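(* Let $X$ be a normed space and $B$ be the closed unit ball of $X$. Then the following conditions are equivalent: (1) $(X,\mathrm{weak})$ is $k^*$-metrizable; (2) $(X,\mathrm{weak})$ is $\mathrm{cs}^*$-metrizable; (3) $(B,\mathrm{weak})$ is $k^*$-metrizable; (4) $(B,\mathrm{weak})$ is $\mathrm{cs}^*$-metrizable. Moreover, if the completion of $X$ contains no isomorphic copy of $l^1$, then the conditions (1)--(3) are equivalent to (5) $(B,\mathrm{weak})$ is $\mathrm{cs}$-metrizable; (6) $(B,\mathrm{weak})$ is $k$-metrizable; (7) $(B,\mathrm{weak})$ is metrizable; (8) $X^*$ is separable.
   Context: $(X,\mathrm{weak})$ and $(B,\mathrm{weak})$ denote $X$ and $B$ with the weak topology of $X$; $X^*$ is the dual Banach space (norm topology); $l^1$ is the Banach space of absolutely summable sequences. All topological spaces are Hausdorff; "map" means continuous function. A subset is precompact if its closure is compact. A map $f:M\to Y$ is proper if $f^{-1}(K)$ is precompact in $M$ for every precompact $K\subset Y$; it is subproper if there is $Z\subset M$ with $f(Z)=Y$ such that $Z\cap f^{-1}(K)$ is precompact in $M$ for every precompact $K\subset Y$. A space is $k$-metrizable (resp. $k^*$-metrizable) if it is the image of a metrizable space under a proper (resp. subproper) map. A section of a map $f:M\to Y$ is a (possibly discontinuous) function $s:Y\to M$ with $f\circ s=\mathrm{id}_Y$. A function $s:Y\to M$ is sequentially continuous if for every convergent sequence $(y_n)$ in $Y$ the sequence $(s(y_n))$ converges in $M$; it is $\mathrm{cs}^*$-continuous if for every convergent sequence $(y_n)$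 in $Y$ the sequence $(s(y_n))$ has an accumulation point in $M$ (a point each of whose neighborhoods contains $s(y_n)$ for infinitely many $n$). A space $Y$ is $\mathrm{cs}$-metrizable (resp. $\mathrm{cs}^*$-metrizable) if it is the image of a metrizable space $M$ under a map $\pi:M\to Y$ having a sequentially continuous (resp. $\mathrm{cs}^*$-continuous) section. *)

theory Defs
  imports "HOL-Analysis.Analysis"
begin

definition precompact_in :: "'a topology \<Rightarrow> 'a set \<Rightarrow> bool" where
  "precompact_in Y K \<longleftrightarrow> K \<subseteq> topspace Y \<and> compactin Y (Y closure_of K)"

text \<open>
  The library constant \<^const>\<open>proper_map\<close> (closed with compact fibres) is a different notion,
  hence the prefix. Both notions include continuity.
\<close>

definition pc_proper_map :: "'m topology \<Rightarrow> 'y topology \<Rightarrow> ('m \<Rightarrow> 'y) \<Rightarrow> bool" where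
  "pc_proper_map M Y f \<longleftrightarrow> continuous_map M Y f \<and>
     (\<forall>K. precompact_in Y K \<longrightarrow> precompact_in M {x \<in> topspace M. f x \<in> K})"

definition pc_subproper_map :: "'m topology \<Rightarrow> 'y topology \<Rightarrow> ('m \<Rightarrow> 'y) \<Rightarrow> bool" where
  "pc_subproper_map M Y f \<longleftrightarrow> continuous_map M Y f \<and>
     (\<exists>Z \<subseteq> topspace M. f ` Z = topspace Y \<and>
        (\<forall>K. precompact_in Y K \<longrightarrow> precompact_in M {x \<in> Z. f x \<in> K}))"

definition section_of :: "'m topology \<Rightarrow> 'y topology \<Rightarrow> ('m \<Rightarrow> 'y) \<Rightarrow> ('y \<Rightarrow> 'm) \<Rightarrow> bool" where
  "section_of M Y f s \<longleftrightarrow> s \<in> topspace Y \<rightarrow> topspace M \<and> (\<forall>y \<in> topspace Y. f (s y) = y)"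

definition convergent_seq_in :: "'a topology \<Rightarrow> (nat \<Rightarrow> 'a) \<Rightarrow> bool" where
  "convergent_seq_in Y y \<longleftrightarrow> range y \<subseteq> topspace Y \<and> (\<exists>l. limitin Y y l sequentially)"

definition accumulation_point_in :: "'a topology \<Rightarrow> (nat \<Rightarrow> 'a) \<Rightarrow> 'a \<Rightarrow> bool" where
  "accumulation_point_in M x a \<longleftrightarrow> a \<in> topspace M \<and>
     (\<forall>U. openin M U \<and> a \<in> U \<longrightarrow> infinite {n. x n \<in> U})"

definition seq_continuous_map :: "'y topology \<Rightarrow> 'm topology \<Rightarrow> ('y \<Rightarrow> 'm) \<Rightarrow> bool" where
  "seq_continuous_map Y M s \<longleftrightarrow> s \<in> topspace Y \<rightarrow> topspace M \<and>
     (\<forall>y. convergent_seq_in Y y \<longrightarrow> convergent_seq_in M (s \<circ> y))"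

definition cs_star_continuous_map :: "'y topology \<Rightarrow> 'm topology \<Rightarrow> ('y \<Rightarrow> 'm) \<Rightarrow> bool" where
  "cs_star_continuous_map Y M s \<longleftrightarrow> s \<in> topspace Y \<rightarrow> topspace M \<and>
     (\<forall>y. convergent_seq_in Y y \<longrightarrow> (\<exists>a. accumulation_point_in M (s \<circ> y) a))"

text \<open>
  Each definition asks for some metrizable space \<open>M\<close> mapping onto \<open>Y\<close>. HOL cannot quantify over
  the carrier type of \<open>M\<close> inside a formula, so the definitions take \<open>M\<close> to be carried by a subset
  of the type \<^typ>\<open>nat \<Rightarrow> 'y\<close>. This is no restriction: the lemmas \<open>k_metrizableI\<close>,
  \<open>k_star_metrizableI\<close>, \<open>cs_metrizableI\<close> and \<open>cs_star_metrizableI\<close> below show that a witness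
  \<open>M\<close> on any type whatsoever can be replaced by one on \<^typ>\<open>nat \<Rightarrow> 'y\<close>.
  The Hausdorff axiom is not repeated for \<open>Y\<close>: weak topologies of normed spaces satisfy it.
\<close>

definition k_metrizable :: "'y topology \<Rightarrow> bool" where
  "k_metrizable Y \<longleftrightarrow> (\<exists>(M :: (nat \<Rightarrow> 'y) topology) f.
     metrizable_space M \<and> pc_proper_map M Y f \<and> f ` topspace M = topspace Y)"

definition k_star_metrizable :: "'y topology \<Rightarrow> bool" where
  "k_star_metrizable Y \<longleftrightarrow> (\<exists>(M :: (nat \<Rightarrow> 'y) topology) f.
     metrizable_space M \<and> pc_subproper_map M Y f \<and> f ` topspace M = topspace Y)"

definition cs_metrizable :: "'y topology \<Rightarrow> bool" where
  "cs_metrizable Y \<longleftrightarrow> (\<exists>(M :: (nat \<Rightarrow> 'y) topology) f s.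
     metrizable_space M \<and> continuous_map M Y f \<and> f ` topspace M = topspace Y \<and>
     section_of M Y f s \<and> seq_continuous_map Y M s)"

definition cs_star_metrizable :: "'y topology \<Rightarrow> bool" where
  "cs_star_metrizable Y \<longleftrightarrow> (\<exists>(M :: (nat \<Rightarrow> 'y) topology) f s.
     metrizable_space M \<and> continuous_map M Y f \<and> f ` topspace M = topspace Y \<and>
     section_of M Y f s \<and> cs_star_continuous_map Y M s)"

text \<open>
  The closure of the image of a section is all that matters, and a point of this closure is coded
  by the \<open>f\<close>-image of a sequence in the image of the section converging to it.
\<close>

lemma section_closure_carrier:
  fixes M :: "'m topology" and Y :: "'y topology"
  assumes M: "metrizable_space M" and s: "section_of M Y f s"
  obtains N :: "(nat \<Rightarrow> 'y) topology" and h
  where "metrizable_space N"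
    and "homeomorphic_map N (subtopology M (M closure_of (s ` topspace Y))) h"
proof -
  define A where "A = M closure_of (s ` topspace Y)"
  have sub: "s ` topspace Y \<subseteq> topspace M"
    using s by (auto simp: section_of_def)
  have A_sub: "A \<subseteq> topspace M"
    by (simp add: A_def closure_of_subset_topspace)
  have "\<exists>\<tau>. limitin M (s \<circ> \<tau>) x sequentially" if x: "x \<in> A" for x
  proof -
    obtain S d where Sd: "Metric_space S d" "M = Metric_space.mtopology S d"
      using M unfolding metrizable_space_def by blast
    interpret Metric_space S d by (rule Sd(1))
    obtain \<sigma> where \<sigma>: "range \<sigma> \<subseteq> s ` topspace Y \<inter> S" "limitin mtopology \<sigma> x sequentially"
      using x unfolding A_def Sd(2) closure_of_sequentially by blast
    have "s \<circ> (f \<circ> \<sigma>) = \<sigma>"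
    proof
      fix n
      have "\<sigma> n \<in> s ` topspace Y" using \<sigma>(1) by auto
      then show "(s \<circ> (f \<circ> \<sigma>)) n = \<sigma> n"
        using s by (auto simp: section_of_def)
    qed
    then show ?thesis using \<sigma>(2) Sd(2) by metis
  qed
  then obtain e where e: "\<And>x. x \<in> A \<Longrightarrow> limitin M (s \<circ> e x) x sequentially"
    by metis
  have inj: "inj_on e A"
  proof (rule inj_onI)
    fix x y assume "x \<in> A" "y \<in> A" "e x = e y"
    then show "x = y"
      using e[of x] e[of y] metrizable_imp_Hausdorff_space[OF M]
        limitin_Hausdorff_unique[of M "s \<circ> e x" x sequentially y] by simp
  qed
  define h where "h = inv_into A e"
  define N where "N = pullback_topology (e ` A) h (subtopology M A)"
  have h_img: "h ` e ` A = A" and h_inj: "inj_on h (e ` A)"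
    using inj by (auto simp: h_def inj_on_inv_into)
  have h_e: "h (e x) = x" if "x \<in> A" for x
    using that inj by (simp add: h_def)
  have topN: "topspace N = e ` A"
    using A_sub h_e by (auto simp: N_def topspace_pullback_topology)
  have "homeomorphic_map N (subtopology M A) h"
  proof (rule bijective_open_imp_homeomorphic_map)
    show "continuous_map N (subtopology M A) h"
      unfolding N_def by (rule continuous_map_pullback[OF continuous_map_id, simplified])
    show "open_map N (subtopology M A) h"
      unfolding open_map_def
    proof (intro allI impI)
      fix V assume "openin N V"
      then obtain U where U: "openin (subtopology M A) U" "V = h -` U \<inter> e ` A"
        by (auto simp: N_def openin_pullback_topology)
      then have "U \<subseteq> A" using openin_subset by fastforce
      have "h ` V = U"
      proof
        show "h ` V \<subseteq> U" using U(2) by auto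
        show "U \<subseteq> h ` V"
        proof
          fix x assume "x \<in> U"
          then have "e x \<in> V" "h (e x) = x"
            using U(2) h_e[of x] \<open>U \<subseteq> A\<close> by auto
          then show "x \<in> h ` V" by (metis imageI)
        qed
      qed
      then show "openin (subtopology M A) (h ` V)" using U(1) by simp
    qed
    show "h ` topspace N = topspace (subtopology M A)"
      using h_img topN A_sub by auto
    show "inj_on h (topspace N)" using h_inj topN by simp
  qed
  moreover have "metrizable_space N"
    using calculation M homeomorphic_metrizable_space homeomorphic_map_imp_homeomorphic_space
      metrizable_space_subtopology by metis
  ultimately show thesis using that A_def by blast
qed

lemma precompact_in_subset:
  "precompact_in M P \<Longrightarrow> Q \<subseteq> P \<Longrightarrow> precompact_in M Q"
  unfolding precompact_in_def
  using closed_compactin[OF _ closure_of_mono closedin_closure_of] by blast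

lemma precompact_in_preimage:
  assumes h: "homeomorphic_map N (subtopology M A) h" and A: "closedin M A"
    and P: "precompact_in M P"
  shows "precompact_in N {x \<in> topspace N. h x \<in> P}"
proof -
  let ?C = "{x \<in> topspace N. h x \<in> M closure_of P}"
  have "proper_map N M h"
    using h A closedin_subset[OF A]
    by (metis homeomorphic_imp_closed_map closed_injective_imp_proper_map homeomorphic_imp_injective_map
        closed_map_from_closed_subtopology closed_map_in_subtopology)
  then have "compactin N ?C"
    using P by (simp add: compactin_proper_map_preimage precompact_in_def)
  moreover have "closedin N ?C"
  proof (rule closedin_continuous_map_preimage[where Y = M])
    show "continuous_map N M h"
      using h homeomorphic_imp_continuous_map continuous_map_in_subtopology by blast
  qed auto
  moreover have "{x \<in> topspace N. h x \<in> P} \<subseteq> ?C"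
    using P closure_of_subset[of P M] by (auto simp: precompact_in_def)
  ultimately have "compactin N (N closure_of {x \<in> topspace N. h x \<in> P})"
    using closed_compactin[OF _ closure_of_minimal closedin_closure_of] by blast
  then show ?thesis by (auto simp: precompact_in_def)
qed

lemma section_transfer:
  assumes s: "section_of M Y f s" and f: "continuous_map M Y f"
    and h: "homeomorphic_map N (subtopology M (M closure_of (s ` topspace Y))) h"
  obtains t where "section_of N Y (f \<circ> h) t" "\<And>y. y \<in> topspace Y \<Longrightarrow> h (t y) = s y"
    and "continuous_map N Y (f \<circ> h)" and "(f \<circ> h) ` topspace N = topspace Y"
proof -
  let ?A = "M closure_of (s ` topspace Y)"
  define t where "t y = inv_into (topspace N) h (s y)" for y
  have sA: "s y \<in> h ` topspace N" if "y \<in> topspace Y" for y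
  proof -
    have "s ` topspace Y \<subseteq> topspace M" using s by (auto simp: section_of_def)
    then have "s y \<in> topspace (subtopology M ?A)"
      using that closure_of_subset[of "s ` topspace Y" M] by auto
    then show ?thesis
      using homeomorphic_imp_surjective_map[OF h] by simp
  qed
  have ht: "h (t y) = s y" and tN: "t y \<in> topspace N" if "y \<in> topspace Y" for y
    unfolding t_def using sA[OF that] by (auto simp: f_inv_into_f inv_into_into)
  have sec: "section_of N Y (f \<circ> h) t"
    using s ht tN by (auto simp: section_of_def)
  have cont: "continuous_map N Y (f \<circ> h)"
    using f h homeomorphic_imp_continuous_map continuous_map_in_subtopology
      continuous_map_compose by metis
  have "(f \<circ> h) ` topspace N = topspace Y"
  proof
    show "(f \<circ> h) ` topspace N \<subseteq> topspace Y"
      using cont continuous_map_image_subset_topspace by blast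
    show "topspace Y \<subseteq> (f \<circ> h) ` topspace N"
      using sec by (force simp: section_of_def)
  qed
  then show thesis using that sec ht cont by blast
qed

lemma limitin_homeomorphic_preimage:
  assumes h: "homeomorphic_map N M' h" and z: "range z \<subseteq> topspace N"
    and lim: "limitin M' (h \<circ> z) l F"
  shows "\<exists>m. limitin N z m F"
proof -
  obtain g where g: "homeomorphic_maps N M' h g"
    using h homeomorphic_map_maps by blast
  then have "limitin N (g \<circ> (h \<circ> z)) (g l) F"
    using lim continuous_map_limit homeomorphic_maps_def by metis
  moreover have "g \<circ> (h \<circ> z) = z"
    using g z by (auto simp: homeomorphic_maps_def fun_eq_iff range_subsetD)
  ultimately show ?thesis by auto
qed

lemma k_metrizableI:
  fixes M :: "'m topology" and Y :: "'y topology"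
  assumes M: "metrizable_space M" and f: "pc_proper_map M Y f" "f ` topspace M = topspace Y"
  shows "k_metrizable Y"
proof -
  obtain s where s: "section_of M Y f s"
    using f(2) unfolding section_of_def
    by (metis (no_types, lifting) Pi_I f_inv_into_f inv_into_into)
  obtain N :: "(nat \<Rightarrow> 'y) topology" and h where N: "metrizable_space N"
    and h: "homeomorphic_map N (subtopology M (M closure_of (s ` topspace Y))) h"
    using section_closure_carrier[OF M s] .
  have f': "continuous_map M Y f"
    using f(1) by (simp add: pc_proper_map_def)
  obtain t where t: "continuous_map N Y (f \<circ> h)" "(f \<circ> h) ` topspace N = topspace Y"
    using section_transfer[OF s f' h] .
  have hM: "h x \<in> topspace M" if "x \<in> topspace N" for x
    using homeomorphic_imp_surjective_map[OF h] that by auto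
  have "precompact_in N {x \<in> topspace N. (f \<circ> h) x \<in> K}" if "precompact_in Y K" for K
  proof -
    have "precompact_in N {x \<in> topspace N. h x \<in> {x \<in> topspace M. f x \<in> K}}"
      using f(1) that
      by (intro precompact_in_preimage[OF h closedin_closure_of]) (auto simp: pc_proper_map_def)
    then show ?thesis
      by (rule precompact_in_subset) (use hM in auto)
  qed
  then show ?thesis
    unfolding k_metrizable_def pc_proper_map_def using N t by blast
qed

lemma k_star_metrizableI:
  fixes M :: "'m topology" and Y :: "'y topology"
  assumes M: "metrizable_space M" and f: "pc_subproper_map M Y f"
  shows "k_star_metrizable Y"
proof -
  have f': "continuous_map M Y f"
    using f by (simp add: pc_subproper_map_def)
  obtain Z where Z: "Z \<subseteq> topspace M" "f ` Z = topspace Y"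
    and pc: "\<And>K. precompact_in Y K \<Longrightarrow> precompact_in M {x \<in> Z. f x \<in> K}"
    using f unfolding pc_subproper_map_def by blast
  define s where "s = inv_into Z f"
  have sZ: "s y \<in> Z" and fs: "f (s y) = y" if "y \<in> topspace Y" for y
    unfolding s_def using that Z(2) by (auto simp: inv_into_into f_inv_into_f)
  have s: "section_of M Y f s"
    using sZ fs Z(1) by (auto simp: section_of_def)
  obtain N :: "(nat \<Rightarrow> 'y) topology" and h where N: "metrizable_space N"
    and h: "homeomorphic_map N (subtopology M (M closure_of (s ` topspace Y))) h"
    using section_closure_carrier[OF M s] .
  obtain t where t: "section_of N Y (f \<circ> h) t" "\<And>y. y \<in> topspace Y \<Longrightarrow> h (t y) = s y"
    "continuous_map N Y (f \<circ> h)" "(f \<circ> h) ` topspace N = topspace Y"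
    using section_transfer[OF s f' h] by blast
  let ?Z = "t ` topspace Y"
  have Z': "?Z \<subseteq> topspace N" "(f \<circ> h) ` ?Z = topspace Y"
    using t(1) by (force simp: section_of_def)+
  have "precompact_in N {x \<in> ?Z. (f \<circ> h) x \<in> K}" if "precompact_in Y K" for K
  proof -
    have "precompact_in N {x \<in> topspace N. h x \<in> {x \<in> Z. f x \<in> K}}"
      using precompact_in_preimage[OF h closedin_closure_of pc[OF that]] .
    then show ?thesis
      by (rule precompact_in_subset) (use Z' t(2) sZ in auto)
  qed
  then have "pc_subproper_map N Y (f \<circ> h)"
    unfolding pc_subproper_map_def using t(3) Z' by blast
  then show ?thesis
    unfolding k_star_metrizable_def using N t(4) by blast
qed

lemma cs_metrizableI:
  fixes M :: "'m topology" and Y :: "'y topology"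
  assumes M: "metrizable_space M" and f: "continuous_map M Y f"
    and s: "section_of M Y f s" "seq_continuous_map Y M s"
  shows "cs_metrizable Y"
proof -
  let ?A = "M closure_of (s ` topspace Y)"
  obtain N :: "(nat \<Rightarrow> 'y) topology" and h where N: "metrizable_space N"
    and h: "homeomorphic_map N (subtopology M ?A) h"
    using section_closure_carrier[OF M s(1)] .
  obtain t where t: "section_of N Y (f \<circ> h) t" "\<And>y. y \<in> topspace Y \<Longrightarrow> h (t y) = s y"
    "continuous_map N Y (f \<circ> h)" "(f \<circ> h) ` topspace N = topspace Y"
    using section_transfer[OF s(1) f h] by blast
  have tN: "t \<in> topspace Y \<rightarrow> topspace N"
    using t(1) by (simp add: section_of_def)
  have hA: "h x \<in> ?A" if "x \<in> topspace N" for x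
    using homeomorphic_imp_surjective_map[OF h] that by auto
  have "convergent_seq_in N (t \<circ> y)" if y: "convergent_seq_in Y y" for y
  proof -
    have yY: "range y \<subseteq> topspace Y" using y by (simp add: convergent_seq_in_def)
    have r: "range (t \<circ> y) \<subseteq> topspace N" using yY tN by auto
    have eq: "h \<circ> (t \<circ> y) = s \<circ> y" using yY t(2) by (auto simp: fun_eq_iff range_subsetD)
    obtain l where l: "limitin M (s \<circ> y) l sequentially"
      using s(2) y unfolding seq_continuous_map_def convergent_seq_in_def by blast
    have inA: "(s \<circ> y) n \<in> ?A" for n
    proof -
      have "(t \<circ> y) n \<in> topspace N" using r by blast
      then show ?thesis using hA[of "(t \<circ> y) n"] fun_cong[OF eq, of n] by simp
    qed
    have "l \<in> ?A"
      by (rule limitin_closedin[OF l closedin_closure_of]) (use inA in auto)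
    then have "limitin (subtopology M ?A) (h \<circ> (t \<circ> y)) l sequentially"
      using l inA eq by (simp add: limitin_subtopology)
    then show ?thesis
      unfolding convergent_seq_in_def using r limitin_homeomorphic_preimage[OF h r] by blast
  qed
  then show ?thesis
    unfolding cs_metrizable_def seq_continuous_map_def using N t tN by blast
qed

lemma cs_star_metrizableI:
  fixes M :: "'m topology" and Y :: "'y topology"
  assumes M: "metrizable_space M" and f: "continuous_map M Y f"
    and s: "section_of M Y f s" "cs_star_continuous_map Y M s"
  shows "cs_star_metrizable Y"
proof -
  let ?A = "M closure_of (s ` topspace Y)"
  obtain N :: "(nat \<Rightarrow> 'y) topology" and h where N: "metrizable_space N"
    and h: "homeomorphic_map N (subtopology M ?A) h"
    using section_closure_carrier[OF M s(1)] .
  obtain t where t: "section_of N Y (f \<circ> h) t" "\<And>y. y \<in> topspace Y \<Longrightarrow> h (t y) = s y"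
    "continuous_map N Y (f \<circ> h)" "(f \<circ> h) ` topspace N = topspace Y"
    using section_transfer[OF s(1) f h] by blast
  have tN: "t \<in> topspace Y \<rightarrow> topspace N"
    using t(1) by (simp add: section_of_def)
  have "\<exists>b. accumulation_point_in N (t \<circ> y) b" if y: "convergent_seq_in Y y" for y
  proof -
    have yY: "y n \<in> topspace Y" for n using y by (auto simp: convergent_seq_in_def)
    obtain a where a: "accumulation_point_in M (s \<circ> y) a"
      using s(2) y by (auto simp: cs_star_continuous_map_def)
    have "a \<in> ?A"
      unfolding in_closure_of
    proof (intro conjI allI impI)
      show "a \<in> topspace M" using a by (simp add: accumulation_point_in_def)
      fix T assume "a \<in> T \<and> openin M T"
      then have "infinite {n. (s \<circ> y) n \<in> T}" using a by (simp add: accumulation_point_in_def)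
      then obtain n where "(s \<circ> y) n \<in> T" using not_finite_existsD by blast
      then show "\<exists>z. z \<in> s ` topspace Y \<and> z \<in> T" using yY by auto
    qed
    then have "a \<in> h ` topspace N"
      using homeomorphic_imp_surjective_map[OF h] a by (auto simp: accumulation_point_in_def)
    then obtain b where b: "b \<in> topspace N" "h b = a" by blast
    have "infinite {n. (t \<circ> y) n \<in> U}" if U: "openin N U" "b \<in> U" for U
    proof -
      have "openin (subtopology M ?A) (h ` U)"
        using h U(1) homeomorphic_imp_open_map open_map_def by blast
      then obtain V where V: "openin M V" "h ` U = V \<inter> ?A"
        by (auto simp: openin_subtopology)
      have "a \<in> V" using U(2) b(2) V(2) by auto
      then have inf: "infinite {n. (s \<circ> y) n \<in> V}"
        using a V(1) by (simp add: accumulation_point_in_def)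
      have "t (y n) \<in> U" if "s (y n) \<in> V" for n
      proof -
        have tn: "t (y n) \<in> topspace N" using tN yY by auto
        then have "h (t (y n)) \<in> ?A"
          using homeomorphic_imp_surjective_map[OF h] by auto
        then have "h (t (y n)) \<in> h ` U"
          using V(2) that t(2)[OF yY] by auto
        then show ?thesis
          using tn openin_subset[OF U(1)] homeomorphic_imp_injective_map[OF h]
          by (meson inj_on_image_mem_iff)
      qed
      then have "{n. (s \<circ> y) n \<in> V} \<subseteq> {n. (t \<circ> y) n \<in> U}" by auto
      from infinite_super[OF this inf] show ?thesis .
    qed
    then show ?thesis
      unfolding accumulation_point_in_def using b(1) by blast
  qed
  then show ?thesis
    unfolding cs_star_metrizable_def cs_star_continuous_map_def using N t tN by blast
qed

definition weak_topology :: "'a::real_normed_vector topology" where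
  "weak_topology =
     topology_generated_by {\<phi> -` U | \<phi> U. bounded_linear (\<phi> :: 'a \<Rightarrow> real) \<and> open U}"

lemma topspace_weak_topology [simp]: "topspace weak_topology = UNIV"
proof -
  have "(\<lambda>_. 0) -` UNIV \<in> {\<phi> -` U | \<phi> U. bounded_linear (\<phi> :: 'a \<Rightarrow> real) \<and> open U}"
    using bounded_linear_zero open_UNIV by blast
  then show ?thesis
    unfolding weak_topology_def topology_generated_by_topspace by auto
qed

typedef l1 = "{a :: nat \<Rightarrow> real. summable (\<lambda>n. \<bar>a n\<bar>)}"
  morphisms l1_nth Abs_l1
  by (rule exI[of _ "\<lambda>_. 0"]) simp

setup_lifting type_definition_l1

lemma l1_nth_summable: "summable (\<lambda>n. \<bar>l1_nth a n\<bar>)"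
  using l1_nth[of a] by simp

instantiation l1 :: real_vector
begin

lift_definition zero_l1 :: l1 is "\<lambda>_. 0" by simp

lift_definition plus_l1 :: "l1 \<Rightarrow> l1 \<Rightarrow> l1" is "\<lambda>a b n. a n + b n"
proof -
  fix a b :: "nat \<Rightarrow> real"
  assume "summable (\<lambda>n. \<bar>a n\<bar>)" "summable (\<lambda>n. \<bar>b n\<bar>)"
  then have "summable (\<lambda>n. \<bar>a n\<bar> + \<bar>b n\<bar>)" by (rule summable_add)
  then show "summable (\<lambda>n. \<bar>a n + b n\<bar>)"
    by (rule summable_comparison_test') (simp add: abs_triangle_ineq)
qed

lift_definition uminus_l1 :: "l1 \<Rightarrow> l1" is "\<lambda>a n. - a n" by simp

lift_definition minus_l1 :: "l1 \<Rightarrow> l1 \<Rightarrow> l1" is "\<lambda>a b n. a n - b n"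
proof -
  fix a b :: "nat \<Rightarrow> real"
  assume "summable (\<lambda>n. \<bar>a n\<bar>)" "summable (\<lambda>n. \<bar>b n\<bar>)"
  then have "summable (\<lambda>n. \<bar>a n\<bar> + \<bar>b n\<bar>)" by (rule summable_add)
  then show "summable (\<lambda>n. \<bar>a n - b n\<bar>)"
    by (rule summable_comparison_test') (simp add: abs_triangle_ineq4)
qed

lift_definition scaleR_l1 :: "real \<Rightarrow> l1 \<Rightarrow> l1" is "\<lambda>c a n. c * a n"
  by (simp add: abs_mult summable_mult)

instance
  by standard (transfer; simp add: algebra_simps)+

end

instantiation l1 :: real_normed_vector
begin

definition norm_l1 :: "l1 \<Rightarrow> real" where
  "norm_l1 a = (\<Sum>n. \<bar>l1_nth a n\<bar>)"

definition sgn_l1 :: "l1 \<Rightarrow> l1" where "sgn_l1 a = a /\<^sub>R norm a"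

definition dist_l1 :: "l1 \<Rightarrow> l1 \<Rightarrow> real" where "dist_l1 a b = norm (a - b)"

definition uniformity_l1 :: "(l1 \<times> l1) filter" where
  "uniformity_l1 = (INF e\<in>{0<..}. principal {(a, b). dist a b < e})"

definition open_l1 :: "l1 set \<Rightarrow> bool" where
  "open_l1 U \<longleftrightarrow> (\<forall>a\<in>U. \<forall>\<^sub>F (a', b) in uniformity. a' = a \<longrightarrow> b \<in> U)"

instance
proof
  fix a b :: l1 and r :: real
  show "norm a = 0 \<longleftrightarrow> a = 0"
  proof
    assume "norm a = 0"
    then have "\<forall>n. l1_nth a n = 0"
      using suminf_eq_zero_iff[OF l1_nth_summable[of a]] by (simp add: norm_l1_def)
    then show "a = 0" by transfer auto
  qed (simp add: norm_l1_def zero_l1.rep_eq)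
  show "norm (a + b) \<le> norm a + norm b"
    unfolding norm_l1_def suminf_add[OF l1_nth_summable l1_nth_summable]
    by (rule suminf_le[OF _ l1_nth_summable summable_add[OF l1_nth_summable l1_nth_summable]])
      (simp add: plus_l1.rep_eq abs_triangle_ineq)
  show "norm (r *\<^sub>R a) = \<bar>r\<bar> * norm a"
    by (simp add: norm_l1_def scaleR_l1.rep_eq abs_mult suminf_mult[OF l1_nth_summable])
qed (rule sgn_l1_def dist_l1_def uniformity_l1_def open_l1_def)+

end

text \<open>
  \<open>C\<close> is a completion of the normed space \<^typ>\<open>'a\<close> via \<open>j\<close>: the closure of the image of a linear
  isometry into a Banach space. It may be all of \<^typ>\<open>'c\<close> or, for instance, the closure of the
  canonical image in the bidual. The pair is unique up to isometric isomorphism.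
\<close>

definition is_completion :: "('a::real_normed_vector \<Rightarrow> 'c::banach) \<Rightarrow> 'c set \<Rightarrow> bool" where
  "is_completion j C \<longleftrightarrow> linear j \<and> (\<forall>x. norm (j x) = norm x) \<and> C = closure (range j)"

definition contains_copy_of_l1 :: "'c::real_normed_vector set \<Rightarrow> bool" where
  "contains_copy_of_l1 C \<longleftrightarrow>
     (\<exists>(T :: l1 \<Rightarrow> 'c) S. linear T \<and> range T \<subseteq> C \<and> homeomorphism UNIV (range T) T S)"

end

theory Submission
  imports Defs
begin

text \<open>
  Weakly compact sets are sequentially compact, which makes cs*- and k*-metrizability agree; weakly
  convergent sequences are bounded, so the whole space is covered by countably many copies of the
  ball witness. Without copies of \<open>l1\<close>, a point in the weak closure of a bounded set is the limit of
  a sequence from that set: this needs neither Rosenthal's theorem nor the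
  Bourgain--Fremlin--Talagrand theorem, but follows from a direct dichotomy along an ultrafilter.
  Given a cs*-continuous section, this forces the weak topology of the ball to have a countable
  base at \<open>0\<close>, and the functionals that define such a base span a dense subspace of the dual.
\<close>

subsection \<open>The Hahn--Banach theorem\<close>

text \<open>The difficulty in the last step is that a cs*-continuous section need not send a weakly
  null sequence to a convergent one: the images merely accumulate, and at different points of
  \<open>M\<close> for different sequences. All these points lie in the fibre over \<open>0\<close>,
  but countably many metric neighbourhoods of a set form a base of its neighbourhoods only under
  some compactness. The required precompactness comes from a diagonal property: out of countably
  many weakly null sequences in the ball one can pick a weakly null sequence whose terms come from
  rows tending to infinity. This is extracted from the sequential description of weak closures,
  applied to rows shifted by small vectors.

  The dichotomy behind that description works over countable sets, because it removes a countable
  family of pieces from the dual ball. Hence Kaplansky's theorem, which passes to a countable subset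
  that still has \<open>0\<close> in its weak closure, has to come before it.\<close>

definition sublinear :: "('a::real_vector \<Rightarrow> real) \<Rightarrow> bool" where
  "sublinear p \<longleftrightarrow> (\<forall>x y. p (x + y) \<le> p x + p y) \<and> (\<forall>t x. t > 0 \<longrightarrow> p (t *\<^sub>R x) = t * p x)"

lemma sublinearD:
  assumes "sublinear p"
  shows sublinear_add: "p (x + y) \<le> p x + p y"
    and sublinear_scale: "t > 0 \<Longrightarrow> p (t *\<^sub>R x) = t * p x"
    and sublinear_zero: "p 0 = 0"
    and sublinear_minus: "- p (- x) \<le> p x"
proof -
  show "p (x + y) \<le> p x + p y" "t > 0 \<Longrightarrow> p (t *\<^sub>R x) = t * p x" for t x y
    using assms by (auto simp: sublinear_def)
  have "p (2 *\<^sub>R 0) = 2 * p 0"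
    using assms unfolding sublinear_def by (metis zero_less_numeral)
  then show z: "p 0 = 0" by simp
  have "p (x + - x) \<le> p x + p (- x)"
    using assms unfolding sublinear_def by blast
  then show "- p (- x) \<le> p x" using z by simp
qed

text \<open>A pair \<open>(u, c)\<close> in \<open>H\<close> encodes the demand
  \<open>c \<le> g u\<close> on a linear functional \<open>g\<close>. The infimum gives
  \<open>q (- u) \<le> p 0 - c = - c\<close>, so a linear functional below \<open>q\<close> meets
  every demand, while \<open>q \<le> p\<close> keeps it dominated by \<open>p\<close>. Demands
  compatible with \<open>p\<close> leave the infimum finite.\<close>

lemma sublinear_infimum_cone:
  fixes p :: "'a::real_vector \<Rightarrow> real" and H :: "('a \<times> real) set"
  defines "q \<equiv> \<lambda>y. INF (u, c)\<in>H. p (y + u) - c"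
  assumes p: "sublinear p" and zero: "(0, 0) \<in> H"
    and add: "\<And>u c v d. (u, c) \<in> H \<Longrightarrow> (v, d) \<in> H \<Longrightarrow> (u + v, c + d) \<in> H"
    and scale: "\<And>u c t. (u, c) \<in> H \<Longrightarrow> t > 0 \<Longrightarrow> (t *\<^sub>R u, t * c) \<in> H"
    and le: "\<And>u c. (u, c) \<in> H \<Longrightarrow> c \<le> p u"
  shows "sublinear q" and "\<And>y. q y \<le> p y" and "\<And>u c y. (u, c) \<in> H \<Longrightarrow> q y \<le> p (y + u) - c"
proof -
  have bdd: "bdd_below ((\<lambda>(u, c). p (y + u) - c) ` H)" for y
  proof (rule bdd_belowI2[of _ "- p (- y)"], clarify)
    fix u c assume "(u, c) \<in> H"
    then have "c \<le> p u" by (rule le)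
    also have "p u \<le> p (- y) + p (y + u)"
      using sublinear_add[OF p, of "- y" "y + u"] by simp
    finally show "- p (- y) \<le> p (y + u) - c" by simp
  qed
  show lower: "q y \<le> p (y + u) - c" if "(u, c) \<in> H" for u c y
    unfolding q_def using cINF_lower[OF bdd that] by auto
  show "q y \<le> p y" for y
    using lower[OF zero, of y] by simp
  have greatest: "m \<le> q y" if "\<And>u c. (u, c) \<in> H \<Longrightarrow> m \<le> p (y + u) - c" for m y
    unfolding q_def using zero that by (intro cINF_greatest) auto
  have scale_le: "t * q y \<le> q (t *\<^sub>R y)" if t: "t > 0" for t y
  proof (rule greatest)
    fix u c assume "(u, c) \<in> H"
    then have "((1 / t) *\<^sub>R u, (1 / t) * c) \<in> H" by (rule scale) (use t in simp)
    then have "t * q y \<le> t * (p (y + (1 / t) *\<^sub>R u) - (1 / t) * c)"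
      using t lower by (intro mult_left_mono) auto
    also have "\<dots> = t * p (y + (1 / t) *\<^sub>R u) - c"
      using t by (simp add: algebra_simps)
    also have "\<dots> = p (t *\<^sub>R (y + (1 / t) *\<^sub>R u)) - c"
      using sublinear_scale[OF p t] by simp
    also have "t *\<^sub>R (y + (1 / t) *\<^sub>R u) = t *\<^sub>R y + u"
      using t by (simp add: algebra_simps)
    finally show "t * q y \<le> p (t *\<^sub>R y + u) - c" .
  qed
  show "sublinear q"
    unfolding sublinear_def
  proof (intro conjI allI impI)
    fix x y
    have "q (x + y) - (p (y + v) - d) \<le> q x" if H: "(v, d) \<in> H" for v d
    proof (rule greatest)
      fix u c assume "(u, c) \<in> H"
      then have "q (x + y) \<le> p (x + y + (u + v)) - (c + d)"
        using add H lower by blast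
      also have "x + y + (u + v) = (x + u) + (y + v)" by simp
      also have "p \<dots> \<le> p (x + u) + p (y + v)" by (rule sublinear_add[OF p])
      finally show "q (x + y) - (p (y + v) - d) \<le> p (x + u) - c" by simp
    qed
    then have "q (x + y) - q x \<le> q y"
      by (intro greatest) (simp add: algebra_simps)
    then show "q (x + y) \<le> q x + q y" by simp
  next
    fix t :: real and x assume t: "t > 0"
    have "q (t *\<^sub>R x) = t * ((1 / t) * q (t *\<^sub>R x))" using t by simp
    also have "\<dots> \<le> t * q ((1 / t) *\<^sub>R (t *\<^sub>R x))"
      using t by (intro mult_left_mono scale_le) auto
    also have "(1 / t) *\<^sub>R (t *\<^sub>R x) = x" using t by simp
    finally show "q (t *\<^sub>R x) = t * q x" using scale_le[OF t, of x] by simp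
  qed
qed

text \<open>Lower \<open>q\<close> by the demands on the ray through \<open>(x, q x)\<close>. The
  result is sublinear and below \<open>q\<close>, hence equal to \<open>q\<close> by minimality, and
  its bound at \<open>(x, q x)\<close> is the missing inequality
  \<open>q y + q x \<le> q (y + x)\<close>.\<close>

lemma minimal_sublinear_imp_linear:
  fixes q :: "'a::real_vector \<Rightarrow> real"
  assumes q: "sublinear q"
    and min: "\<And>r. sublinear r \<Longrightarrow> (\<And>y. r y \<le> q y) \<Longrightarrow> r = q"
  shows "linear q"
proof -
  have add: "q (y + x) = q y + q x" for x y
  proof -
    define H where "H = {(t *\<^sub>R x, t * q x) |t. t \<ge> 0}"
    define r where "r y = (INF (u, c)\<in>H. q (y + u) - c)" for y
    have zero: "(0, 0) \<in> H" unfolding H_def by force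
    have sums: "(u + v, c + d) \<in> H" if "(u, c) \<in> H" "(v, d) \<in> H" for u c v d
    proof -
      from that obtain s t where "s \<ge> 0" "t \<ge> 0" "u = s *\<^sub>R x" "c = s * q x" "v = t *\<^sub>R x" "d = t * q x"
        by (auto simp: H_def)
      then show ?thesis
        unfolding H_def by (intro CollectI exI[of _ "s + t"]) (simp add: algebra_simps)
    qed
    have scales: "(t *\<^sub>R u, t * c) \<in> H" if "(u, c) \<in> H" "t > 0" for u c t
    proof -
      from that obtain s where "s \<ge> 0" "u = s *\<^sub>R x" "c = s * q x"
        by (auto simp: H_def)
      then show ?thesis
        unfolding H_def using that(2) by (intro CollectI exI[of _ "t * s"]) simp
    qed
    have le: "c \<le> q u" if "(u, c) \<in> H" for u c
    proof -
      from that obtain s where s: "s \<ge> 0" "u = s *\<^sub>R x" "c = s * q x"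
        by (auto simp: H_def)
      then show ?thesis
        using sublinear_scale[OF q, of s x] sublinear_zero[OF q] by (cases "s = 0") auto
    qed
    note inf = sublinear_infimum_cone[OF q zero sums scales le, folded r_def]
    have "r = q" by (rule min) (use inf(1,2) in auto)
    moreover have "(x, q x) \<in> H" unfolding H_def by force
    ultimately have "q y \<le> q (y + x) - q x" using inf(3) by blast
    then show ?thesis using sublinear_add[OF q, of y x] by simp
  qed
  have neg: "q (- x) = - q x" for x
    using add[of x "- x"] sublinear_zero[OF q] by simp
  show ?thesis
  proof (rule linearI)
    show "q (x + y) = q x + q y" for x y by (rule add)
    show "q (t *\<^sub>R x) = t *\<^sub>R q x" for t x
    proof (cases t "0 :: real" rule: linorder_cases)
      case less
      then have "q (- ((- t) *\<^sub>R x)) = - ((- t) * q x)"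
        by (subst neg) (simp add: sublinear_scale[OF q] del: scaleR_minus_left)
      then show ?thesis by simp
    qed (use sublinear_scale[OF q] sublinear_zero[OF q] in auto)
  qed
qed

lemma exists_linear_below_sublinear:
  fixes p :: "'a::real_vector \<Rightarrow> real"
  assumes p: "sublinear p"
  obtains g where "linear g" "\<And>x. g x \<le> p x"
proof -
  define A where "A = {q. sublinear q \<and> (\<forall>x. q x \<le> p x)}"
  \<comment> \<open>The order is reversed: maximal elements for \<open>P\<close> are the pointwise
    minimal sublinear functions below \<open>p\<close>.\<close>
  define P where "P = (\<lambda>q r :: 'a \<Rightarrow> real. \<forall>x. r x \<le> q x)"
  have "\<exists>m\<in>A. \<forall>a\<in>A. P m a \<longrightarrow> a = m"
  proof (rule predicate_Zorn)
    show "partial_order_on A (relation_of P A)"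
      by (rule partial_order_on_relation_ofI) (auto simp: P_def intro: order_trans intro!: ext antisym)
    fix C assume C: "C \<in> Chains (relation_of P A)"
    have CA: "C \<subseteq> A" using C by (auto simp: Chains_def relation_of_def)
    have chain: "P q r \<or> P r q" if "q \<in> C" "r \<in> C" for q r
      using C that unfolding Chains_def relation_of_def by blast
    show "\<exists>u\<in>A. \<forall>a\<in>C. P a u"
    proof (cases "C = {}")
      case True
      then show ?thesis using p by (auto simp: A_def)
    next
      case False
      define u where "u x = (INF q\<in>C. q x)" for x
      have bdd: "bdd_below ((\<lambda>q. q x) ` C)" for x
      proof (rule bdd_belowI2[of _ "- p (- x)"])
        fix q assume "q \<in> C"
        then have "sublinear q" "q (- x) \<le> p (- x)" using CA by (auto simp: A_def)
        then show "- p (- x) \<le> q x" using sublinear_minus[of q x] by simp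
      qed
      have lower: "u x \<le> q x" if "q \<in> C" for q x
        unfolding u_def by (rule cINF_lower[OF bdd that])
      have greatest: "m \<le> u x" if "\<And>q. q \<in> C \<Longrightarrow> m \<le> q x" for m x
        unfolding u_def using False that by (rule cINF_greatest)
      have slin: "sublinear q" if "q \<in> C" for q using CA that by (auto simp: A_def)
      have sc: "t * u x \<le> u (t *\<^sub>R x)" if t: "t > 0" for t x
        using lower slin t by (intro greatest) (auto simp: sublinear_scale)
      have "sublinear u"
        unfolding sublinear_def
      proof (intro conjI allI impI)
        fix x y
        \<comment> \<open>The infima at \<open>x\<close> and at \<open>y\<close> may be approached
          by different members \<open>q\<close> and \<open>r\<close>; the smaller of the two, which
          exists in a chain, serves both points.\<close>
        have "u (x + y) \<le> q x + r y" if "q \<in> C" "r \<in> C" for q r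
        proof -
          obtain s where s: "s \<in> C" "s x \<le> q x" "s y \<le> r y"
            using chain[OF \<open>q \<in> C\<close> \<open>r \<in> C\<close>] \<open>q \<in> C\<close> \<open>r \<in> C\<close> unfolding P_def by blast
          then show ?thesis
            using lower[OF s(1), of "x + y"] sublinear_add[OF slin[OF s(1)], of x y] by linarith
        qed
        then have "u (x + y) - r y \<le> u x" if "r \<in> C" for r
          using that by (intro greatest) (simp add: algebra_simps)
        then have "u (x + y) - u x \<le> u y"
          by (intro greatest) (simp add: algebra_simps)
        then show "u (x + y) \<le> u x + u y" by simp
      next
        fix t :: real and x assume t: "t > 0"
        have "u (t *\<^sub>R x) = t * ((1 / t) * u (t *\<^sub>R x))" using t by simp
        also have "\<dots> \<le> t * u ((1 / t) *\<^sub>R (t *\<^sub>R x))"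
          using t by (intro mult_left_mono sc) auto
        also have "(1 / t) *\<^sub>R (t *\<^sub>R x) = x" using t by simp
        finally show "u (t *\<^sub>R x) = t * u x" using sc[OF t, of x] by simp
      qed
      moreover have "u x \<le> p x" for x
      proof -
        obtain q where q: "q \<in> C" using False by blast
        then have "q x \<le> p x" using CA by (auto simp: A_def)
        then show ?thesis using lower[OF q, of x] by linarith
      qed
      ultimately show ?thesis using lower by (auto simp: A_def P_def)
    qed
  qed
  then obtain m where m: "m \<in> A" "\<And>a. a \<in> A \<Longrightarrow> P m a \<Longrightarrow> a = m" by blast
  have "linear m"
  proof (rule minimal_sublinear_imp_linear)
    show "sublinear m" using m(1) by (simp add: A_def)
    fix r assume r: "sublinear r" "\<And>y. r y \<le> m y"
    then have "r \<in> A" using m(1) unfolding A_def by (blast intro: order_trans)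
    then show "r = m" using m(2) r(2) by (simp add: P_def)
  qed
  then show thesis using that m(1) by (auto simp: A_def)
qed

text \<open>
  The Mazur--Orlicz form, from which the extension and the separation versions follow by choice
  of the cone \<open>H\<close>.
\<close>

theorem Hahn_Banach_cone:
  fixes p :: "'a::real_vector \<Rightarrow> real"
  assumes p: "sublinear p" and zero: "(0, 0) \<in> H"
    and add: "\<And>u c v d. (u, c) \<in> H \<Longrightarrow> (v, d) \<in> H \<Longrightarrow> (u + v, c + d) \<in> H"
    and scale: "\<And>u c t. (u, c) \<in> H \<Longrightarrow> t > 0 \<Longrightarrow> (t *\<^sub>R u, t * c) \<in> H"
    and le: "\<And>u c. (u, c) \<in> H \<Longrightarrow> c \<le> p u"
  obtains g where "linear g" "\<And>x. g x \<le> p x" "\<And>u c. (u, c) \<in> H \<Longrightarrow> c \<le> g u"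
proof -
  define q where "q y = (INF (u, c)\<in>H. p (y + u) - c)" for y
  have q: "sublinear q"
    unfolding q_def by (rule sublinear_infimum_cone(1)[OF p zero]) (fact add scale le)+
  have q_le: "q y \<le> p y" for y
    unfolding q_def by (rule sublinear_infimum_cone(2)[OF p zero]) (fact add scale le)+
  have q_lower: "q y \<le> p (y + u) - c" if "(u, c) \<in> H" for u c y
    unfolding q_def by (rule sublinear_infimum_cone(3)[OF p zero _ _ _ that]) (fact add scale le)+
  obtain g where g: "linear g" "\<And>y. g y \<le> q y"
    using exists_linear_below_sublinear[OF q] by blast
  have "c \<le> g u" if "(u, c) \<in> H" for u c
  proof -
    have "g (- u) \<le> p (- u + u) - c" using g(2)[of "- u"] q_lower[OF that, of "- u"] by linarith
    then show ?thesis using linear_neg[OF g(1)] sublinear_zero[OF p] by simp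
  qed
  moreover have "g x \<le> p x" for x using g(2)[of x] q_le[of x] by linarith
  ultimately show thesis using that g(1) by blast
qed

section \<open>Bounded functionals on normed spaces\<close>

lemma sublinear_norm: "c \<ge> 0 \<Longrightarrow> sublinear (\<lambda>x :: 'a::real_normed_vector. c * norm x)"
  unfolding sublinear_def by (simp add: norm_triangle_ineq flip: distrib_left)
    (simp add: mult_left_mono norm_triangle_ineq)

lemma linear_le_norm:
  fixes g :: "'a::real_normed_vector \<Rightarrow> real"
  assumes g: "linear g" and le: "\<And>x. g x \<le> c * norm x"
  shows "bounded_linear g" and "\<bar>g x\<bar> \<le> c * norm x"
proof -
  show abs: "\<bar>g x\<bar> \<le> c * norm x" for x
    using le[of x] le[of "- x"] linear_neg[OF g, of x] by simp
  show "bounded_linear g"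
    by (rule bounded_linear_intro[of g c])
      (use g abs in \<open>auto simp: linear_add linear_scale mult.commute\<close>)
qed

lemma functional_attaining_sublinear:
  fixes p :: "'a::real_vector \<Rightarrow> real"
  assumes p: "sublinear p"
  obtains g where "linear g" "\<And>y. g y \<le> p y" "g x = p x"
proof -
  \<comment> \<open>Demands along the ray through \<open>x\<close> give only
    \<open>p x \<le> g x\<close>; equality follows because \<open>g\<close> lies below
    \<open>p\<close>.\<close>
  define H where "H = {(t *\<^sub>R x, t * p x) |t. t \<ge> 0}"
  have "\<exists>g. linear g \<and> (\<forall>y. g y \<le> p y) \<and> (\<forall>u c. (u, c) \<in> H \<longrightarrow> c \<le> g u)"
  proof (rule Hahn_Banach_cone[OF p, of H])
    show "(0, 0) \<in> H" unfolding H_def by force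
    fix u c v d assume "(u, c) \<in> H" "(v, d) \<in> H"
    then obtain s t where "s \<ge> 0" "t \<ge> 0" "u = s *\<^sub>R x" "c = s * p x" "v = t *\<^sub>R x" "d = t * p x"
      by (auto simp: H_def)
    then show "(u + v, c + d) \<in> H"
      unfolding H_def by (intro CollectI exI[of _ "s + t"]) (simp add: algebra_simps)
  next
    fix u c and t :: real assume "(u, c) \<in> H" "t > 0"
    then obtain s where "s \<ge> 0" "u = s *\<^sub>R x" "c = s * p x" by (auto simp: H_def)
    then show "(t *\<^sub>R u, t * c) \<in> H"
      unfolding H_def using \<open>t > 0\<close> by (intro CollectI exI[of _ "t * s"]) simp
  next
    fix u c assume "(u, c) \<in> H"
    then obtain s where "s \<ge> 0" "u = s *\<^sub>R x" "c = s * p x" by (auto simp: H_def)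
    then show "c \<le> p u"
      using sublinear_scale[OF p, of s x] sublinear_zero[OF p] by (cases "s = 0") auto
  qed blast
  then obtain g where g: "linear g" "\<And>y. g y \<le> p y" "\<And>u c. (u, c) \<in> H \<Longrightarrow> c \<le> g u"
    by blast
  have "(x, p x) \<in> H" unfolding H_def by force
  then have "g x = p x" using g(2)[of x] g(3)[of x "p x"] by simp
  then show thesis using that g(1,2) by blast
qed

lemma norming_functional:
  fixes x :: "'a::real_normed_vector"
  obtains \<phi> where "bounded_linear \<phi>" "\<And>y. \<bar>\<phi> y\<bar> \<le> norm y" "\<phi> x = norm x"
proof -
  obtain g where g: "linear g" "\<And>y. g y \<le> 1 * norm y" "g x = 1 * norm x"
    using functional_attaining_sublinear[OF sublinear_norm[of 1], of x] by auto
  show thesis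
    using that[OF linear_le_norm(1)[OF g(1,2)]] linear_le_norm(2)[OF g(1,2)] g(3) by simp
qed

text \<open>The graph of \<open>f\<close> over \<open>W\<close> serves as the cone: at
  \<open>w\<close> and \<open>- w\<close> its demands combine to an equality. The bound on
  \<open>f\<close> is asked on \<open>W\<close> alone, so that a functional can later be exchanged
  for one of small norm that agrees with it on a common kernel.\<close>

lemma functional_extension:
  fixes f :: "'a::real_normed_vector \<Rightarrow> real"
  assumes W: "subspace W" and f: "linear f" and c: "c \<ge> 0" "\<And>w. w \<in> W \<Longrightarrow> f w \<le> c * norm w"
  obtains g where "bounded_linear g" "\<And>x. \<bar>g x\<bar> \<le> c * norm x" "\<And>w. w \<in> W \<Longrightarrow> g w = f w"
proof -
  obtain g where g: "linear g" "\<And>x. g x \<le> c * norm x" "\<And>u d. (u, d) \<in> (\<lambda>w. (w, f w)) ` W \<Longrightarrow> d \<le> g u"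
    by (rule Hahn_Banach_cone[OF sublinear_norm[OF c(1)], of "(\<lambda>w. (w, f w)) ` W"])
      (use W f c in \<open>auto simp: image_iff subspace_0 subspace_add subspace_mul linear_0 linear_add linear_scale\<close>)
  have "g w = f w" if w: "w \<in> W" for w
  proof -
    have "f w \<le> g w" "f (- w) \<le> g (- w)"
      using g(3) w subspace_neg[OF W w] by (metis imageI)+
    then show ?thesis by (simp add: linear_neg[OF f] linear_neg[OF g(1)])
  qed
  then show thesis using that linear_le_norm[OF g(1,2)] by blast
qed

text \<open>The distance to \<open>W\<close> is sublinear, vanishes on \<open>W\<close> and is
  positive at \<open>x\<close>. A linear functional below it that attains it at \<open>x\<close>
  kills \<open>W\<close> but not \<open>x\<close>, and it is bounded because the distance to
  \<open>W\<close> is at most the norm.\<close>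

lemma functional_separating_point_subspace:
  fixes x :: "'a::real_normed_vector"
  assumes W: "subspace W" "closed W" and x: "x \<notin> W"
  obtains \<phi> :: "'a \<Rightarrow> real" where "bounded_linear \<phi>" "\<And>w. w \<in> W \<Longrightarrow> \<phi> w = 0" "\<phi> x \<noteq> 0"
proof -
  have ne: "W \<noteq> {}" using W(1) subspace_0 by blast
  have near: "\<exists>w\<in>W. dist y w < infdist y W + e" if "e > 0" for y e
  proof (rule ccontr)
    assume "\<not> ?thesis"
    then have "infdist y W + e \<le> infdist y W"
      unfolding infdist_notempty[OF ne] by (intro cINF_greatest[OF ne]) (simp add: not_less)
    then show False using that by simp
  qed
  have sc: "infdist (t *\<^sub>R y) W \<le> t * infdist y W" if t: "t > 0" for t y
  proof (rule field_le_epsilon)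
    fix e :: real assume e: "e > 0"
    obtain w where w: "w \<in> W" "dist y w < infdist y W + e / t" using near[of "e / t" y] e t by auto
    have "infdist (t *\<^sub>R y) W \<le> dist (t *\<^sub>R y) (t *\<^sub>R w)"
      using W(1) w(1) by (intro infdist_le subspace_mul)
    also have "\<dots> = t * dist y w"
      using t by (simp add: dist_norm flip: scaleR_right_diff_distrib)
    also have "\<dots> \<le> t * (infdist y W + e / t)" using w(2) t by simp
    finally show "infdist (t *\<^sub>R y) W \<le> t * infdist y W + e" using t by (simp add: distrib_left)
  qed
  have "sublinear (\<lambda>y. infdist y W)"
    unfolding sublinear_def
  proof (intro conjI allI impI)
    fix y z
    show "infdist (y + z) W \<le> infdist y W + infdist z W"
    proof (rule field_le_epsilon)
      fix e :: real assume "e > 0"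
      then obtain v w where v: "v \<in> W" "dist y v < infdist y W + e / 2"
        and w: "w \<in> W" "dist z w < infdist z W + e / 2"
        using near[of "e / 2"] by (meson half_gt_zero)
      have "infdist (y + z) W \<le> dist (y + z) (v + w)"
        using W(1) v(1) w(1) by (intro infdist_le subspace_add)
      also have "\<dots> \<le> dist y v + dist z w" by (rule dist_triangle_add)
      finally show "infdist (y + z) W \<le> infdist y W + infdist z W + e" using v(2) w(2) by simp
    qed
  next
    fix t :: real and y assume t: "t > 0"
    have "infdist ((1 / t) *\<^sub>R (t *\<^sub>R y)) W \<le> (1 / t) * infdist (t *\<^sub>R y) W"
      using t by (intro sc) simp
    then show "infdist (t *\<^sub>R y) W = t * infdist y W"
      using sc[OF t, of y] t by (simp add: field_simps)
  qed
  then obtain g where g: "linear g" "\<And>y. g y \<le> infdist y W" "g x = infdist x W"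
    using functional_attaining_sublinear[of "\<lambda>y. infdist y W" x] by blast
  have "g y \<le> 1 * norm y" for y
    using g(2)[of y] infdist_le[OF subspace_0[OF W(1)], of y] by simp
  then have "bounded_linear g" by (rule linear_le_norm(1)[OF g(1)])
  moreover have "g w = 0" if w: "w \<in> W" for w
    using g(2)[of w] g(2)[of "- w"] w subspace_neg[OF W(1) w] linear_neg[OF g(1), of w] by simp
  moreover have "g x \<noteq> 0"
    using g(3) x W(2) ne in_closed_iff_infdist_zero by metis
  ultimately show thesis using that[of g] by blast
qed

subsection \<open>Weak topologies\<close>

lemma continuous_map_weak_functional:
  fixes \<phi> :: "'a::real_normed_vector \<Rightarrow> real"
  assumes "bounded_linear \<phi>"
  shows "continuous_map weak_topology euclideanreal \<phi>"
proof -
  have "openin weak_topology (\<phi> -` U)" if "open U" for U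
    unfolding weak_topology_def openin_topology_generated_by_iff
    using assms that by (intro generate_topology_on.Basis) blast
  then show ?thesis
    by (simp add: continuous_map_alt vimage_def)
qed

lemma openin_weak_topologyD:
  fixes U :: "'a::real_normed_vector set"
  assumes "openin weak_topology U" "x \<in> U"
  obtains F \<epsilon> where "finite F" "\<And>\<phi>. \<phi> \<in> F \<Longrightarrow> bounded_linear (\<phi> :: 'a \<Rightarrow> real)" "\<epsilon> > 0"
    "{y. \<forall>\<phi>\<in>F. \<bar>\<phi> y - \<phi> x\<bar> < \<epsilon>} \<subseteq> U"
proof -
  let ?P = "\<lambda>U. \<exists>F \<epsilon>. finite F \<and> (\<forall>\<phi>\<in>F. bounded_linear (\<phi> :: 'a \<Rightarrow> real)) \<and> \<epsilon> > 0 \<and>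
    {y. \<forall>\<phi>\<in>F. \<bar>\<phi> y - \<phi> x\<bar> < \<epsilon>} \<subseteq> U"
  have "generate_topology_on {\<phi> -` U | \<phi> U. bounded_linear (\<phi> :: 'a \<Rightarrow> real) \<and> open U} U"
    using assms(1) by (simp add: weak_topology_def openin_topology_generated_by_iff)
  then have "?P U" using assms(2)
  proof (induction rule: generate_topology_on.induct)
    case (Int a b)
    have "?P a" using Int by blast
    then obtain F :: "('a \<Rightarrow> real) set" and \<epsilon> where F: "finite F" "\<forall>\<phi>\<in>F. bounded_linear \<phi>" "\<epsilon> > 0"
      "{y. \<forall>\<phi>\<in>F. \<bar>\<phi> y - \<phi> x\<bar> < \<epsilon>} \<subseteq> a" by blast
    have "?P b" using Int by blast
    then obtain G :: "('a \<Rightarrow> real) set" and \<delta> where G: "finite G" "\<forall>\<phi>\<in>G. bounded_linear \<phi>" "\<delta> > 0"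
      "{y. \<forall>\<phi>\<in>G. \<bar>\<phi> y - \<phi> x\<bar> < \<delta>} \<subseteq> b" by blast
    from F G show ?case
      by (intro exI[of _ "F \<union> G"] exI[of _ "min \<epsilon> \<delta>"]) auto
  next
    case (UN K)
    then obtain k where "k \<in> K" "x \<in> k" by blast
    then have "?P k" by (rule UN(2))
    then show ?case using Union_upper[OF \<open>k \<in> K\<close>] by (elim exE conjE) (intro exI conjI; (assumption | blast))
  next
    case (Basis s)
    then obtain \<phi> :: "'a \<Rightarrow> real" and V where \<phi>: "bounded_linear \<phi>" and V: "open V" "s = \<phi> -` V" by blast
    have "\<phi> x \<in> V" using V(2) Basis(2) by simp
    then obtain \<epsilon> where "\<epsilon> > 0" "\<And>r. \<bar>r - \<phi> x\<bar> < \<epsilon> \<Longrightarrow> r \<in> V"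
      using V(1) unfolding open_dist dist_real_def by blast
    then show ?case
      using \<phi> V by (intro exI[of _ "{\<phi>}"] exI[of _ \<epsilon>]) auto
  qed simp
  then show thesis using that by blast
qed

lemma openin_weak_topologyI:
  fixes F :: "('a::real_normed_vector \<Rightarrow> real) set"
  assumes "finite F" "\<And>\<phi>. \<phi> \<in> F \<Longrightarrow> bounded_linear \<phi>"
  shows "openin weak_topology {y. \<forall>\<phi>\<in>F. \<bar>\<phi> y - \<phi> x\<bar> < \<epsilon>}"
proof -
  have *: "openin weak_topology {y. \<bar>\<phi> y - \<phi> x\<bar> < \<epsilon>}" if "\<phi> \<in> F" for \<phi>
  proof -
    have "openin weak_topology {y \<in> topspace weak_topology. \<phi> y \<in> ball (\<phi> x) \<epsilon>}"
      using continuous_map_weak_functional[OF assms(2)[OF that]]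
      by (rule openin_continuous_map_preimage) simp
    then show ?thesis by (simp add: dist_real_def abs_minus_commute)
  qed
  show ?thesis
  proof (cases "F = {}")
    case False
    have "openin weak_topology (\<Inter>\<phi>\<in>F. {y. \<bar>\<phi> y - \<phi> x\<bar> < \<epsilon>})"
      using False assms(1) * by (intro openin_INT2) auto
    moreover have "(\<Inter>\<phi>\<in>F. {y. \<bar>\<phi> y - \<phi> x\<bar> < \<epsilon>}) = {y. \<forall>\<phi>\<in>F. \<bar>\<phi> y - \<phi> x\<bar> < \<epsilon>}" by auto
    ultimately show ?thesis by simp
  qed (use openin_topspace[of weak_topology] in simp)
qed

lemma limitin_weak_topology:
  fixes x :: "'i \<Rightarrow> 'a::real_normed_vector"
  shows "limitin weak_topology x l F \<longleftrightarrow>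
    (\<forall>\<phi> :: 'a \<Rightarrow> real. bounded_linear \<phi> \<longrightarrow> ((\<lambda>i. \<phi> (x i)) \<longlongrightarrow> \<phi> l) F)"
proof (intro iffI allI impI)
  fix \<phi> :: "'a \<Rightarrow> real" assume "limitin weak_topology x l F" "bounded_linear \<phi>"
  then show "((\<lambda>i. \<phi> (x i)) \<longlongrightarrow> \<phi> l) F"
    using continuous_map_limit[OF continuous_map_weak_functional] by (fastforce simp: comp_def)
next
  assume lim: "\<forall>\<phi> :: 'a \<Rightarrow> real. bounded_linear \<phi> \<longrightarrow> ((\<lambda>i. \<phi> (x i)) \<longlongrightarrow> \<phi> l) F"
  show "limitin weak_topology x l F"
    unfolding limitin_def
  proof (intro conjI allI impI)
    fix U assume U: "openin weak_topology U \<and> l \<in> U"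
    then obtain G \<epsilon> where G: "finite G" "\<And>\<phi>. \<phi> \<in> G \<Longrightarrow> bounded_linear (\<phi> :: 'a \<Rightarrow> real)" "\<epsilon> > 0"
      "{y. \<forall>\<phi>\<in>G. \<bar>\<phi> y - \<phi> l\<bar> < \<epsilon>} \<subseteq> U"
      using openin_weak_topologyD by blast
    have "\<forall>\<^sub>F i in F. \<forall>\<phi>\<in>G. dist (\<phi> (x i)) (\<phi> l) < \<epsilon>"
      using G lim by (intro eventually_ball_finite ballI tendstoD) auto
    then show "\<forall>\<^sub>F i in F. x i \<in> U"
      by (rule eventually_mono) (use G(4) in \<open>auto simp: dist_real_def\<close>)
  qed simp
qed

lemma Hausdorff_space_weak_topology:
  "Hausdorff_space (weak_topology :: 'a::real_normed_vector topology)"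
  unfolding Hausdorff_space_def
proof (intro allI impI)
  fix x y :: 'a assume "x \<in> topspace weak_topology \<and> y \<in> topspace weak_topology \<and> x \<noteq> y"
  then have "x - y \<noteq> 0" by simp
  obtain \<phi> where \<phi>: "bounded_linear \<phi>" "\<phi> (x - y) = norm (x - y)"
    using norming_functional[of "x - y"] by metis
  define e where "e = norm (x - y) / 2"
  have e: "\<phi> x - \<phi> y = 2 * e"
    using \<phi>(2) bounded_linear.linear[OF \<phi>(1)] by (simp add: linear_diff e_def)
  have "e > 0" using \<open>x - y \<noteq> 0\<close> by (simp add: e_def)
  have op: "openin weak_topology {z. \<forall>\<phi>\<in>{\<phi>}. \<bar>\<phi> z - \<phi> w\<bar> < e}" for w
    by (rule openin_weak_topologyI) (use \<phi>(1) in auto)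
  have "disjnt {z. \<forall>\<phi>\<in>{\<phi>}. \<bar>\<phi> z - \<phi> x\<bar> < e} {z. \<forall>\<phi>\<in>{\<phi>}. \<bar>\<phi> z - \<phi> y\<bar> < e}"
    using e by (auto simp: disjnt_def)
  then show "\<exists>U V. openin weak_topology U \<and> openin weak_topology V \<and> x \<in> U \<and> y \<in> V \<and> disjnt U V"
    using op[of x] op[of y] \<open>e > 0\<close> by fastforce
qed

text \<open>By norming functionals the ball is an intersection of half-spaces
  \<open>\<phi> x \<le> r\<close> with \<open>\<phi>\<close> in the dual unit ball, each of them
  weakly closed.\<close>

lemma closedin_weak_cball: "closedin weak_topology (cball (0 :: 'a::real_normed_vector) r)"
proof -
  let ?C = "\<lambda>\<phi> :: 'a \<Rightarrow> real. {x \<in> topspace weak_topology. \<phi> x \<in> {..r}}"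
  let ?K = "{\<phi> :: 'a \<Rightarrow> real. bounded_linear \<phi> \<and> (\<forall>x. \<bar>\<phi> x\<bar> \<le> norm x)}"
  have "closedin weak_topology (\<Inter> (?C ` ?K))"
  proof (rule closedin_Inter)
    have "(\<lambda>_. 0) \<in> ?K" by (simp add: bounded_linear_zero)
    then show "?C ` ?K \<noteq> {}" by blast
    fix S assume "S \<in> ?C ` ?K"
    then obtain \<phi> where \<phi>: "bounded_linear \<phi>" "S = ?C \<phi>" by blast
    show "closedin weak_topology S"
      unfolding \<phi>(2)
      by (rule closedin_continuous_map_preimage[OF continuous_map_weak_functional[OF \<phi>(1)]]) simp
  qed
  moreover have "\<Inter> (?C ` ?K) = cball 0 r"
  proof
    show "\<Inter> (?C ` ?K) \<subseteq> cball 0 r"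
    proof
      fix x assume x: "x \<in> \<Inter> (?C ` ?K)"
      obtain \<phi> where "bounded_linear \<phi>" "\<And>y. \<bar>\<phi> y\<bar> \<le> norm y" "\<phi> x = norm x"
        using norming_functional[of x] by blast
      then show "x \<in> cball 0 r" using x by fastforce
    qed
    have "\<phi> x \<le> r" if "\<forall>x. \<bar>\<phi> x\<bar> \<le> norm x" "norm x \<le> r" for \<phi> :: "'a \<Rightarrow> real" and x
      using that by (meson abs_le_iff order_trans)
    then show "cball 0 r \<subseteq> \<Inter> (?C ` ?K)" by auto
  qed
  ultimately show ?thesis by simp
qed

text \<open>Hahn--Banach separation makes \<open>W\<close> the intersection of the kernels of all
  functionals that vanish on it.\<close>

lemma closedin_weak_closed_subspace:
  fixes W :: "'a::real_normed_vector set"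
  assumes W: "subspace W" "closed W"
  shows "closedin weak_topology W"
proof -
  let ?C = "\<lambda>\<phi> :: 'a \<Rightarrow> real. {x \<in> topspace weak_topology. \<phi> x \<in> {0}}"
  let ?K = "{\<phi> :: 'a \<Rightarrow> real. bounded_linear \<phi> \<and> (\<forall>w\<in>W. \<phi> w = 0)}"
  have "closedin weak_topology (\<Inter> (?C ` ?K))"
  proof (rule closedin_Inter)
    have "(\<lambda>_. 0) \<in> ?K" by (simp add: bounded_linear_zero)
    then show "?C ` ?K \<noteq> {}" by blast
    fix S assume "S \<in> ?C ` ?K"
    then obtain \<phi> where \<phi>: "bounded_linear \<phi>" "S = ?C \<phi>" by blast
    show "closedin weak_topology S"
      unfolding \<phi>(2)
      by (rule closedin_continuous_map_preimage[OF continuous_map_weak_functional[OF \<phi>(1)]]) simp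
  qed
  moreover have "\<Inter> (?C ` ?K) = W"
  proof
    show "\<Inter> (?C ` ?K) \<subseteq> W"
    proof (rule subsetI, rule ccontr)
      fix x assume x: "x \<in> \<Inter> (?C ` ?K)" "x \<notin> W"
      obtain \<phi> :: "'a \<Rightarrow> real" where "bounded_linear \<phi>" "\<And>w. w \<in> W \<Longrightarrow> \<phi> w = 0" "\<phi> x \<noteq> 0"
        using functional_separating_point_subspace[OF W x(2)] by blast
      then show False using x(1) by auto
    qed
  qed auto
  ultimately show ?thesis by simp
qed

text \<open>The vectors act as functionals on the dual space, which is complete even when
  \<open>'a\<close> is not. Baire's theorem there yields a ball of functionals on which all of them
  are uniformly bounded.\<close>

theorem weakly_bounded_imp_bounded:
  fixes x :: "nat \<Rightarrow> 'a::real_normed_vector"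
  assumes bd: "\<And>\<phi> :: 'a \<Rightarrow> real. bounded_linear \<phi> \<Longrightarrow> bounded (range (\<lambda>n. \<phi> (x n)))"
  shows "bounded (range x)"
proof -
  define E where "E n = {f :: 'a \<Rightarrow>\<^sub>L real. \<forall>k. \<bar>f (x k)\<bar> \<le> real n}" for n
  have clE: "closed (E n)" for n
    unfolding E_def by (intro closed_Collect_all closed_Collect_le continuous_intros)
  have "f \<in> (\<Union>n. E n)" for f
  proof -
    obtain c where c: "\<And>k. \<bar>f (x k)\<bar> \<le> c"
      using bd[OF blinfun.bounded_linear_right[of f]] by (auto simp: bounded_iff)
    obtain n :: nat where "c \<le> real n" using real_arch_simple by blast
    then show ?thesis using c unfolding E_def by (blast intro: order_trans)
  qed
  then have UE: "(\<Union>n. E n) = UNIV" by blast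
  have "\<exists>n. interior (E n) \<noteq> {}"
  proof (rule ccontr)
    assume "\<not> ?thesis"
    have "Met_TC.mtopology interior_of \<Union>(range E) = {}"
    proof (rule Met_TC.metric_Baire_category_alt)
      show "Met_TC.mcomplete TYPE('a \<Rightarrow>\<^sub>L real)" by (simp add: complete_UNIV)
      fix T assume "T \<in> range E"
      then show "closedin Met_TC.mtopology T \<and> Met_TC.mtopology interior_of T = {}"
        using clE \<open>\<not> (\<exists>n. interior (E n) \<noteq> {})\<close> by auto
    qed simp
    then show False using UE by simp
  qed
  then obtain n f0 where "f0 \<in> interior (E n)" by blast
  then obtain r where r: "r > 0" "cball f0 r \<subseteq> E n"
    by (meson interior_subset mem_interior_cball order_trans)
  \<comment> \<open>Both the centre \<open>f0\<close> and the point
    \<open>f0 + r *\<^sub>R g\<close> of the ball lie in \<open>E n\<close>, so their values at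
    \<open>x k\<close> differ by at most \<open>2 * n\<close>; this is the origin of the
    constant.\<close>
  have "norm (x k) \<le> 2 * real n / r" for k
  proof -
    obtain \<phi> where \<phi>: "bounded_linear \<phi>" "\<And>y. \<bar>\<phi> y\<bar> \<le> norm y" "\<phi> (x k) = norm (x k)"
      using norming_functional[of "x k"] by blast
    define g where "g = Blinfun \<phi>"
    have g: "blinfun_apply g = \<phi>" using \<phi>(1) by (simp add: g_def bounded_linear_Blinfun_apply)
    have "norm g \<le> 1" by (rule norm_blinfun_bound) (use \<phi>(2) g in auto)
    then have "f0 + r *\<^sub>R g \<in> cball f0 r" using r(1) by (simp add: dist_norm)
    moreover have "f0 \<in> cball f0 r" using r(1) by simp
    ultimately have "\<bar>(f0 + r *\<^sub>R g) (x k)\<bar> \<le> real n" "\<bar>f0 (x k)\<bar> \<le> real n"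
      using r(2) unfolding E_def by blast+
    then have "r * norm (x k) \<le> 2 * real n"
      using \<phi>(3) by (simp add: blinfun.bilinear_simps g)
    then show ?thesis using r(1) by (simp add: field_simps)
  qed
  then show ?thesis by (auto simp: bounded_iff)
qed

lemma limitin_weak_imp_bounded:
  fixes x :: "nat \<Rightarrow> 'a::real_normed_vector"
  assumes "limitin weak_topology x l sequentially"
  shows "bounded (range x)"
proof (rule weakly_bounded_imp_bounded)
  fix \<phi> :: "'a \<Rightarrow> real" assume "bounded_linear \<phi>"
  then have "(\<lambda>n. \<phi> (x n)) \<longlonglongrightarrow> \<phi> l" using assms by (simp add: limitin_weak_topology)
  then show "bounded (range (\<lambda>n. \<phi> (x n)))" by (rule convergent_imp_bounded)
qed

subsection \<open>Proper and subproper images of metrizable spaces\<close>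

lemma accumulation_point_in_subseq:
  assumes "strict_mono r" "limitin M (x \<circ> r) a sequentially"
  shows "accumulation_point_in M x a"
  unfolding accumulation_point_in_def
proof (intro conjI allI impI)
  show "a \<in> topspace M" using assms(2) by (rule limitin_topspace)
  fix U assume "openin M U \<and> a \<in> U"
  then obtain N where N: "\<And>n. n \<ge> N \<Longrightarrow> x (r n) \<in> U"
    using assms(2) by (auto simp: limitin_sequentially)
  have "infinite (r ` {N..})"
    using finite_imageD[OF _ strict_mono_imp_inj_on[OF assms(1)]] infinite_Ici by blast
  moreover have "r ` {N..} \<subseteq> {n. x n \<in> U}" using N by auto
  ultimately show "infinite {n. x n \<in> U}" using infinite_super by blast
qed

lemma accumulation_point_in_metrizable_subseq:
  assumes M: "metrizable_space M" and acc: "accumulation_point_in M x a"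
    and x: "range x \<subseteq> topspace M"
  obtains r where "strict_mono r" "limitin M (x \<circ> r) a sequentially"
proof -
  obtain S d where Sd: "Metric_space S d" "M = Metric_space.mtopology S d"
    using M unfolding metrizable_space_def by blast
  interpret Metric_space S d by (rule Sd(1))
  have aS: "a \<in> S" using acc by (simp add: accumulation_point_in_def Sd(2))
  have "\<exists>m>n. x m \<in> mball a (1 / Suc k)" for n k
  proof -
    have "infinite {m. x m \<in> mball a (1 / Suc k)}"
      using acc aS openin_mball unfolding accumulation_point_in_def Sd(2)
      by (metis centre_in_mball_iff of_nat_0_less_iff zero_less_Suc zero_less_divide_1_iff)
    then show ?thesis by (auto simp: infinite_nat_iff_unbounded)
  qed
  then obtain h where h: "\<And>n k. h n k > n" "\<And>n k. x (h n k) \<in> mball a (1 / Suc k)"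
    by metis
  define r where "r = rec_nat (h 0 0) (\<lambda>k n. h n (Suc k))"
  have r_Suc: "r (Suc k) = h (r k) (Suc k)" for k by (simp add: r_def)
  have "strict_mono r" by (simp add: strict_mono_Suc_iff r_Suc h(1))
  moreover have "x (r k) \<in> mball a (1 / Suc k)" for k
    using h(2) by (cases k) (simp_all only: r_Suc, simp add: r_def h(2)[of 0 0, simplified])
  then have "limitin mtopology (x \<circ> r) a sequentially"
    unfolding limit_metric_sequentially
  proof (intro conjI allI impI)
    fix e :: real assume "e > 0"
    then obtain N where N: "1 / Suc N < e" using reals_Archimedean by (auto simp: inverse_eq_divide)
    have "(x \<circ> r) n \<in> S \<and> d ((x \<circ> r) n) a < e" if "n \<ge> N" for n
    proof -
      have "1 / real (Suc n) \<le> 1 / real (Suc N)" using that by (intro frac_le) auto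
      then show ?thesis using N \<open>\<And>k. x (r k) \<in> mball a (1 / Suc k)\<close>[of n] by (simp add: commute)
    qed
    then show "\<exists>N. \<forall>n\<ge>N. (x \<circ> r) n \<in> S \<and> d ((x \<circ> r) n) a < e" by blast
  qed (use aS in simp)
  ultimately show thesis using that Sd(2) by blast
qed

text \<open>Subproper maps speak of precompact sets, cs*-continuity of accumulation points; in a
  metrizable space the two meet by Bolzano--Weierstrass. For the converse an injective sequence in
  an infinite set turns its accumulation point into a limit point of the set.\<close>

lemma precompact_in_metrizable_sequentially:
  fixes M :: "'m topology"
  assumes M: "metrizable_space M" and P: "P \<subseteq> topspace M"
  shows "precompact_in M P \<longleftrightarrow>
    (\<forall>x :: nat \<Rightarrow> _. range x \<subseteq> P \<longrightarrow> (\<exists>a. accumulation_point_in M x a))"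
proof -
  obtain S d where Sd: "Metric_space S d" "M = Metric_space.mtopology S d"
    using M unfolding metrizable_space_def by blast
  interpret Metric_space S d by (rule Sd(1))
  have P_sub: "P \<subseteq> mtopology closure_of P"
    using P Sd(2) closure_of_subset by blast
  show ?thesis
  proof
    assume "precompact_in M P"
    then have *: "compactin mtopology (mtopology closure_of P)"
      by (simp add: precompact_in_def Sd(2))
    show "\<forall>x :: nat \<Rightarrow> _. range x \<subseteq> P \<longrightarrow> (\<exists>a. accumulation_point_in M x a)"
    proof (intro allI impI)
      fix x :: "nat \<Rightarrow> 'm" assume "range x \<subseteq> P"
      then have "range x \<subseteq> mtopology closure_of P" using P_sub by blast
      then obtain l r where "strict_mono (r :: nat \<Rightarrow> nat)" "limitin mtopology (x \<circ> r) l sequentially"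
        using * unfolding compactin_sequentially by blast
      then show "\<exists>a. accumulation_point_in M x a"
        unfolding Sd(2) by (intro exI[of _ l] accumulation_point_in_subseq[of r])
    qed
  next
    assume acc: "\<forall>x :: nat \<Rightarrow> _. range x \<subseteq> P \<longrightarrow> (\<exists>a. accumulation_point_in M x a)"
    have "mtopology derived_set_of T \<noteq> {}" if T: "infinite T" "T \<subseteq> P" for T
    proof -
      obtain x :: "nat \<Rightarrow> 'm" where x: "inj x" "range x \<subseteq> T"
        using infinite_countable_subset[OF T(1)] by blast
      then obtain a where a: "accumulation_point_in M x a" using acc T(2) by blast
      have "infinite (T \<inter> U)" if "a \<in> U" "openin mtopology U" for U
      proof -
        have "infinite (x ` {n. x n \<in> U})"
          using a that x(1) unfolding accumulation_point_in_def Sd(2)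
          by (simp add: finite_image_iff inj_on_subset)
        moreover have "x ` {n. x n \<in> U} \<subseteq> T \<inter> U" using x(2) by auto
        ultimately show ?thesis using infinite_super by blast
      qed
      then have "a \<in> mtopology derived_set_of T"
        using a unfolding derived_set_of_infinite_openin_metric
        by (auto simp: accumulation_point_in_def Sd(2))
      then show ?thesis by blast
    qed
    then have "compactin mtopology (mtopology closure_of P)"
      unfolding compact_closure_of_eq_Bolzano_Weierstrass by blast
    then show "precompact_in M P" using P by (simp add: precompact_in_def Sd(2))
  qed
qed

lemma k_metrizable_imp_k_star_metrizable:
  assumes "k_metrizable Y"
  shows "k_star_metrizable Y"
proof -
  obtain M :: "(nat \<Rightarrow> 'a) topology" and f where M: "metrizable_space M" "f ` topspace M = topspace Y"
    and f: "pc_proper_map M Y f"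
    using assms unfolding k_metrizable_def by blast
  have "pc_subproper_map M Y f"
    unfolding pc_subproper_map_def
    by (intro conjI exI[of _ "topspace M"]) (use f M(2) in \<open>auto simp: pc_proper_map_def\<close>)
  then show ?thesis unfolding k_star_metrizable_def using M by blast
qed

text \<open>A convergent sequence together with its limit is compact, and closed because
  \<open>Y\<close> is Hausdorff. Choosing the section inside \<open>Z\<close> puts its values over
  this sequence into a precompact set.\<close>

lemma k_star_metrizable_imp_cs_star_metrizable:
  assumes haus: "Hausdorff_space Y" and Y: "k_star_metrizable Y"
  shows "cs_star_metrizable Y"
proof -
  obtain M :: "(nat \<Rightarrow> 'a) topology" and f where M: "metrizable_space M" "f ` topspace M = topspace Y"
    and f: "pc_subproper_map M Y f"
    using Y unfolding k_star_metrizable_def by blast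
  obtain Z where Z: "Z \<subseteq> topspace M" "f ` Z = topspace Y"
    and pc: "\<And>K. precompact_in Y K \<Longrightarrow> precompact_in M {x \<in> Z. f x \<in> K}"
    using f unfolding pc_subproper_map_def by blast
  define s where "s = inv_into Z f"
  have s: "s y \<in> Z" "f (s y) = y" if "y \<in> topspace Y" for y
    unfolding s_def using that Z(2) by (auto simp: inv_into_into f_inv_into_f)
  have "\<exists>a. accumulation_point_in M (s \<circ> y) a" if y: "convergent_seq_in Y y" for y
  proof -
    obtain l where l: "limitin Y y l sequentially" and ran: "range y \<subseteq> topspace Y"
      using y by (auto simp: convergent_seq_in_def)
    have "compactin Y (insert l (range y))"
      using compactin_sequence_with_limit[OF l _ ran] by simp
    moreover from this have "Y closure_of (insert l (range y)) = insert l (range y)"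
      using haus compactin_imp_closedin closure_of_closedin by blast
    ultimately have "precompact_in Y (insert l (range y))"
      using compactin_subset_topspace unfolding precompact_in_def by metis
    then have "precompact_in M {x \<in> Z. f x \<in> insert l (range y)}" by (rule pc)
    moreover have "range (s \<circ> y) \<subseteq> {x \<in> Z. f x \<in> insert l (range y)}"
      using s ran by (auto simp: range_subsetD)
    ultimately show ?thesis
      using precompact_in_metrizable_sequentially[OF M(1)] Z(1)
      by (metis (no_types, lifting) precompact_in_def)
  qed
  then have "cs_star_continuous_map Y M s"
    unfolding cs_star_continuous_map_def using s(1) Z(1) by blast
  moreover have "section_of M Y f s"
    unfolding section_of_def using s Z(1) by blast
  ultimately show ?thesis
    unfolding cs_star_metrizable_def using M f pc_subproper_map_def by blast
qed

text \<open>The image of the section plays the role of \<open>Z\<close>. A sequence in it over a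
  precompact \<open>K\<close> is \<open>s\<close> applied to a sequence in \<open>K\<close>, so a
  convergent subsequence downstairs yields an accumulation point upstairs. The assumption
  \<open>subseq\<close> is a genuine restriction, as compact sets need not be sequentially
  compact.\<close>

lemma cs_star_metrizable_imp_k_star_metrizable:
  assumes Y: "cs_star_metrizable Y"
    and subseq: "\<And>K (y :: nat \<Rightarrow> _). precompact_in Y K \<Longrightarrow> range y \<subseteq> K \<Longrightarrow>
      \<exists>l r. strict_mono (r :: nat \<Rightarrow> nat) \<and> limitin Y (y \<circ> r) l sequentially"
  shows "k_star_metrizable Y"
proof -
  obtain M :: "(nat \<Rightarrow> 'a) topology" and f s where M: "metrizable_space M" "f ` topspace M = topspace Y"
    and f: "continuous_map M Y f" and sec: "section_of M Y f s" and cs: "cs_star_continuous_map Y M s"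
    using Y unfolding cs_star_metrizable_def by blast
  have s: "s y \<in> topspace M" "f (s y) = y" if "y \<in> topspace Y" for y
    using sec that by (auto simp: section_of_def)
  let ?Z = "s ` topspace Y"
  have pc: "precompact_in M {x \<in> ?Z. f x \<in> K}" if K: "precompact_in Y K" for K
  proof -
    have "\<exists>a. accumulation_point_in M x a"
      if x: "range x \<subseteq> {x \<in> ?Z. f x \<in> K}" for x :: "nat \<Rightarrow> _"
    proof -
      have KY: "K \<subseteq> topspace Y" using K by (simp add: precompact_in_def)
      have sf: "s (f (x n)) = x n" "f (x n) \<in> K" for n
      proof -
        have "x n \<in> {x \<in> ?Z. f x \<in> K}" using x by blast
        then show "s (f (x n)) = x n" "f (x n) \<in> K" using s by auto
      qed
      then have "range (f \<circ> x) \<subseteq> K" by auto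
      then obtain l r where r: "strict_mono (r :: nat \<Rightarrow> nat)" and l: "limitin Y ((f \<circ> x) \<circ> r) l sequentially"
        using subseq[OF K] by blast
      then have "convergent_seq_in Y ((f \<circ> x) \<circ> r)"
        unfolding convergent_seq_in_def using sf(2) KY by auto
      then obtain a where "accumulation_point_in M (s \<circ> ((f \<circ> x) \<circ> r)) a"
        using cs unfolding cs_star_continuous_map_def by blast
      moreover have "s \<circ> ((f \<circ> x) \<circ> r) = x \<circ> r" using sf(1) by auto
      ultimately have acc: "accumulation_point_in M (x \<circ> r) a" by simp
      have "x n \<in> topspace M" for n using s(1)[of "f (x n)"] sf[of n] KY by auto
      then have "range (x \<circ> r) \<subseteq> topspace M" by auto
      then obtain q where q: "strict_mono q" "limitin M ((x \<circ> r) \<circ> q) a sequentially"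
        using accumulation_point_in_metrizable_subseq[OF M(1) acc] by blast
      then have "accumulation_point_in M x a"
        using accumulation_point_in_subseq[of "r \<circ> q" M x a] strict_mono_o[OF r q(1)]
        by (simp add: comp_assoc)
      then show ?thesis by blast
    qed
    moreover have "{x \<in> ?Z. f x \<in> K} \<subseteq> topspace M" using s by auto
    ultimately show ?thesis using precompact_in_metrizable_sequentially[OF M(1)] by blast
  qed
  have "pc_subproper_map M Y f"
    unfolding pc_subproper_map_def
  proof (intro conjI exI[of _ ?Z] allI impI)
    show "?Z \<subseteq> topspace M" "f ` ?Z = topspace Y" using s by force+
  qed (use f pc in auto)
  then show ?thesis unfolding k_star_metrizable_def using M by blast
qed

lemma cs_metrizable_imp_cs_star_metrizable:
  assumes Y: "cs_metrizable Y"
  shows "cs_star_metrizable Y"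
proof -
  obtain M :: "(nat \<Rightarrow> 'a) topology" and f s where M: "metrizable_space M" "f ` topspace M = topspace Y"
    "continuous_map M Y f" "section_of M Y f s" and s: "seq_continuous_map Y M s"
    using Y unfolding cs_metrizable_def by blast
  have "cs_star_continuous_map Y M s"
    using s accumulation_point_in_subseq[OF strict_mono_id]
    unfolding seq_continuous_map_def cs_star_continuous_map_def convergent_seq_in_def
    by (metis comp_id)
  then show ?thesis unfolding cs_star_metrizable_def using M by blast
qed

lemma metrizable_imp_k_metrizable:
  assumes "metrizable_space Y"
  shows "k_metrizable Y"
proof (rule k_metrizableI[OF assms])
  have "{x \<in> topspace Y. x \<in> K} = K" if "precompact_in Y K" for K
    using that by (auto simp: precompact_in_def)
  then show "pc_proper_map Y Y id" by (simp add: pc_proper_map_def)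
qed simp

lemma metrizable_imp_cs_metrizable: "metrizable_space Y \<Longrightarrow> cs_metrizable Y"
  by (rule cs_metrizableI[where f = id and s = id])
    (auto simp: section_of_def seq_continuous_map_def)

text \<open>Accumulation points of the lifted sequence stay in the preimage of \<open>C\<close>
  because this preimage is closed.\<close>

lemma cs_star_metrizable_closed_subspace:
  assumes Y: "cs_star_metrizable Y" and C: "closedin Y C"
  shows "cs_star_metrizable (subtopology Y C)"
proof -
  obtain M :: "(nat \<Rightarrow> 'a) topology" and f s where M: "metrizable_space M" "f ` topspace M = topspace Y"
    and f: "continuous_map M Y f" and sec: "section_of M Y f s" and cs: "cs_star_continuous_map Y M s"
    using Y unfolding cs_star_metrizable_def by blast
  have CY: "C \<subseteq> topspace Y" using C closedin_subset by blast
  define D where "D = {x \<in> topspace M. f x \<in> C}"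
  have D: "closedin M D" unfolding D_def using f C by (rule closedin_continuous_map_preimage)
  have s: "s y \<in> D" "f (s y) = y" if "y \<in> C" for y
    using sec that CY by (auto simp: section_of_def D_def)
  have "\<exists>a. accumulation_point_in (subtopology M D) (s \<circ> y) a"
    if y: "convergent_seq_in (subtopology Y C) y" for y
  proof -
    have yC: "range y \<subseteq> C" using y by (auto simp: convergent_seq_in_def)
    have "convergent_seq_in Y y" using y by (auto simp: convergent_seq_in_def limitin_subtopology)
    then obtain a where a: "accumulation_point_in M (s \<circ> y) a"
      using cs by (auto simp: cs_star_continuous_map_def)
    have sy: "s (y n) \<in> D" for n using s yC by blast
    have "a \<in> D"
    proof (rule ccontr)
      assume "a \<notin> D"
      then have "infinite {n. (s \<circ> y) n \<in> topspace M - D}"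
        using a D unfolding accumulation_point_in_def by (metis DiffI closedin_def)
      then show False using sy by simp
    qed
    then have "accumulation_point_in (subtopology M D) (s \<circ> y) a"
      using a sy by (auto simp: accumulation_point_in_def openin_subtopology)
    then show ?thesis by blast
  qed
  then have "cs_star_continuous_map (subtopology Y C) (subtopology M D) s"
    unfolding cs_star_continuous_map_def using s by (auto simp: D_def)
  moreover have "section_of (subtopology M D) (subtopology Y C) f s"
    unfolding section_of_def using s by (auto simp: D_def)
  moreover have "continuous_map (subtopology M D) (subtopology Y C) f"
    using f by (auto simp: continuous_map_in_subtopology continuous_map_from_subtopology D_def)
  ultimately show ?thesis
    using cs_star_metrizableI M(1) metrizable_space_subtopology by blast
qed

subsection \<open>Countable separating families of functionals\<close>

text \<open>Made for countable sets, which can be closed under rational but hardly under real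
  multiples; a real multiple is reached by approximating scalar and vector simultaneously.\<close>

lemma subspace_closure_if_rational_subspace:
  fixes D :: "'a::real_normed_vector set"
  assumes zero: "0 \<in> D" and add: "\<And>x y. x \<in> D \<Longrightarrow> y \<in> D \<Longrightarrow> x + y \<in> D"
    and scale: "\<And>q x. x \<in> D \<Longrightarrow> of_rat q *\<^sub>R x \<in> D"
  shows "subspace (closure D)"
proof (rule subspaceI)
  show "0 \<in> closure D" using zero closure_subset by blast
  fix x assume "x \<in> closure D"
  then obtain u where u: "\<And>n. u n \<in> D" "u \<longlonglongrightarrow> x" by (auto simp: closure_sequential)
  {
    fix y assume "y \<in> closure D"
    then obtain v where v: "\<And>n. v n \<in> D" "v \<longlonglongrightarrow> y" by (auto simp: closure_sequential)
    have "(\<lambda>n. u n + v n) \<longlonglongrightarrow> x + y" by (intro tendsto_add u v)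
    then show "x + y \<in> closure D"
      using add[OF u(1) v(1)] by (auto simp: closure_sequential intro!: exI[of _ "\<lambda>n. u n + v n"])
  }
  fix c :: real
  have "\<exists>q. c < of_rat q \<and> of_rat q < c + inverse (Suc n)" for n
    by (intro of_rat_dense) simp
  then obtain q where q: "\<And>n. c < of_rat (q n)" "\<And>n. of_rat (q n) < c + inverse (Suc n)" by metis
  have lim: "(\<lambda>n. c + inverse (real (Suc n))) \<longlonglongrightarrow> c"
    using tendsto_add[OF tendsto_const LIMSEQ_inverse_real_of_nat] by simp
  have lo: "\<forall>\<^sub>F n in sequentially. c \<le> of_rat (q n)"
    using q(1) by (simp add: less_imp_le)
  have hi: "\<forall>\<^sub>F n in sequentially. of_rat (q n) \<le> c + inverse (real (Suc n))"
    using q(2) by (simp add: less_imp_le)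
  have "(\<lambda>n. of_rat (q n)) \<longlonglongrightarrow> c"
    by (rule tendsto_sandwich[OF lo hi tendsto_const lim])
  then have "(\<lambda>n. of_rat (q n) *\<^sub>R u n) \<longlonglongrightarrow> c *\<^sub>R x" by (intro tendsto_scaleR u)
  then show "c *\<^sub>R x \<in> closure D"
    using scale[OF u(1)] by (auto simp: closure_sequential intro!: exI[of _ "\<lambda>n. of_rat (q n) *\<^sub>R u n"])
qed

lemma subspace_closure:
  fixes S :: "'a::real_normed_vector set"
  shows "subspace S \<Longrightarrow> subspace (closure S)"
  by (rule subspace_closure_if_rational_subspace)
    (auto simp: subspace_0 subspace_add subspace_scale)

lemma countable_dense_subset_span:
  fixes S :: "'a::real_normed_vector set"
  assumes "countable S"
  obtains D where "countable D" "D \<subseteq> span S" "span S \<subseteq> closure D"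
proof -
  \<comment> \<open>Lists code the rational combinations, so that countability of \<open>D\<close>
    is that of a set of lists.\<close>
  define h where "h xs = (\<Sum>(q, v)\<leftarrow>xs. of_rat q *\<^sub>R v)" for xs :: "(rat \<times> 'a) list"
  define D where "D = h ` lists (UNIV \<times> S)"
  have "countable D" unfolding D_def using assms by simp
  moreover have "D \<subseteq> span S"
  proof -
    have "h xs \<in> span S" if "xs \<in> lists (UNIV \<times> S)" for xs
      using that by (induction xs) (auto simp: h_def span_zero span_base span_add span_scale)
    then show ?thesis by (auto simp: D_def)
  qed
  moreover have "span S \<subseteq> closure D"
  proof (rule span_minimal)
    have "v \<in> D" if "v \<in> S" for v
      unfolding D_def using that by (intro image_eqI[of _ _ "[(1, v)]"]) (auto simp: h_def)
    then show "S \<subseteq> closure D" using closure_subset by blast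
    show "subspace (closure D)"
    proof (rule subspace_closure_if_rational_subspace)
      show "0 \<in> D" unfolding D_def by (intro image_eqI[of _ _ "[]"]) (auto simp: h_def)
      fix x assume "x \<in> D"
      then obtain xs where xs: "xs \<in> lists (UNIV \<times> S)" "x = h xs" by (auto simp: D_def)
      {
        fix y assume "y \<in> D"
        then obtain ys where ys: "ys \<in> lists (UNIV \<times> S)" "y = h ys" by (auto simp: D_def)
        show "x + y \<in> D"
          unfolding D_def using xs ys by (intro image_eqI[of _ _ "xs @ ys"]) (auto simp: h_def)
      }
      fix q :: rat
      have "of_rat q *\<^sub>R h xs = h (map (\<lambda>(r, v). (q * r, v)) xs)"
        by (induction xs) (auto simp: h_def of_rat_mult scaleR_add_right)
      moreover have "map (\<lambda>(r, v). (q * r, v)) xs \<in> lists (UNIV \<times> S)" using xs(1) by auto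
      ultimately show "of_rat q *\<^sub>R x \<in> D" unfolding D_def xs(2) by (rule image_eqI)
    qed
  qed
  ultimately show thesis by (rule that)
qed

text \<open>Take norming functionals of the points of \<open>D\<close>. If all vanish at
  \<open>w\<close>, then a point \<open>x\<close> of \<open>D\<close> near \<open>w\<close>
  satisfies \<open>norm x = N x (x - w) \<le> norm (x - w)\<close>, so \<open>x\<close> and with it
  \<open>w\<close> are arbitrarily small.\<close>

lemma separating_functionals_on_separable:
  fixes D :: "'a::real_normed_vector set"
  assumes "countable D"
  obtains \<Phi> :: "nat \<Rightarrow> 'a \<Rightarrow> real" where "\<And>n. bounded_linear (\<Phi> n)"
    "\<And>w. w \<in> closure D \<Longrightarrow> (\<And>n. \<Phi> n w = 0) \<Longrightarrow> w = 0"
proof -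
  have "\<exists>\<phi>. bounded_linear \<phi> \<and> (\<forall>y. \<bar>\<phi> y\<bar> \<le> norm y) \<and> \<phi> x = norm x" for x :: 'a
    using norming_functional[of x] by metis
  then obtain N :: "'a \<Rightarrow> 'a \<Rightarrow> real" where N: "\<And>x. bounded_linear (N x)"
    "\<And>x y. \<bar>N x y\<bar> \<le> norm y" "\<And>x. N x x = norm x" by metis
  show thesis
  proof (rule that[of "\<lambda>n. N (from_nat_into D n)"])
    show "bounded_linear (N (from_nat_into D n))" for n by (rule N)
    fix w assume w: "w \<in> closure D" "\<And>n. N (from_nat_into D n) w = 0"
    have "norm w \<le> 0 + e" if e: "e > 0" for e
    proof -
      have "\<exists>x\<in>D. dist x w < e / 2"
        using w(1)[unfolded closure_approachable, rule_format, of "e / 2"] e by simp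
      then obtain x where x: "x \<in> D" "dist x w < e / 2" by blast
      then obtain n where "x = from_nat_into D n"
        using assms by (metis from_nat_into_surj)
      then have "N x w = 0" using w(2) by simp
      then have "norm x = \<bar>N x (x - w)\<bar>"
        using N(3)[of x] by (simp add: linear_diff[OF bounded_linear.linear[OF N(1)]])
      also have "\<dots> \<le> norm (x - w)" by (rule N(2))
      finally have "norm x < e / 2" using x(2) by (simp add: dist_norm)
      then show ?thesis using x(2) norm_triangle_ineq2[of w x] by (simp add: dist_norm norm_minus_commute)
    qed
    then have "norm w \<le> 0" by (rule field_le_epsilon)
    then show "w = 0" by simp
  qed
qed

lemma continuous_map_weak_functional_sequence:
  fixes \<Phi> :: "nat \<Rightarrow> 'a::real_normed_vector \<Rightarrow> real"
  assumes "\<And>n. bounded_linear (\<Phi> n)"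
  shows "continuous_map weak_topology (product_topology (\<lambda>_. euclideanreal) UNIV) (\<lambda>x n. \<Phi> n x)"
  using assms by (simp add: continuous_map_componentwise_UNIV continuous_map_weak_functional)

lemma metrizable_space_real_sequences:
  "metrizable_space (product_topology (\<lambda>_ :: nat. euclideanreal) UNIV)"
  by (simp add: metrizable_space_product_topology metrizable_space_euclidean)

lemma embedding_map_into_metrizable:
  assumes "embedding_map X Y f" "metrizable_space Y"
  shows "metrizable_space X"
  using assms embedding_map_imp_homeomorphic_space homeomorphic_metrizable_space
    metrizable_space_subtopology by metis

subsection \<open>Sequential compactness of weakly compact sets\<close>

text \<open>The sequence lives in a separable closed subspace \<open>W\<close>, which is weakly
  closed as well. Countably many functionals separate the points of \<open>W\<close>, and they embed
  the compact set \<open>C\<close> into a countable product of lines. Thus \<open>C\<close> is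
  metrizable, although the weak closure of \<open>K\<close> itself need not be.\<close>

theorem weakly_precompact_subsequence:
  fixes K :: "'a::real_normed_vector set" and y :: "nat \<Rightarrow> 'a"
  assumes K: "precompact_in weak_topology K" and y: "range y \<subseteq> K"
  obtains l r where "l \<in> weak_topology closure_of K" "strict_mono r"
    "limitin weak_topology (y \<circ> r) l sequentially"
proof -
  define W where "W = closure (span (range y))"
  have W: "subspace W" "closed W" unfolding W_def by (auto intro: subspace_closure)
  define C where "C = weak_topology closure_of K \<inter> W"
  have C: "compactin weak_topology C"
    unfolding C_def using K closedin_weak_closed_subspace[OF W]
    by (intro compact_Int_closedin) (auto simp: precompact_in_def)
  obtain D where D: "countable D" "D \<subseteq> span (range y)" "span (range y) \<subseteq> closure D"
    by (rule countable_dense_subset_span[of "range y"]) auto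
  have WD: "W \<subseteq> closure D" unfolding W_def using D(3) by (simp add: closure_minimal)
  obtain \<Phi> :: "nat \<Rightarrow> 'a \<Rightarrow> real" where \<Phi>: "\<And>n. bounded_linear (\<Phi> n)"
    "\<And>w. w \<in> closure D \<Longrightarrow> (\<And>n. \<Phi> n w = 0) \<Longrightarrow> w = 0"
    using separating_functionals_on_separable[OF D(1)] by blast
  let ?X = "subtopology weak_topology C"
  have inj: "inj_on (\<lambda>x n. \<Phi> n x) C"
  proof (rule inj_onI)
    fix x z assume xz: "x \<in> C" "z \<in> C" "(\<lambda>n. \<Phi> n x) = (\<lambda>n. \<Phi> n z)"
    have "\<Phi> n (x - z) = 0" for n
      using fun_cong[OF xz(3), of n] by (simp add: linear_diff[OF bounded_linear.linear[OF \<Phi>(1)]])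
    moreover have "x - z \<in> closure D"
      using xz(1,2) WD subspace_diff[OF W(1)] unfolding C_def by blast
    ultimately have "x - z = 0" using \<Phi>(2) by blast
    then show "x = z" by simp
  qed
  have "embedding_map ?X (product_topology (\<lambda>_. euclideanreal) UNIV) (\<lambda>x n. \<Phi> n x)"
  proof (rule continuous_imp_embedding_map)
    show "continuous_map ?X (product_topology (\<lambda>_. euclideanreal) UNIV) (\<lambda>x n. \<Phi> n x)"
      using continuous_map_weak_functional_sequence[OF \<Phi>(1)] by (rule continuous_map_from_subtopology)
    show "compact_space ?X" using C by (rule compact_space_subtopology)
    show "Hausdorff_space (product_topology (\<lambda>_ :: nat. euclideanreal) UNIV)"
      by (rule metrizable_imp_Hausdorff_space[OF metrizable_space_real_sequences])
    show "inj_on (\<lambda>x n. \<Phi> n x) (topspace ?X)" using inj by simp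
  qed
  then have "metrizable_space ?X"
    using embedding_map_into_metrizable metrizable_space_real_sequences by blast
  then obtain S d where Sd: "Metric_space S d" "?X = Metric_space.mtopology S d"
    unfolding metrizable_space_def by blast
  interpret Metric_space S d by (rule Sd(1))
  have S: "S = C" using arg_cong[OF Sd(2), of topspace] by simp
  have "compact_space mtopology" using C Sd(2) compact_space_subtopology by metis
  moreover have "range y \<subseteq> S"
  proof -
    have "K \<subseteq> weak_topology closure_of K" by (rule closure_of_subset) simp
    moreover have "range y \<subseteq> W"
      unfolding W_def by (rule subset_trans[OF span_superset closure_subset])
    ultimately show ?thesis using y unfolding S C_def by (meson Int_greatest subset_trans)
  qed
  ultimately obtain l r where l: "l \<in> S" "strict_mono (r :: nat \<Rightarrow> nat)" "limitin mtopology (y \<circ> r) l sequentially"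
    unfolding compact_space_sequentially by blast
  have "limitin weak_topology (y \<circ> r) l sequentially"
    using l(3) unfolding Sd(2)[symmetric] limitin_subtopology by blast
  moreover have "l \<in> weak_topology closure_of K" using l(1) unfolding S C_def by blast
  ultimately show thesis using that l(2) by blast
qed

lemma k_star_iff_cs_star_metrizable_weak_closed:
  fixes A :: "'a::real_normed_vector set"
  assumes A: "closedin weak_topology A"
  shows "k_star_metrizable (subtopology weak_topology A) \<longleftrightarrow> cs_star_metrizable (subtopology weak_topology A)"
proof
  assume "k_star_metrizable (subtopology weak_topology A)"
  then show "cs_star_metrizable (subtopology weak_topology A)"
    by (intro k_star_metrizable_imp_cs_star_metrizable Hausdorff_space_subtopology Hausdorff_space_weak_topology)
next
  assume "cs_star_metrizable (subtopology weak_topology A)"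
  then show "k_star_metrizable (subtopology weak_topology A)"
  proof (rule cs_star_metrizable_imp_k_star_metrizable)
    fix K and y :: "nat \<Rightarrow> 'a"
    assume K: "precompact_in (subtopology weak_topology A) K" and y: "range y \<subseteq> K"
    have KA: "K \<subseteq> A" using K by (simp add: precompact_in_def)
    then have cl: "weak_topology closure_of K \<subseteq> A" using A by (rule closure_of_minimal)
    then have "subtopology weak_topology A closure_of K = weak_topology closure_of K"
      using closure_of_subtopology_open[of weak_topology A K] KA by blast
    then have "precompact_in weak_topology K"
      using K by (simp add: precompact_in_def compactin_subtopology)
    then obtain l r where l: "l \<in> weak_topology closure_of K" "strict_mono r"
      "limitin weak_topology (y \<circ> r) l sequentially"
      using weakly_precompact_subsequence[OF _ y] by blast
    moreover have "\<forall>n. (y \<circ> r) n \<in> A" using y KA by auto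
    ultimately have "limitin (subtopology weak_topology A) (y \<circ> r) l sequentially"
      using cl by (auto simp: limitin_subtopology)
    then show "\<exists>l r. strict_mono (r :: nat \<Rightarrow> nat) \<and> limitin (subtopology weak_topology A) (y \<circ> r) l sequentially"
      using l(2) by blast
  qed
qed

subsection \<open>From the unit ball to the whole space\<close>

lemma continuous_map_into_weak_topology:
  fixes g :: "'b \<Rightarrow> 'a::real_normed_vector"
  assumes "\<And>\<phi> :: 'a \<Rightarrow> real. bounded_linear \<phi> \<Longrightarrow> continuous_map Z euclideanreal (\<lambda>z. \<phi> (g z))"
  shows "continuous_map Z weak_topology g"
  unfolding weak_topology_def
proof (rule continuous_on_generated_topo)
  show "g ` topspace Z \<subseteq> \<Union> {\<phi> -` U | \<phi> U. bounded_linear (\<phi> :: 'a \<Rightarrow> real) \<and> open U}"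
    using topspace_weak_topology[where 'a = 'a] unfolding weak_topology_def topology_generated_by_topspace by simp
  fix V assume "V \<in> {\<phi> -` U | \<phi> U. bounded_linear (\<phi> :: 'a \<Rightarrow> real) \<and> open U}"
  then obtain \<phi> :: "'a \<Rightarrow> real" and U where \<phi>: "bounded_linear \<phi>" "open U" "V = \<phi> -` U" by blast
  then have "openin Z {z \<in> topspace Z. \<phi> (g z) \<in> U}"
    using assms by (intro openin_continuous_map_preimage[of Z euclideanreal]) auto
  moreover have "g -` V \<inter> topspace Z = {z \<in> topspace Z. \<phi> (g z) \<in> U}" using \<phi>(3) by auto
  ultimately show "openin Z (g -` V \<inter> topspace Z)" by simp
qed

text \<open>The second coordinate of \<open>N\<close> records the dilation factor. Along a weakly
  convergent sequence it may oscillate, but boundedness leaves finitely many values, and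
  cs*-continuity demands one accumulation point: it suffices to look at a subsequence with constant
  factor.\<close>

theorem cs_star_metrizable_weak_if_unit_ball:
  assumes "cs_star_metrizable (subtopology weak_topology (cball (0 :: 'a::real_normed_vector) 1))"
  shows "cs_star_metrizable (weak_topology :: 'a topology)"
proof -
  let ?B = "cball (0 :: 'a) 1"
  obtain M :: "(nat \<Rightarrow> 'a) topology" and f s where M: "metrizable_space M" "f ` topspace M = ?B"
    and f: "continuous_map M (subtopology weak_topology ?B) f"
    and sec: "section_of M (subtopology weak_topology ?B) f s"
    and cs: "cs_star_continuous_map (subtopology weak_topology ?B) M s"
    using assms unfolding cs_star_metrizable_def by auto
  define N where "N = prod_topology M (discrete_topology (UNIV :: nat set))"
  define g where "g = (\<lambda>(m, n). real (Suc n) *\<^sub>R f m)"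
  \<comment> \<open>The level of \<open>0\<close> is \<open>0\<close>; scaling by
    \<open>Suc (k x)\<close> avoids dividing by it.\<close>
  define k where "k x = nat \<lceil>norm x\<rceil>" for x :: 'a
  define t where "t x = (s (x /\<^sub>R real (Suc (k x))), k x)" for x
  have in_ball: "x /\<^sub>R real (Suc (k x)) \<in> ?B" for x :: 'a
  proof -
    have "norm x \<le> real (Suc (k x))" unfolding k_def by linarith
    then show ?thesis by (simp add: field_simps)
  qed
  have s: "s x \<in> topspace M" "f (s x) = x" if "x \<in> ?B" for x
    using sec that by (auto simp: section_of_def)
  have gt: "g (t x) = x" for x
    using s(2)[OF in_ball] by (simp add: g_def t_def)
  show ?thesis
  proof (rule cs_star_metrizableI[of N _ g t])
    show "metrizable_space N"
      unfolding N_def using M(1) by (simp add: metrizable_space_prod_topology)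
    show "continuous_map N weak_topology g"
    proof (rule continuous_map_into_weak_topology)
      fix \<phi> :: "'a \<Rightarrow> real" assume \<phi>: "bounded_linear \<phi>"
      have "continuous_map M euclideanreal (\<phi> \<circ> f)"
        using f continuous_map_weak_functional[OF \<phi>] continuous_map_compose continuous_map_in_subtopology by blast
      then have "continuous_map N euclideanreal ((\<phi> \<circ> f) \<circ> fst)"
        unfolding N_def by (rule continuous_map_compose[OF continuous_map_fst])
      moreover have "continuous_map N euclideanreal ((\<lambda>n. real (Suc n)) \<circ> snd)"
        unfolding N_def by (rule continuous_map_compose[OF continuous_map_snd]) simp
      ultimately have "continuous_map N euclideanreal (\<lambda>z. ((\<lambda>n. real (Suc n)) \<circ> snd) z * ((\<phi> \<circ> f) \<circ> fst) z)"
        by (intro continuous_map_real_mult)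
      moreover have "(\<lambda>z. ((\<lambda>n. real (Suc n)) \<circ> snd) z * ((\<phi> \<circ> f) \<circ> fst) z) = (\<lambda>z. \<phi> (g z))"
        using linear_scale[OF bounded_linear.linear[OF \<phi>]] by (auto simp: g_def)
      ultimately show "continuous_map N euclideanreal (\<lambda>z. \<phi> (g z))" by simp
    qed
    show "section_of N weak_topology g t"
      unfolding section_of_def using s(1)[OF in_ball] gt by (auto simp: N_def t_def)
    show "cs_star_continuous_map weak_topology N t"
      unfolding cs_star_continuous_map_def
    proof (intro conjI allI impI)
      show "t \<in> topspace weak_topology \<rightarrow> topspace N"
        using s(1)[OF in_ball] by (auto simp: N_def t_def)
      fix y :: "nat \<Rightarrow> 'a" assume "convergent_seq_in weak_topology y"
      then obtain l where l: "limitin weak_topology y l sequentially"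
        by (auto simp: convergent_seq_in_def)
      then obtain b where b: "\<And>i. norm (y i) \<le> b"
        using limitin_weak_imp_bounded[of y l] by (auto simp: bounded_iff)
      have "(\<lambda>i. k (y i)) ` UNIV \<subseteq> {..nat \<lceil>b\<rceil>}"
        using b by (auto simp: k_def intro!: nat_mono ceiling_mono)
      then have "finite ((\<lambda>i. k (y i)) ` UNIV)" by (rule finite_subset) simp
      then obtain i0 where "infinite {i \<in> UNIV. k (y i) = k (y i0)}"
        using pigeonhole_infinite[OF infinite_UNIV_nat] by blast
      then obtain n where "infinite {i. k (y i) = n}" by auto
      then obtain r :: "nat \<Rightarrow> nat" where r: "strict_mono r" "\<And>i. k (y (r i)) = n"
        using infinite_enumerate[of "{i. k (y i) = n}"] by auto
      define z where "z i = y (r i) /\<^sub>R real (Suc n)" for i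
      have z: "z i \<in> ?B" for i using in_ball[of "y (r i)"] by (simp add: r(2) z_def)
      have "limitin weak_topology z (l /\<^sub>R real (Suc n)) sequentially"
        unfolding limitin_weak_topology
      proof (intro allI impI)
        fix \<phi> :: "'a \<Rightarrow> real" assume \<phi>: "bounded_linear \<phi>"
        then have "(\<lambda>i. \<phi> (y i)) \<longlonglongrightarrow> \<phi> l" using l by (simp add: limitin_weak_topology)
        then have "(\<lambda>i. \<phi> (y (r i))) \<longlonglongrightarrow> \<phi> l"
          using LIMSEQ_subseq_LIMSEQ[OF _ r(1), of "\<lambda>i. \<phi> (y i)"] by (simp add: comp_def)
        then show "(\<lambda>i. \<phi> (z i)) \<longlonglongrightarrow> \<phi> (l /\<^sub>R real (Suc n))"
          unfolding z_def linear_scale[OF bounded_linear.linear[OF \<phi>]] by (intro tendsto_scaleR tendsto_const)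
      qed
      moreover from this have "l /\<^sub>R real (Suc n) \<in> ?B"
        using z by (intro limitin_closedin[OF _ closedin_weak_cball]) auto
      ultimately have "convergent_seq_in (subtopology weak_topology ?B) z"
        unfolding convergent_seq_in_def limitin_subtopology using z
        by (intro conjI exI[of _ "l /\<^sub>R real (Suc n)"]) auto
      then obtain a where a: "accumulation_point_in M (s \<circ> z) a"
        using cs by (auto simp: cs_star_continuous_map_def)
      have "accumulation_point_in N (t \<circ> y) (a, n)"
        unfolding accumulation_point_in_def
      proof (intro conjI allI impI)
        show "(a, n) \<in> topspace N" using a by (simp add: N_def accumulation_point_in_def)
        fix U assume "openin N U \<and> (a, n) \<in> U"
        then obtain V E where V: "openin M V" "a \<in> V" "n \<in> E" "V \<times> E \<subseteq> U"
          unfolding N_def openin_prod_topology_alt by blast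
        then have inf: "infinite {i. (s \<circ> z) i \<in> V}"
          using a by (simp add: accumulation_point_in_def)
        have "infinite (r ` {i. (s \<circ> z) i \<in> V})"
          using finite_imageD[OF _ strict_mono_imp_inj_on[OF r(1)]] inf by blast
        moreover have "r ` {i. (s \<circ> z) i \<in> V} \<subseteq> {i. (t \<circ> y) i \<in> U}"
          using V by (auto simp: t_def r(2) z_def)
        ultimately show "infinite {i. (t \<circ> y) i \<in> U}" using infinite_super by blast
      qed
      then show "\<exists>a. accumulation_point_in N (t \<circ> y) a" by blast
    qed
  qed
qed

subsection \<open>Separable duals\<close>

text \<open>On the ball every functional is a uniform limit of members of a countable dense set. The
  values of these members therefore separate points and determine the weak neighbourhoods, so they
  embed the ball into a countable product of lines.\<close>

theorem metrizable_weak_unit_ball_if_separable_dual: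
  assumes "separable_space (euclidean :: ('a::real_normed_vector \<Rightarrow>\<^sub>L real) topology)"
  shows "metrizable_space (subtopology weak_topology (cball (0 :: 'a) 1))"
proof -
  let ?B = "cball (0 :: 'a) 1"
  let ?P = "product_topology (\<lambda>_ :: nat. euclideanreal) UNIV"
  obtain C :: "('a \<Rightarrow>\<^sub>L real) set" where C: "countable C" "closure C = UNIV"
    using assms unfolding separable_space_def by auto
  then have "C \<noteq> {}" by auto
  then obtain G :: "nat \<Rightarrow> 'a \<Rightarrow>\<^sub>L real" where G: "range G = C"
    using C(1) by (metis uncountable_def)
  define \<Psi> where "\<Psi> x n = G n x" for x n
  have approx: "\<exists>n. \<forall>x\<in>?B. \<bar>\<phi> x - \<Psi> x n\<bar> < e" if \<phi>: "bounded_linear \<phi>" and e: "e > 0" for \<phi> e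
  proof -
    have "Blinfun \<phi> \<in> closure C" using C(2) by simp
    then obtain n where n: "dist (G n) (Blinfun \<phi>) < e"
      using e G by (metis closure_approachable rangeE)
    have "\<bar>\<phi> x - \<Psi> x n\<bar> < e" if "x \<in> ?B" for x
    proof -
      have "\<bar>\<phi> x - \<Psi> x n\<bar> = norm ((Blinfun \<phi> - G n) x)"
        by (simp add: \<Psi>_def blinfun.bilinear_simps bounded_linear_Blinfun_apply[OF \<phi>])
      also have "\<dots> \<le> norm (Blinfun \<phi> - G n) * norm x" by (rule norm_blinfun)
      also have "\<dots> \<le> norm (Blinfun \<phi> - G n) * 1" using that by (intro mult_left_mono) auto
      finally show ?thesis using n by (simp add: dist_norm norm_minus_commute)
    qed
    then show ?thesis by blast
  qed
  have inj: "inj_on \<Psi> ?B"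
  proof (rule inj_onI, rule ccontr)
    fix x y assume xy: "x \<in> ?B" "y \<in> ?B" "\<Psi> x = \<Psi> y" "x \<noteq> y"
    obtain \<phi> where \<phi>: "bounded_linear \<phi>" "\<phi> (x - y) = norm (x - y)"
      by (rule norming_functional[of "x - y"])
    define e where "e = norm (x - y) / 2"
    have "e > 0" using xy(4) by (simp add: e_def)
    then obtain n where "\<bar>\<phi> x - \<Psi> x n\<bar> < e" "\<bar>\<phi> y - \<Psi> y n\<bar> < e"
      using approx[OF \<phi>(1)] xy(1,2) by meson
    moreover have "\<phi> x - \<phi> y = 2 * e"
      using \<phi>(2) by (simp add: e_def linear_diff[OF bounded_linear.linear[OF \<phi>(1)]])
    ultimately show False using xy(3) by simp
  qed
  have "homeomorphic_map (subtopology weak_topology ?B) (subtopology ?P (\<Psi> ` ?B)) \<Psi>"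
  proof (rule bijective_open_imp_homeomorphic_map)
    have "continuous_map weak_topology ?P (\<lambda>x n. blinfun_apply (G n) x)"
      by (rule continuous_map_weak_functional_sequence) (rule blinfun.bounded_linear_right)
    then have "continuous_map weak_topology ?P \<Psi>" unfolding \<Psi>_def .
    then show "continuous_map (subtopology weak_topology ?B) (subtopology ?P (\<Psi> ` ?B)) \<Psi>"
      by (auto simp: continuous_map_in_subtopology continuous_map_from_subtopology)
    show "open_map (subtopology weak_topology ?B) (subtopology ?P (\<Psi> ` ?B)) \<Psi>"
      unfolding open_map_def
    proof (intro allI impI)
      fix U assume "openin (subtopology weak_topology ?B) U"
      then obtain V where V: "openin weak_topology V" "U = V \<inter> ?B" by (auto simp: openin_subtopology)
      show "openin (subtopology ?P (\<Psi> ` ?B)) (\<Psi> ` U)"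
      proof (subst openin_subopen, clarify)
        fix x assume x: "x \<in> U"
        then obtain F :: "('a \<Rightarrow> real) set" and e where F: "finite F" "\<And>\<phi>. \<phi> \<in> F \<Longrightarrow> bounded_linear \<phi>"
          "e > 0" "{y. \<forall>\<phi>\<in>F. \<bar>\<phi> y - \<phi> x\<bar> < e} \<subseteq> V"
          using V openin_weak_topologyD[of V x] by blast
        \<comment> \<open>Three errors add up to \<open>e\<close>: replacing \<open>\<phi>\<close>
          by its approximation at \<open>y\<close>, the same at \<open>x\<close>, and the change of
          the approximation between the two points.\<close>
        have "\<exists>k. \<forall>y\<in>?B. \<bar>\<phi> y - \<Psi> y k\<bar> < e / 3" if "\<phi> \<in> F" for \<phi>
          using approx[OF F(2)[OF that], of "e / 3"] F(3) by simp
        then obtain n where n: "\<And>\<phi> y. \<phi> \<in> F \<Longrightarrow> y \<in> ?B \<Longrightarrow> \<bar>\<phi> y - \<Psi> y (n \<phi>)\<bar> < e / 3"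
          by metis
        define T where "T = topspace ?P \<inter> (\<Inter>\<phi>\<in>F. {h \<in> topspace ?P. h (n \<phi>) \<in> ball (\<Psi> x (n \<phi>)) (e / 3)})"
        have "openin ?P T"
          unfolding T_def using F(1)
          by (subst Int_commute, intro openin_INT openin_continuous_map_preimage[where Y = euclideanreal])
            (auto intro: continuous_map_product_projection)
        then have "openin (subtopology ?P (\<Psi> ` ?B)) (\<Psi> ` ?B \<inter> T)" by (rule openin_subtopology_Int2)
        moreover have "\<Psi> x \<in> \<Psi> ` ?B \<inter> T" using x V(2) F(3) by (auto simp: T_def)
        moreover have "\<Psi> ` ?B \<inter> T \<subseteq> \<Psi> ` U"
        proof clarify
          fix y assume y: "\<Psi> y \<in> T" "y \<in> ?B"
          have "\<bar>\<phi> y - \<phi> x\<bar> < e" if \<phi>: "\<phi> \<in> F" for \<phi>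
          proof -
            have "\<bar>\<Psi> x (n \<phi>) - \<Psi> y (n \<phi>)\<bar> < e / 3"
              using y(1) \<phi> by (auto simp: T_def dist_real_def)
            moreover have "\<bar>\<phi> y - \<Psi> y (n \<phi>)\<bar> < e / 3" "\<bar>\<phi> x - \<Psi> x (n \<phi>)\<bar> < e / 3"
              using n \<phi> y(2) x V(2) by auto
            ultimately show ?thesis by linarith
          qed
          then have "y \<in> V" using F(4) by blast
          then show "\<Psi> y \<in> \<Psi> ` U" using y(2) V(2) by blast
        qed
        ultimately show "\<exists>T. openin (subtopology ?P (\<Psi> ` ?B)) T \<and> \<Psi> x \<in> T \<and> T \<subseteq> \<Psi> ` U" by blast
      qed
    qed
    show "\<Psi> ` topspace (subtopology weak_topology ?B) = topspace (subtopology ?P (\<Psi> ` ?B))" by auto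
    show "inj_on \<Psi> (topspace (subtopology weak_topology ?B))" using inj by simp
  qed
  then have "embedding_map (subtopology weak_topology ?B) ?P \<Psi>"
    by (simp add: embedding_map_def)
  then show ?thesis using embedding_map_into_metrizable metrizable_space_real_sequences by blast
qed

subsection \<open>Countable tightness of the weak topology\<close>

lemma zero_in_weak_closure:
  fixes A :: "'a::real_normed_vector set"
  shows "0 \<in> weak_topology closure_of A \<longleftrightarrow>
    (\<forall>F \<epsilon>. finite F \<and> (\<forall>\<phi>\<in>F. bounded_linear (\<phi> :: 'a \<Rightarrow> real)) \<and> \<epsilon> > 0 \<longrightarrow>
      (\<exists>a\<in>A. \<forall>\<phi>\<in>F. \<bar>\<phi> a\<bar> < \<epsilon>))"
    (is "?L \<longleftrightarrow> ?R")
proof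
  assume L: ?L
  show ?R
  proof (intro allI impI, elim conjE)
    fix F :: "('a \<Rightarrow> real) set" and \<epsilon> :: real
    assume F: "finite F" "\<forall>\<phi>\<in>F. bounded_linear \<phi>" "\<epsilon> > 0"
    have zero: "\<phi> 0 = 0" if "\<phi> \<in> F" for \<phi>
      using F(2) that by (simp add: linear_0 bounded_linear.linear)
    define V where "V = {y. \<forall>\<phi>\<in>F. \<bar>\<phi> y - \<phi> 0\<bar> < \<epsilon>}"
    have "openin weak_topology V"
      unfolding V_def using F by (intro openin_weak_topologyI) auto
    moreover have "0 \<in> V" using F(3) by (simp add: V_def)
    ultimately have "\<exists>a. a \<in> A \<and> a \<in> V" using L unfolding in_closure_of by blast
    then obtain a where "a \<in> A" "a \<in> V" by blast
    have "\<bar>\<phi> a\<bar> < \<epsilon>" if "\<phi> \<in> F" for \<phi>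
      using \<open>a \<in> V\<close> that zero[OF that] by (force simp: V_def)
    then show "\<exists>a\<in>A. \<forall>\<phi>\<in>F. \<bar>\<phi> a\<bar> < \<epsilon>" using \<open>a \<in> A\<close> by blast
  qed
next
  assume R: ?R
  show ?L
    unfolding in_closure_of
  proof (intro conjI allI impI)
    fix U :: "'a set" assume U: "0 \<in> U \<and> openin weak_topology U"
    obtain F \<epsilon> where F: "finite F" "\<And>\<phi>. \<phi> \<in> F \<Longrightarrow> bounded_linear (\<phi> :: 'a \<Rightarrow> real)" "\<epsilon> > 0"
      "{y. \<forall>\<phi>\<in>F. \<bar>\<phi> y - \<phi> 0\<bar> < \<epsilon>} \<subseteq> U"
      by (rule openin_weak_topologyD[of U 0]) (use U in auto)
    obtain a where a: "a \<in> A" "\<forall>\<phi>\<in>F. \<bar>\<phi> a\<bar> < \<epsilon>" using R F(1-3) by blast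
    have "\<bar>\<phi> a - \<phi> 0\<bar> < \<epsilon>" if "\<phi> \<in> F" for \<phi>
      using F(2)[OF that] a(2) that by (simp add: linear_0 bounded_linear.linear)
    then have "a \<in> U" using F(4) by blast
    then show "\<exists>y. y \<in> A \<and> y \<in> U" using a(1) by blast
  qed simp
qed

lemma finite_functionals_common_bound:
  assumes "finite F" "\<And>\<phi>. \<phi> \<in> F \<Longrightarrow> bounded_linear (\<phi> :: 'a::real_normed_vector \<Rightarrow> real)"
  obtains c where "c > 0" "\<And>\<phi> x. \<phi> \<in> F \<Longrightarrow> \<bar>\<phi> x\<bar> \<le> c * norm x"
proof -
  have "\<exists>c>0. \<forall>\<phi>\<in>F. \<forall>x. \<bar>\<phi> x\<bar> \<le> c * norm x"
    using assms
  proof (induction F rule: finite_induct)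
    case empty
    then show ?case by (intro exI[of _ 1]) auto
  next
    case (insert \<psi> F)
    then obtain c where c: "c > 0" "\<And>\<phi> x. \<phi> \<in> F \<Longrightarrow> \<bar>\<phi> x\<bar> \<le> c * norm x" by auto
    have "bounded_linear \<psi>" using insert.prems by simp
    then obtain b where b: "b > 0" "\<And>x. \<bar>\<psi> x\<bar> \<le> norm x * b"
      using bounded_linear.pos_bounded[of \<psi>] by auto
    have "\<bar>\<phi> x\<bar> \<le> (max b c) * norm x" if "\<phi> \<in> insert \<psi> F" for \<phi> x
    proof -
      have "b * norm x \<le> max b c * norm x" "c * norm x \<le> max b c * norm x"
        by (intro mult_right_mono; simp)+
      moreover have "\<bar>\<phi> x\<bar> \<le> b * norm x \<or> \<bar>\<phi> x\<bar> \<le> c * norm x"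
        using that b(2)[of x] c(2)[of \<phi> x] by (auto simp: mult.commute)
      ultimately show ?thesis by linarith
    qed
    then show ?case using c(1) by (intro exI[of _ "max b c"]) auto
  qed
  then show thesis using that by blast
qed

text \<open>Alaoglu's argument for a countable power of the dual ball: \<open>g\<close> codes a
  sequence of functionals, and linearity is a closed condition on a product of compact intervals.
  Coding all coordinates in one function lets a single compact set serve tuples of every
  length.\<close>

lemma compact_dual_ball_sequences:
  "compact {g :: nat \<times> 'a::real_normed_vector \<Rightarrow> real.
     \<forall>i. linear (\<lambda>x. g (i, x)) \<and> (\<forall>x. \<bar>g (i, x)\<bar> \<le> norm x)}" (is "compact ?K")
proof -
  let ?I = "\<lambda>p :: nat \<times> 'a. {- norm (snd p)..norm (snd p)}"
  have "compactin (product_topology (\<lambda>_. euclideanreal) UNIV) (PiE UNIV ?I)"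
    by (simp add: compactin_PiE)
  then have compact: "compact (PiE UNIV ?I)"
    by (simp add: euclidean_product_topology)
  have cont: "continuous_on UNIV (\<lambda>g :: nat \<times> 'a \<Rightarrow> real. g p)" for p
    by (rule continuous_on_product_coordinates)
  have "closed {g :: nat \<times> 'a \<Rightarrow> real. \<forall>i x y. g (i, x + y) = g (i, x) + g (i, y)}"
    by (intro closed_Collect_all closed_Collect_eq continuous_on_add cont)
  moreover have "closed {g :: nat \<times> 'a \<Rightarrow> real. \<forall>i c x. g (i, c *\<^sub>R x) = c * g (i, x)}"
    by (intro closed_Collect_all closed_Collect_eq continuous_on_mult continuous_on_const cont)
  ultimately have "compact (PiE UNIV ?I \<inter>
      ({g. \<forall>i x y. g (i, x + y) = g (i, x) + g (i, y)} \<inter> {g. \<forall>i c x. g (i, c *\<^sub>R x) = c * g (i, x)}))"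
    using compact by (intro compact_Int_closed closed_Int)
  moreover have "PiE UNIV ?I \<inter>
      ({g. \<forall>i x y. g (i, x + y) = g (i, x) + g (i, y)} \<inter> {g. \<forall>i c x. g (i, c *\<^sub>R x) = c * g (i, x)}) = ?K"
    by (auto simp: PiE_iff linear_iff abs_le_iff minus_le_iff)
  ultimately show ?thesis by simp
qed

text \<open>Kaplansky's theorem: compactness of the powers of the dual ball leaves finitely many points of \<open>A\<close> for each power.\<close>

theorem weak_closure_countable_subset:
  fixes A :: "'a::real_normed_vector set"
  assumes A: "0 \<in> weak_topology closure_of A"
  obtains D where "countable D" "D \<subseteq> A" "0 \<in> weak_topology closure_of D"
proof -
  let ?K = "{g :: nat \<times> 'a \<Rightarrow> real. \<forall>i. linear (\<lambda>x. g (i, x)) \<and> (\<forall>x. \<bar>g (i, x)\<bar> \<le> norm x)}"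
  \<comment> \<open>The same \<open>m\<close> controls the number of coordinates and the tolerance,
    so countably many covers account for all basic neighbourhoods of \<open>0\<close>.\<close>
  let ?O = "\<lambda>m a. {g :: nat \<times> 'a \<Rightarrow> real. \<forall>i<m. \<bar>g (i, a)\<bar> < 1 / Suc m}"
  have "\<exists>A' \<subseteq> A. finite A' \<and> ?K \<subseteq> (\<Union>a\<in>A'. ?O m a)" for m :: nat
  proof -
    have op: "open (?O m a)" for a
    proof -
      have "open (\<Inter>i\<in>{..<m}. {g :: nat \<times> 'a \<Rightarrow> real. \<bar>g (i, a)\<bar> < 1 / Suc m})"
        by (intro open_INT ballI open_Collect_less continuous_on_rabs continuous_on_const
            continuous_on_product_coordinates) simp
      moreover have "(\<Inter>i\<in>{..<m}. {g :: nat \<times> 'a \<Rightarrow> real. \<bar>g (i, a)\<bar> < 1 / Suc m}) = ?O m a"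
        by auto
      ultimately show ?thesis by simp
    qed
    have "?K \<subseteq> (\<Union>a\<in>A. ?O m a)"
    proof
      fix g assume g: "g \<in> ?K"
      let ?F = "(\<lambda>i x. g (i, x)) ` {..<m}"
      have "bounded_linear (\<lambda>x. g (i, x))" for i
        by (rule linear_le_norm(1)[of _ 1]) (use g in \<open>auto simp: abs_le_iff\<close>)
      then have "\<exists>a\<in>A. \<forall>\<phi>\<in>?F. \<bar>\<phi> a\<bar> < 1 / Suc m"
        using A[unfolded zero_in_weak_closure, rule_format, of ?F "1 / Suc m"] by auto
      then show "g \<in> (\<Union>a\<in>A. ?O m a)" by auto
    qed
    then show ?thesis
      by (rule compactE_image[OF compact_dual_ball_sequences op]) blast
  qed
  then have "\<exists>E. \<forall>m. E m \<subseteq> A \<and> finite (E m) \<and> ?K \<subseteq> (\<Union>a\<in>E m. ?O m a)"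
    by (intro choice allI)
  then obtain E where *: "\<forall>m. E m \<subseteq> A \<and> finite (E m) \<and> ?K \<subseteq> (\<Union>a\<in>E m. ?O m a)" by (rule exE)
  have E: "E m \<subseteq> A" "finite (E m)" "?K \<subseteq> (\<Union>a\<in>E m. ?O m a)" for m
    using spec[OF *, of m] by - (elim conjE, assumption)+
  have "0 \<in> weak_topology closure_of (\<Union>m. E m)"
    unfolding zero_in_weak_closure
  proof (intro allI impI, elim conjE)
    fix F :: "('a \<Rightarrow> real) set" and \<epsilon> :: real
    assume F: "finite F" "\<forall>\<phi>\<in>F. bounded_linear \<phi>" "\<epsilon> > 0"
    obtain c where c: "c > 0" "\<And>\<phi> x. \<phi> \<in> F \<Longrightarrow> \<bar>\<phi> x\<bar> \<le> c * norm x"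
      using finite_functionals_common_bound[OF F(1)] F(2) by blast
    obtain p :: nat and h where h: "F = h ` {..<p}"
      using F(1) by (metis finite_imp_nat_seg_image_inj_on lessThan_def)
    obtain m0 :: nat where m0: "1 / real (Suc m0) < \<epsilon> / c"
      using reals_Archimedean[of "\<epsilon> / c"] F(3) c(1) by (auto simp: inverse_eq_divide)
    define m where "m = max m0 p"
    have m: "1 / real (Suc m) < \<epsilon> / c" "p \<le> m"
    proof -
      have "1 / real (Suc m) \<le> 1 / real (Suc m0)" unfolding m_def by (intro frac_le) auto
      then show "1 / real (Suc m) < \<epsilon> / c" using m0 by simp
    qed (simp add: m_def)
    \<comment> \<open>Dividing by the common bound \<open>c\<close> puts the functionals of
      \<open>F\<close> into the dual ball; zero functionals fill the remaining coordinates.\<close>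
    define g where "g = (\<lambda>(i, x). if i < p then h i x / c else 0)"
    have "g \<in> ?K"
    proof (intro CollectI allI conjI)
      fix i
      show "linear (\<lambda>x. g (i, x))"
      proof (cases "i < p")
        case True
        then have "linear (h i)" using F(2) h bounded_linear.linear by auto
        then show ?thesis using True by (simp add: g_def linear_iff add_divide_distrib)
      qed (simp add: g_def linear_iff)
      show "\<bar>g (i, x)\<bar> \<le> norm x" for x
        using c(1) c(2)[of "h i" x] h by (auto simp: g_def divide_simps mult.commute)
    qed
    then obtain a where a: "a \<in> E m" "g \<in> ?O m a" using E(3)[of m] by blast
    have "\<bar>\<phi> a\<bar> < \<epsilon>" if \<phi>: "\<phi> \<in> F" for \<phi>
    proof -
      obtain i where i: "i < p" "\<phi> = h i" using \<phi> h by auto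
      then have "\<bar>g (i, a)\<bar> < 1 / Suc m" using a(2) m(2) by auto
      then have "\<bar>\<phi> a\<bar> / c < \<epsilon> / c" using i m(1) c(1) by (simp add: g_def)
      then show ?thesis using c(1) by (simp add: divide_less_cancel)
    qed
    then show "\<exists>a\<in>\<Union>m. E m. \<forall>\<phi>\<in>F. \<bar>\<phi> a\<bar> < \<epsilon>" using a(1) by blast
  qed
  moreover have "countable (\<Union>m. E m)" using E(2) by (simp add: countable_finite)
  ultimately show thesis using that E(1) by blast
qed

subsection \<open>Ultrafilters\<close>

text \<open>Zorn's lemma for the reversed order gives a minimal proper filter \<open>U\<close> below
  \<open>F\<close>. If the negation of \<open>P\<close> does not hold along \<open>U\<close>,
  restricting \<open>U\<close> to \<open>P\<close> leaves it proper and hence, by minimality,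
  unchanged.\<close>

lemma ultrafilter_exists:
  fixes F :: "'a filter"
  assumes F: "F \<noteq> bot"
  obtains U where "U \<le> F" "U \<noteq> bot" "\<And>P. eventually P U \<or> eventually (\<lambda>x. \<not> P x) U"
proof -
  define A where "A = {G. G \<noteq> bot \<and> G \<le> F}"
  have "\<exists>m\<in>A. \<forall>a\<in>A. a \<le> m \<longrightarrow> a = m"
  proof (rule predicate_Zorn)
    show "partial_order_on A (relation_of (\<lambda>G H. H \<le> G) A)"
      by (rule partial_order_on_relation_ofI) auto
    fix C assume C: "C \<in> Chains (relation_of (\<lambda>G H. H \<le> G) A)"
    have CA: "C \<subseteq> A" using C by (auto simp: Chains_def relation_of_def)
    have chain: "G \<le> H \<or> H \<le> G" if "G \<in> C" "H \<in> C" for G H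
      using C that unfolding Chains_def relation_of_def by blast
    show "\<exists>u\<in>A. \<forall>a\<in>C. u \<le> a"
    proof (cases "C = {}")
      case True
      then show ?thesis using F by (auto simp: A_def)
    next
      case False
      have "eventually P (Inf C) \<longleftrightarrow> (\<exists>b\<in>C. eventually P b)" for P
      proof (rule eventually_Inf_base[OF False])
        fix G H assume "G \<in> C" "H \<in> C"
        then show "\<exists>x\<in>C. x \<le> inf G H" using chain by (meson le_inf_iff order_refl)
      qed
      then have "Inf C \<noteq> bot" using CA unfolding trivial_limit_def A_def by blast
      moreover have "Inf C \<le> F"
        using False CA unfolding A_def by (blast intro: Inf_lower2)
      ultimately show ?thesis by (intro bexI[of _ "Inf C"]) (auto simp: A_def Inf_lower)
    qed
  qed
  then obtain U where U: "U \<in> A" "\<And>G. G \<in> A \<Longrightarrow> G \<le> U \<Longrightarrow> G = U" by blast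
  have "eventually P U \<or> eventually (\<lambda>x. \<not> P x) U" for P
  proof (rule disjCI)
    assume not: "\<not> eventually (\<lambda>x. \<not> P x) U"
    let ?G = "inf U (principal {x. P x})"
    have "?G \<noteq> bot"
      using not by (simp add: trivial_limit_def eventually_inf_principal)
    then have "?G \<in> A" using U(1) by (auto simp: A_def intro: le_infI1)
    then have G: "?G = U" by (rule U(2)) simp
    have "U \<le> principal {x. P x}" by (subst G[symmetric]) (rule inf.cobounded2)
    then show "eventually P U" by (simp add: le_principal)
  qed
  then show thesis using that U(1) by (auto simp: A_def)
qed

text \<open>The traces on \<open>D\<close> of the basic weak neighbourhoods of \<open>0\<close> form
  a filter base. An ultrafilter refining it acts as a weakly null generalized sequence in
  \<open>D\<close> that decides every property.\<close>

lemma ultrafilter_of_weak_closure: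
  fixes D :: "'a::real_normed_vector set"
  assumes D: "0 \<in> weak_topology closure_of D"
  obtains U where "U \<noteq> bot" "\<And>P. eventually P U \<or> eventually (\<lambda>x. \<not> P x) U"
    "eventually (\<lambda>a. a \<in> D) U" "\<And>\<phi> :: 'a \<Rightarrow> real. bounded_linear \<phi> \<Longrightarrow> (\<phi> \<longlongrightarrow> 0) U"
proof -
  define I where "I = {(F, \<epsilon>). finite F \<and> (\<forall>\<phi>\<in>F. bounded_linear (\<phi> :: 'a \<Rightarrow> real)) \<and> \<epsilon> > (0 :: real)}"
  define N where "N = (\<lambda>(F, \<epsilon>). {a \<in> D. \<forall>\<phi>\<in>F. \<bar>\<phi> a\<bar> < (\<epsilon> :: real)})"
  define F0 where "F0 = (INF p\<in>I. principal (N p))"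
  have ev: "eventually P F0 \<longleftrightarrow> (\<exists>p\<in>I. eventually P (principal (N p)))" for P
    unfolding F0_def
  proof (rule eventually_INF_base)
    show "I \<noteq> {}" unfolding I_def by (auto intro!: exI[of _ "{}"] exI[of _ 1])
    fix p q assume "p \<in> I" "q \<in> I"
    moreover obtain F \<epsilon> G \<delta> where "p = (F, \<epsilon>)" "q = (G, \<delta>)" by fastforce
    ultimately show "\<exists>r\<in>I. principal (N r) \<le> inf (principal (N p)) (principal (N q))"
      by (intro bexI[of _ "(F \<union> G, min \<epsilon> \<delta>)"]) (auto simp: I_def N_def)
  qed
  have "N p \<noteq> {}" if p: "p \<in> I" for p
  proof -
    obtain F \<epsilon> where F: "p = (F, \<epsilon>)" by fastforce
    have "\<exists>a\<in>D. \<forall>\<phi>\<in>F. \<bar>\<phi> a\<bar> < \<epsilon>"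
      using D p unfolding zero_in_weak_closure I_def F by simp
    then show ?thesis by (auto simp: F N_def)
  qed
  then have "F0 \<noteq> bot"
    unfolding trivial_limit_def ev by (auto simp: eventually_principal)
  then obtain U where U: "U \<le> F0" "U \<noteq> bot" "\<And>P. eventually P U \<or> eventually (\<lambda>x. \<not> P x) U"
    using ultrafilter_exists by blast
  show thesis
  proof (rule that[OF U(2,3)])
    have "({}, 1) \<in> I" by (simp add: I_def)
    then have "eventually (\<lambda>a. a \<in> D) F0"
      unfolding ev by (rule bexI[rotated]) (simp add: N_def eventually_principal)
    then show "eventually (\<lambda>a. a \<in> D) U" using U(1) by (rule filter_leD[rotated])
    fix \<phi> :: "'a \<Rightarrow> real" assume \<phi>: "bounded_linear \<phi>"
    show "(\<phi> \<longlongrightarrow> 0) U"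
    proof (rule tendstoI)
      fix e :: real assume "e > 0"
      then have "({\<phi>}, e) \<in> I" using \<phi> by (simp add: I_def)
      then have "eventually (\<lambda>a. dist (\<phi> a) 0 < e) F0"
        unfolding ev by (rule bexI[rotated]) (simp add: N_def eventually_principal)
      then show "eventually (\<lambda>a. dist (\<phi> a) 0 < e) U" using U(1) by (rule filter_leD[rotated])
    qed
  qed
qed

subsection \<open>Weakly null sequences and copies of \<open>l1\<close>\<close>

text \<open>The dual ball is symmetric, so one-sided eventual bounds on it are enough. This is the
  form in which tiny sets of functionals deliver their estimates.\<close>

lemma weakly_null_if_dual_ball:
  fixes x :: "nat \<Rightarrow> 'a::real_normed_vector"
  assumes "\<And>\<phi> m. bounded_linear \<phi> \<Longrightarrow> (\<And>y. \<bar>\<phi> y\<bar> \<le> norm y) \<Longrightarrow>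
    \<forall>\<^sub>F k in sequentially. \<phi> (x k) \<le> 1 / real (Suc m)"
  shows "limitin weak_topology x 0 sequentially"
  unfolding limitin_weak_topology
proof (intro allI impI)
  have ball: "(\<lambda>k. \<phi> (x k)) \<longlonglongrightarrow> 0"
    if \<phi>: "bounded_linear \<phi>" "\<And>y. \<bar>\<phi> y\<bar> \<le> norm y" for \<phi>
  proof (rule tendstoI)
    fix e :: real assume "e > 0"
    then obtain m where m: "1 / real (Suc m) < e"
      using reals_Archimedean by (auto simp: inverse_eq_divide)
    have "bounded_linear (\<lambda>y. - \<phi> y)" using \<phi>(1) by (rule bounded_linear_minus)
    then have "\<forall>\<^sub>F k in sequentially. - \<phi> (x k) \<le> 1 / real (Suc m)"
      using \<phi>(2) by (intro assms) auto
    moreover have "\<forall>\<^sub>F k in sequentially. \<phi> (x k) \<le> 1 / real (Suc m)"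
      using \<phi> by (rule assms)
    ultimately show "\<forall>\<^sub>F k in sequentially. dist (\<phi> (x k)) 0 < e"
      by eventually_elim (use m in auto)
  qed
  fix \<phi> :: "'a \<Rightarrow> real" assume \<phi>: "bounded_linear \<phi>"
  obtain c where c: "c > 0" "\<And>y. \<bar>\<phi> y\<bar> \<le> norm y * c"
    using bounded_linear.pos_bounded[OF \<phi>] by auto
  have "bounded_linear (\<lambda>y. \<phi> y / c)" using \<phi> by (rule bounded_linear_divide[THEN bounded_linear_compose])
  moreover have "\<bar>\<phi> y / c\<bar> \<le> norm y" for y using c by (simp add: divide_simps mult.commute)
  ultimately have "(\<lambda>k. \<phi> (x k) / c) \<longlonglongrightarrow> 0" by (rule ball)
  then have "(\<lambda>k. \<phi> (x k) / c * c) \<longlonglongrightarrow> 0" by (rule tendsto_mult_left_zero)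
  then show "(\<lambda>k. \<phi> (x k)) \<longlonglongrightarrow> \<phi> 0"
    using c(1) by (simp add: linear_0[OF bounded_linear.linear[OF \<phi>]])
qed

text \<open>This is Boolean independence as in Rosenthal's theorem, for the sets of
  \<open>\<phi>\<close> in the dual ball with \<open>\<phi> (x i) > \<delta>\<close> and with
  \<open>\<phi> (x i) < \<delta> / 2\<close>.\<close>

definition separated_signs :: "real \<Rightarrow> (nat \<Rightarrow> 'a::real_normed_vector) \<Rightarrow> bool" where
  "separated_signs \<delta> x \<longleftrightarrow> (\<forall>N \<sigma>. \<exists>\<phi>. bounded_linear \<phi> \<and> (\<forall>y. \<bar>\<phi> y\<bar> \<le> norm y) \<and>
     (\<forall>i<N. if \<sigma> i then \<delta> < \<phi> (x i) else \<phi> (x i) < \<delta> / 2))"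

text \<open>One functional follows the signs of the coefficients, another the opposite signs. Their
  difference gains at least \<open>\<delta> / 2\<close> at each \<open>x i\<close> in the direction
  of \<open>c i\<close>, while its norm is at most \<open>2\<close>; the quotient is the constant
  \<open>\<delta> / 4\<close>.\<close>

lemma separated_signs_lower_l1_estimate:
  assumes x: "separated_signs \<delta> x"
  shows "\<delta> / 4 * (\<Sum>i<N. \<bar>c i\<bar>) \<le> norm (\<Sum>i<N. c i *\<^sub>R x i)"
proof -
  obtain \<phi> where \<phi>: "bounded_linear \<phi>" "\<And>y. \<bar>\<phi> y\<bar> \<le> norm y"
    "\<And>i. i < N \<Longrightarrow> if c i > 0 then \<delta> < \<phi> (x i) else \<phi> (x i) < \<delta> / 2"
    using x[unfolded separated_signs_def, rule_format, of N "\<lambda>i. c i > 0"] by blast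
  obtain \<psi> where \<psi>: "bounded_linear \<psi>" "\<And>y. \<bar>\<psi> y\<bar> \<le> norm y"
    "\<And>i. i < N \<Longrightarrow> if \<not> c i > 0 then \<delta> < \<psi> (x i) else \<psi> (x i) < \<delta> / 2"
    using x[unfolded separated_signs_def, rule_format, of N "\<lambda>i. \<not> c i > 0"] by blast
  define v where "v = (\<Sum>i<N. c i *\<^sub>R x i)"
  have "\<delta> / 2 * (\<Sum>i<N. \<bar>c i\<bar>) = (\<Sum>i<N. \<bar>c i\<bar> * (\<delta> / 2))"
    by (simp add: sum_distrib_left mult.commute)
  also have "\<dots> \<le> (\<Sum>i<N. c i * (\<phi> (x i) - \<psi> (x i)))"
  proof (rule sum_mono)
    fix i assume "i \<in> {..<N}"
    then have i: "i < N" by simp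
    show "\<bar>c i\<bar> * (\<delta> / 2) \<le> c i * (\<phi> (x i) - \<psi> (x i))"
    proof (cases "c i > 0")
      case True
      then have "\<delta> / 2 \<le> \<phi> (x i) - \<psi> (x i)" using \<phi>(3)[OF i] \<psi>(3)[OF i] by simp
      then show ?thesis using True by (simp add: mult_left_mono)
    next
      case False
      then have "\<delta> / 2 \<le> \<psi> (x i) - \<phi> (x i)" using \<phi>(3)[OF i] \<psi>(3)[OF i] by simp
      then have "(- c i) * (\<delta> / 2) \<le> (- c i) * (\<psi> (x i) - \<phi> (x i))"
        using False by (intro mult_left_mono) auto
      then show ?thesis using False by (simp add: algebra_simps)
    qed
  qed
  also have "\<dots> = \<phi> v - \<psi> v"
    by (simp add: v_def linear_sum[OF bounded_linear.linear[OF \<phi>(1)]]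
        linear_sum[OF bounded_linear.linear[OF \<psi>(1)]] linear_scale[OF bounded_linear.linear[OF \<phi>(1)]]
        linear_scale[OF bounded_linear.linear[OF \<psi>(1)]] right_diff_distrib sum_subtractf)
  also have "\<dots> \<le> 2 * norm v" using \<phi>(2)[of v] \<psi>(2)[of v] by linarith
  finally show ?thesis by (simp add: v_def)
qed

text \<open>
  Call a set of functionals tiny if \<open>U\<close>-almost all \<open>a\<close> are at most \<open>\<delta>\<close> on it. If the dual ball is
  a countable union of tiny sets for every \<open>\<delta>\<close>, a diagonal choice yields a weakly null sequence.
  Otherwise, remove from the dual ball those members of a countable family of open sets that are
  countable unions of tiny sets. What remains branches everywhere, as both \<open>\<phi> a > \<delta>\<close> and \<open>\<phi> a < \<delta> / 2\<close> occur on each open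
  piece for \<open>U\<close>-almost all \<open>a\<close>.
\<close>

theorem weakly_null_sequence_or_separated_signs:
  fixes D :: "'a::real_normed_vector set"
  assumes D: "countable D" "0 \<in> weak_topology closure_of D"
  obtains x :: "nat \<Rightarrow> 'a" where "range x \<subseteq> D" "limitin weak_topology x 0 sequentially"
    | x :: "nat \<Rightarrow> 'a" and \<delta> where "range x \<subseteq> D" "\<delta> > 0" "separated_signs \<delta> x"
proof -
  obtain U where U: "U \<noteq> bot" "\<And>P. eventually P U \<or> eventually (\<lambda>x. \<not> P x) U"
    and UD: "eventually (\<lambda>a. a \<in> D) U"
    and Unull: "\<And>\<phi> :: 'a \<Rightarrow> real. bounded_linear \<phi> \<Longrightarrow> (\<phi> \<longlongrightarrow> 0) U"
    using ultrafilter_of_weak_closure[OF D(2)] by blast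
  define K where "K = {\<phi> :: 'a \<Rightarrow> real. bounded_linear \<phi> \<and> (\<forall>y. \<bar>\<phi> y\<bar> \<le> norm y)}"
  define tiny where "tiny \<delta> S \<longleftrightarrow> eventually (\<lambda>a. \<forall>\<phi>\<in>S. \<phi> a \<le> \<delta>) U" for \<delta> :: real and S
  define small where "small \<delta> S \<longleftrightarrow> (\<exists>\<T>. countable \<T> \<and> S \<subseteq> \<Union>\<T> \<and> (\<forall>T\<in>\<T>. tiny \<delta> T))" for \<delta> S
  have tiny_small: "small \<delta> S" if "tiny \<delta> S" for \<delta> S
    unfolding small_def using that by (intro exI[of _ "{S}"]) auto
  have small_subset: "small \<delta> S" if "small \<delta> T" "S \<subseteq> T" for \<delta> S T
    using that unfolding small_def by blast
  have small_Union: "small \<delta> (\<Union>\<S>)" if "countable \<S>" "\<And>S. S \<in> \<S> \<Longrightarrow> small \<delta> S" for \<delta> \<S>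
  proof -
    have "\<forall>S\<in>\<S>. \<exists>\<T>. countable \<T> \<and> S \<subseteq> \<Union>\<T> \<and> (\<forall>T\<in>\<T>. tiny \<delta> T)"
      using that(2) unfolding small_def by blast
    then obtain h where h: "\<forall>S\<in>\<S>. countable (h S) \<and> S \<subseteq> \<Union>(h S) \<and> (\<forall>T\<in>h S. tiny \<delta> T)"
      by (rule bchoice[THEN exE])
    then show ?thesis
      unfolding small_def using that(1) by (intro exI[of _ "\<Union>(h ` \<S>)"]) fastforce
  qed
  show thesis
  proof (cases "\<forall>m :: nat. small (1 / Suc m) K")
    case True
    then obtain \<T> where \<T>: "\<And>m :: nat. countable (\<T> m)" "\<And>m. K \<subseteq> \<Union>(\<T> m)"
      "\<And>m T. T \<in> \<T> m \<Longrightarrow> tiny (1 / Suc m) T"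
      unfolding small_def by metis
    have "(\<lambda>_. 0) \<in> K" unfolding K_def by simp
    then have "(SIGMA m:UNIV. \<T> m) \<noteq> {}" using \<T>(2)[of 0] by blast
    moreover have "countable (SIGMA m:UNIV. \<T> m)" using \<T>(1) by (intro countable_SIGMA) auto
    \<comment> \<open>The map \<open>q\<close> lists the pieces of the covers of all levels. The
      term \<open>x k\<close> respects the first \<open>k + 1\<close> of them, a finite demand that
      holds along \<open>U\<close>. Each functional of the dual ball belongs to a piece of every
      level, so its values eventually obey every threshold.\<close>
    ultimately obtain q :: "nat \<Rightarrow> nat \<times> ('a \<Rightarrow> real) set" where q: "range q = (SIGMA m:UNIV. \<T> m)"
      by (metis uncountable_def)
    have "\<exists>a. a \<in> D \<and> (\<forall>j\<le>k. \<forall>\<phi>\<in>snd (q j). \<phi> a \<le> 1 / Suc (fst (q j)))" for k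
    proof -
      have "eventually (\<lambda>a. \<forall>\<phi>\<in>snd (q j). \<phi> a \<le> 1 / Suc (fst (q j))) U" for j
      proof -
        have "q j \<in> (SIGMA m:UNIV. \<T> m)" using q by blast
        then show ?thesis using \<T>(3)[of "snd (q j)" "fst (q j)"] unfolding tiny_def by auto
      qed
      then have "eventually (\<lambda>a. \<forall>j\<in>{..k}. \<forall>\<phi>\<in>snd (q j). \<phi> a \<le> 1 / Suc (fst (q j))) U"
        by (intro eventually_ball_finite) auto
      with UD have "eventually (\<lambda>a. a \<in> D \<and> (\<forall>j\<le>k. \<forall>\<phi>\<in>snd (q j). \<phi> a \<le> 1 / Suc (fst (q j)))) U"
        by eventually_elim auto
      then show ?thesis using eventually_happens'[OF U(1)] by blast
    qed
    then obtain x where x: "\<And>k. x k \<in> D"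
      "\<And>k j \<phi>. j \<le> k \<Longrightarrow> \<phi> \<in> snd (q j) \<Longrightarrow> \<phi> (x k) \<le> 1 / Suc (fst (q j))"
      by metis
    have "limitin weak_topology x 0 sequentially"
    proof (rule weakly_null_if_dual_ball)
      fix \<phi> :: "'a \<Rightarrow> real" and m
      assume "bounded_linear \<phi>" "\<And>y. \<bar>\<phi> y\<bar> \<le> norm y"
      then have "\<phi> \<in> \<Union>(\<T> m)" using \<T>(2) unfolding K_def by blast
      then obtain T where "\<phi> \<in> T" "(m, T) \<in> range q" unfolding q by blast
      then obtain j where "\<phi> \<in> snd (q j)" "fst (q j) = m" by (metis fst_conv rangeE snd_conv)
      then have "\<phi> (x k) \<le> 1 / Suc m" if "k \<ge> j" for k using x(2) that by blast
      then show "\<forall>\<^sub>F k in sequentially. \<phi> (x k) \<le> 1 / real (Suc m)"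
        unfolding eventually_sequentially by blast
    qed
    then show thesis using that(1) x(1) by blast
  next
    case False
    then obtain m :: nat where m: "\<not> small (1 / Suc m) K" by blast
    define \<delta> :: real where "\<delta> = 1 / Suc m"
    have \<delta>: "\<delta> > 0" and K: "\<not> small \<delta> K" using m by (simp_all add: \<delta>_def)
    \<comment> \<open>A list entry \<open>(a, b)\<close> prescribes on which side of the gap the
      value at \<open>a\<close> lies. The cells in \<open>\<V>\<close> use points of
      \<open>D\<close> only and are therefore countably many; here the countability of
      \<open>D\<close> enters.\<close>
    define cell where "cell xs = {\<phi> \<in> K. \<forall>(a, b)\<in>set xs. if b then \<delta> < \<phi> a else \<phi> a < \<delta> / 2}"
      for xs :: "('a \<times> bool) list"
    define \<V> where "\<V> = cell ` lists (D \<times> UNIV)"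
    define L where "L = K - \<Union>{V \<in> \<V>. small \<delta> V}"
    have "countable \<V>" unfolding \<V>_def using D(1) by simp
    then have removed: "small \<delta> (\<Union>{V \<in> \<V>. small \<delta> V})"
      by (intro small_Union) (auto intro: countable_subset)
    have K_cell: "K = cell []" by (simp add: cell_def)
    \<comment> \<open>If the trace on \<open>L\<close> were tiny, the cell would be covered by it
      and the removed part, hence small. Then the cell would itself have been removed, and its trace
      on \<open>L\<close> would be empty.\<close>
    have not_tiny: "\<not> tiny \<delta> (cell xs \<inter> L)"
      if xs: "xs \<in> lists (D \<times> UNIV)" "cell xs \<inter> L \<noteq> {}" for xs
    proof
      assume "tiny \<delta> (cell xs \<inter> L)"
      then have "small \<delta> (\<Union>{cell xs \<inter> L, \<Union>{V \<in> \<V>. small \<delta> V}})"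
        using removed tiny_small by (intro small_Union) auto
      moreover have "cell xs \<subseteq> \<Union>{cell xs \<inter> L, \<Union>{V \<in> \<V>. small \<delta> V}}"
        unfolding L_def cell_def by blast
      ultimately have "small \<delta> (cell xs)" by (rule small_subset)
      then have "cell xs \<inter> L = {}" using xs(1) unfolding L_def \<V>_def by blast
      then show False using xs(2) by contradiction
    qed
    \<comment> \<open>The invariant of the recursion: the chosen points realize all sign patterns at
      once, and within \<open>L\<close>, so that the next point can be found.\<close>
    define good where "good as \<longleftrightarrow> set as \<subseteq> D \<and>
      (\<forall>bs. length bs = length as \<longrightarrow> cell (zip as bs) \<inter> L \<noteq> {})" for as :: "'a list"
    have good_Nil: "good []"
    proof -
      have "L \<noteq> {}"
      proof
        assume "L = {}"
        then have "K \<subseteq> \<Union>{V \<in> \<V>. small \<delta> V}" unfolding L_def by blast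
        then show False using removed small_subset K by blast
      qed
      then show ?thesis using K_cell by (auto simp: good_def L_def)
    qed
    have good_Cons: "\<exists>a. good (a # as)" if as: "good as" for as
    proof -
      have zip: "zip as bs \<in> lists (D \<times> UNIV)" for bs :: "bool list"
        using as by (auto simp: good_def dest: set_zip_leftD)
      have step: "eventually (\<lambda>a. \<forall>b. cell ((a, b) # zip as bs) \<inter> L \<noteq> {}) U"
        if bs: "length bs = length as" for bs
      proof -
        let ?V = "cell (zip as bs) \<inter> L"
        have ne: "?V \<noteq> {}" using as bs by (simp add: good_def)
        then obtain \<psi> where \<psi>: "\<psi> \<in> ?V" by blast
        then have "bounded_linear \<psi>" by (simp add: cell_def K_def)
        \<comment> \<open>The lower side is served by one fixed \<open>\<psi>\<close>, whose values
          tend to \<open>0\<close> along \<open>U\<close>. The upper side is served by a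
          \<open>\<phi>\<close> that depends on \<open>a\<close>: not being tiny means, for an
          ultrafilter, that almost every \<open>a\<close> has one.\<close>
        then have "eventually (\<lambda>a. \<psi> a < \<delta> / 2) U"
          using Unull \<delta> order_tendstoD(2) by (metis half_gt_zero)
        moreover have "eventually (\<lambda>a. \<not> (\<forall>\<phi>\<in>?V. \<phi> a \<le> \<delta>)) U"
          using U(2)[of "\<lambda>a. \<forall>\<phi>\<in>?V. \<phi> a \<le> \<delta>"] not_tiny[OF zip ne] unfolding tiny_def by blast
        ultimately show ?thesis
        proof eventually_elim
          case (elim a)
          then obtain \<phi> where \<phi>: "\<phi> \<in> ?V" "\<delta> < \<phi> a" by (auto simp: not_le)
          show ?case
          proof
            fix b
            have "(if b then \<phi> else \<psi>) \<in> cell ((a, b) # zip as bs) \<inter> L"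
              using \<phi> \<psi> elim(1) by (auto simp: cell_def)
            then show "cell ((a, b) # zip as bs) \<inter> L \<noteq> {}" by blast
          qed
        qed
      qed
      \<comment> \<open>There are finitely many patterns, so one \<open>a\<close> serves them
        all.\<close>
      have "finite {bs :: bool list. length bs = length as}"
        using finite_lists_length_eq[of "UNIV :: bool set" "length as"] by simp
      then have "eventually (\<lambda>a. \<forall>bs\<in>{bs. length bs = length as}. \<forall>b. cell ((a, b) # zip as bs) \<inter> L \<noteq> {}) U"
        using step by (intro eventually_ball_finite) auto
      with UD have "eventually (\<lambda>a. a \<in> D \<and>
          (\<forall>bs\<in>{bs. length bs = length as}. \<forall>b. cell ((a, b) # zip as bs) \<inter> L \<noteq> {})) U"
        by eventually_elim auto
      then obtain a where a: "a \<in> D"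
        "\<And>bs b. length bs = length as \<Longrightarrow> cell ((a, b) # zip as bs) \<inter> L \<noteq> {}"
        using eventually_happens'[OF U(1)] by (smt (verit) mem_Collect_eq)
      have "good (a # as)"
        unfolding good_def
      proof (intro conjI allI impI)
        show "set (a # as) \<subseteq> D" using a(1) as by (simp add: good_def)
        fix cs :: "bool list" assume "length cs = length (a # as)"
        then obtain b bs where "cs = b # bs" "length bs = length as" by (auto simp: length_Suc_conv)
        then show "cell (zip (a # as) cs) \<inter> L \<noteq> {}" using a(2)[of bs b] by simp
      qed
      then show ?thesis ..
    qed
    obtain Ls :: "nat \<Rightarrow> 'a list" where Ls: "\<And>n. good (Ls n) \<and> length (Ls n) = n"
      "\<And>n. \<exists>a. Ls (Suc n) = a # Ls n"
    proof (rule dependent_nat_choice[of "\<lambda>n as. good as \<and> length as = n" "\<lambda>n as bs. \<exists>a. bs = a # as", THEN exE])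
      show "\<exists>as. good as \<and> length as = 0" using good_Nil by auto
      show "\<exists>bs. (good bs \<and> length bs = Suc n) \<and> (\<exists>a. bs = a # as)"
        if as: "good as \<and> length as = n" for as n
      proof -
        obtain a where "good (a # as)" using good_Cons as by blast
        then show ?thesis using as by (intro exI[of _ "a # as"]) auto
      qed
    qed (use that in blast)
    then obtain x where x: "\<And>n. Ls (Suc n) = x n # Ls n" by metis
    have "x n \<in> D" for n
      using Ls(1)[of "Suc n"] x[of n] by (auto simp: good_def)
    moreover have "separated_signs \<delta> x"
      unfolding separated_signs_def
    proof (intro allI)
      fix N and \<sigma> :: "nat \<Rightarrow> bool"
      \<comment> \<open>The lists grow at the head, so \<open>Ls n\<close> holds the points in
        reverse order. Membership in the zipped list spares the reversal of indices.\<close>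
      have "\<exists>bs. length bs = n \<and> (\<forall>i<n. (x i, \<sigma> i) \<in> set (zip (Ls n) bs))" for n
      proof (induction n)
        case (Suc n)
        then obtain bs where "length bs = n" "\<forall>i<n. (x i, \<sigma> i) \<in> set (zip (Ls n) bs)" by blast
        then show ?case by (intro exI[of _ "\<sigma> n # bs"]) (auto simp: x less_Suc_eq)
      qed simp
      then obtain bs where bs: "length bs = N" "\<And>i. i < N \<Longrightarrow> (x i, \<sigma> i) \<in> set (zip (Ls N) bs)" by blast
      then obtain \<phi> where \<phi>: "\<phi> \<in> cell (zip (Ls N) bs)" using Ls(1)[of N] unfolding good_def by fastforce
      have "if \<sigma> i then \<delta> < \<phi> (x i) else \<phi> (x i) < \<delta> / 2" if "i < N" for i
        using \<phi> bs(2)[OF that] by (fastforce simp: cell_def)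
      then show "\<exists>\<phi>. bounded_linear \<phi> \<and> (\<forall>y. \<bar>\<phi> y\<bar> \<le> norm y) \<and>
          (\<forall>i<N. if \<sigma> i then \<delta> < \<phi> (x i) else \<phi> (x i) < \<delta> / 2)"
        using \<phi> unfolding cell_def K_def by blast
    qed
    ultimately show thesis using that(2)[of x \<delta>] \<delta> by blast
  qed
qed

text \<open>Boundedness of \<open>x\<close> makes the weighted series converge and \<open>T\<close>
  bounded; the lower estimate passes from partial sums to the limit and makes the inverse Lipschitz.
  Closedness of \<open>C\<close> keeps the sums in \<open>C\<close>.\<close>

lemma contains_copy_of_l1I:
  fixes x :: "nat \<Rightarrow> 'c::banach"
  assumes C: "subspace C" "closed C" "range x \<subseteq> C" and bd: "\<And>i. norm (x i) \<le> R"
    and \<delta>: "\<delta> > 0" "\<And>N c. \<delta> * (\<Sum>i<N. \<bar>c i\<bar>) \<le> norm (\<Sum>i<N. c i *\<^sub>R x i)"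
  shows "contains_copy_of_l1 C"
proof -
  define T where "T a = (\<Sum>i. l1_nth a i *\<^sub>R x i)" for a
  have bound: "norm (l1_nth a i *\<^sub>R x i) \<le> R * \<bar>l1_nth a i\<bar>" for a i
    using mult_left_mono[OF bd[of i], of "\<bar>l1_nth a i\<bar>"] by (simp add: mult.commute)
  have summ: "summable (\<lambda>i. l1_nth a i *\<^sub>R x i)" for a
    by (rule summable_comparison_test'[OF summable_mult[OF l1_nth_summable]]) (rule bound)
  have lin: "linear T"
  proof (rule linearI)
    show "T (a + b) = T a + T b" for a b
      unfolding T_def by (simp add: plus_l1.rep_eq scaleR_add_left suminf_add[OF summ summ])
    show "T (c *\<^sub>R a) = c *\<^sub>R T a" for c a
      unfolding T_def using suminf_scaleR_right[OF summ] by (simp add: scaleR_l1.rep_eq flip: scaleR_scaleR)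
  qed
  have upper: "norm (T a) \<le> R * norm a" for a
  proof -
    have s: "summable (\<lambda>i. norm (l1_nth a i *\<^sub>R x i))"
      by (rule summable_comparison_test'[OF summable_mult[OF l1_nth_summable], of 0]) (use bound in simp)
    have "norm (T a) \<le> (\<Sum>i. norm (l1_nth a i *\<^sub>R x i))"
      unfolding T_def by (rule summable_norm[OF s])
    also have "\<dots> \<le> (\<Sum>i. R * \<bar>l1_nth a i\<bar>)"
      by (rule suminf_le[OF bound s summable_mult[OF l1_nth_summable]])
    also have "\<dots> = R * norm a"
      unfolding norm_l1_def by (rule suminf_mult[OF l1_nth_summable])
    finally show ?thesis .
  qed
  have lower: "\<delta> * norm a \<le> norm (T a)" for a
  proof (rule LIMSEQ_le)
    show "(\<lambda>N. \<delta> * (\<Sum>i<N. \<bar>l1_nth a i\<bar>)) \<longlonglongrightarrow> \<delta> * norm a"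
      unfolding norm_l1_def by (intro tendsto_mult tendsto_const summable_LIMSEQ l1_nth_summable)
    show "(\<lambda>N. norm (\<Sum>i<N. l1_nth a i *\<^sub>R x i)) \<longlonglongrightarrow> norm (T a)"
      unfolding T_def by (intro tendsto_norm summable_LIMSEQ summ)
    show "\<exists>N. \<forall>n\<ge>N. \<delta> * (\<Sum>i<n. \<bar>l1_nth a i\<bar>) \<le> norm (\<Sum>i<n. l1_nth a i *\<^sub>R x i)"
      using \<delta>(2) by blast
  qed
  have dist_lower: "\<delta> * dist a b \<le> dist (T a) (T b)" for a b
    using lower[of "a - b"] by (simp add: dist_norm linear_diff[OF lin])
  have "inj T"
  proof (rule injI)
    fix a b assume "T a = T b"
    then have "\<delta> * dist a b \<le> 0" using dist_lower[of a b] by simp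
    then show "a = b" using \<delta>(1) by (simp add: mult_le_0_iff)
  qed
  have "range T \<subseteq> C"
  proof clarify
    fix a
    have "(\<lambda>N. \<Sum>i<N. l1_nth a i *\<^sub>R x i) \<longlonglongrightarrow> T a"
      unfolding T_def by (intro summable_LIMSEQ summ)
    moreover have "\<forall>N. (\<Sum>i<N. l1_nth a i *\<^sub>R x i) \<in> C"
      using C(1,3) by (intro allI subspace_sum subspace_scale) auto
    ultimately show "T a \<in> C" using C(2) by (metis closed_sequentially)
  qed
  moreover have "homeomorphism UNIV (range T) T (inv T)"
  proof (rule homeomorphismI)
    have "bounded_linear T"
      by (rule bounded_linear_intro[of T R]) (use lin upper in \<open>auto simp: linear_add linear_scale mult.commute\<close>)
    then show "continuous_on UNIV T" by (rule linear_continuous_on)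
    show "continuous_on (range T) (inv T)"
      unfolding continuous_on_iff
    proof (intro ballI allI impI)
      fix y e assume y: "y \<in> range T" and e: "(0 :: real) < e"
      show "\<exists>d>0. \<forall>z\<in>range T. dist z y < d \<longrightarrow> dist (inv T z) (inv T y) < e"
      proof (intro exI[of _ "\<delta> * e"] conjI ballI impI)
        fix z assume z: "z \<in> range T" "dist z y < \<delta> * e"
        have "\<delta> * dist (inv T z) (inv T y) \<le> dist z y"
          using dist_lower[of "inv T z" "inv T y"] y z(1) by (simp add: f_inv_into_f)
        then have "\<delta> * dist (inv T z) (inv T y) < \<delta> * e" using z(2) by linarith
        then show "dist (inv T z) (inv T y) < e" using \<delta>(1) by simp
      qed (use \<delta>(1) e in simp)
    qed
  qed (use \<open>inj T\<close> in \<open>auto simp: f_inv_into_f\<close>)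
  ultimately show ?thesis unfolding contains_copy_of_l1_def using lin by blast
qed

text \<open>Separated signs give a lower \<open>l1\<close> estimate in \<open>'a\<close>, but the
  series need completeness. The isometry \<open>j\<close> therefore carries the points and the
  estimate into the completion before a copy of \<open>l1\<close> is built.\<close>

theorem weakly_null_sequence_in_weak_closure:
  fixes A :: "'a::real_normed_vector set" and j :: "'a \<Rightarrow> 'c::banach"
  assumes j: "is_completion j C" "\<not> contains_copy_of_l1 C"
    and A: "bounded A" "0 \<in> weak_topology closure_of A"
  obtains x :: "nat \<Rightarrow> 'a" where "range x \<subseteq> A" "limitin weak_topology x 0 sequentially"
proof -
  obtain D where D: "countable D" "D \<subseteq> A" "0 \<in> weak_topology closure_of D"
    using weak_closure_countable_subset[OF A(2)] by blast
  show thesis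
  proof (rule weakly_null_sequence_or_separated_signs[OF D(1,3)])
    fix x :: "nat \<Rightarrow> 'a" assume "range x \<subseteq> D" "limitin weak_topology x 0 sequentially"
    then show thesis using that D(2) by blast
  next
    fix x :: "nat \<Rightarrow> 'a" and \<delta> :: real
    assume x: "range x \<subseteq> D" "\<delta> > 0" "separated_signs \<delta> x"
    have lin: "linear j" and norm: "\<And>x. norm (j x) = norm x" and C: "C = closure (range j)"
      using j(1) by (auto simp: is_completion_def)
    obtain R where R: "\<And>a. a \<in> A \<Longrightarrow> norm a \<le> R" using A(1) by (auto simp: bounded_iff)
    have "contains_copy_of_l1 C"
    proof (rule contains_copy_of_l1I[of C "j \<circ> x" R "\<delta> / 4"])
      show "subspace C" unfolding C by (intro subspace_closure linear_subspace_image[OF lin] subspace_UNIV)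
      show "range (j \<circ> x) \<subseteq> C" unfolding C using closure_subset[of "range j"] by auto
      have "x i \<in> A" for i using x(1) D(2) by blast
      then show "norm ((j \<circ> x) i) \<le> R" for i using R by (simp add: norm)
      show "\<delta> / 4 * (\<Sum>i<N. \<bar>c i\<bar>) \<le> norm (\<Sum>i<N. c i *\<^sub>R (j \<circ> x) i)" for N c
      proof -
        have "(\<Sum>i<N. c i *\<^sub>R (j \<circ> x) i) = j (\<Sum>i<N. c i *\<^sub>R x i)"
          by (simp add: linear_sum[OF lin] linear_scale[OF lin])
        then show ?thesis using separated_signs_lower_l1_estimate[OF x(3), of c N] by (simp add: norm)
      qed
    qed (use x(2) C in auto)
    then show thesis using j(2) by contradiction
  qed
qed

subsection \<open>Separability of the dual\<close>

text \<open>If \<open>g\<close> is nonzero at some \<open>x0\<close> in the common kernel of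
  \<open>G\<close>, subtracting the multiple of \<open>g\<close> that cancels \<open>f\<close> at
  \<open>x0\<close> leaves a functional vanishing on this kernel. Otherwise \<open>g\<close> adds no
  condition.\<close>

lemma blinfun_in_span_if_vanishes_on_kernels:
  fixes G :: "('a::real_normed_vector \<Rightarrow>\<^sub>L real) set"
  assumes "finite G" "\<And>x. (\<forall>g\<in>G. g x = 0) \<Longrightarrow> blinfun_apply f x = 0"
  shows "f \<in> span G"
  using assms
proof (induction G arbitrary: f rule: finite_induct)
  case empty
  then have "f = 0" by (intro blinfun_eqI) simp
  then show ?case by (simp add: span_zero)
next
  case (insert g G)
  show ?case
  proof (cases "\<exists>x. (\<forall>h\<in>G. h x = 0) \<and> g x \<noteq> 0")
    case True
    then obtain x0 where x0: "\<forall>h\<in>G. h x0 = 0" "g x0 \<noteq> 0" by blast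
    define c where "c = f x0 / g x0"
    have "f - c *\<^sub>R g \<in> span G"
    proof (rule insert.IH)
      fix x assume x: "\<forall>h\<in>G. blinfun_apply h x = 0"
      have "blinfun_apply f (x - (g x / g x0) *\<^sub>R x0) = 0"
        by (rule insert.prems) (use x x0 in \<open>auto simp: blinfun.bilinear_simps\<close>)
      then show "blinfun_apply (f - c *\<^sub>R g) x = 0"
        by (simp add: c_def blinfun.bilinear_simps mult.commute)
    qed
    then have "f - c *\<^sub>R g \<in> span (insert g G)" using span_mono[of G "insert g G"] by blast
    moreover have "c *\<^sub>R g \<in> span (insert g G)" by (intro span_scale span_base) simp
    ultimately have "(f - c *\<^sub>R g) + c *\<^sub>R g \<in> span (insert g G)" by (rule span_add)
    then show ?thesis by simp
  next
    case False
    have "f \<in> span G" by (rule insert.IH) (rule insert.prems, use False in auto)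
    then show ?thesis using span_mono[of G "insert g G"] by blast
  qed
qed

text \<open>The unit ball of the common kernel \<open>W\<close> of \<open>F n\<close> lies in the
  neighbourhood given by \<open>F n\<close>. A functional \<open>f\<close> below
  \<open>e / 2\<close> there thus has norm at most \<open>e / 2\<close> on \<open>W\<close>. A
  Hahn--Banach extension \<open>h\<close> of its restriction is equally small, and
  \<open>f - h\<close> vanishes on \<open>W\<close>, hence lies in the span of
  \<open>F n\<close>.\<close>

theorem separable_dual_if_countable_base:
  fixes F :: "nat \<Rightarrow> ('a::real_normed_vector \<Rightarrow> real) set" and \<epsilon> :: "nat \<Rightarrow> real"
  assumes F: "\<And>n. finite (F n)" "\<And>n \<phi>. \<phi> \<in> F n \<Longrightarrow> bounded_linear \<phi>" and \<epsilon>: "\<And>n. \<epsilon> n > 0"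
    and base: "\<And>(\<phi> :: 'a \<Rightarrow> real) e. bounded_linear \<phi> \<Longrightarrow> e > 0 \<Longrightarrow>
      \<exists>n. \<forall>x\<in>cball 0 1. (\<forall>g\<in>F n. \<bar>g x\<bar> < \<epsilon> n) \<longrightarrow> \<bar>\<phi> x\<bar> < e"
  shows "separable_space (euclidean :: ('a \<Rightarrow>\<^sub>L real) topology)"
proof -
  define G where "G n = Blinfun ` F n" for n
  have "countable (\<Union>n. G n)" using F(1) by (simp add: G_def countable_finite)
  then obtain D where D: "countable D" "span (\<Union>n. G n) \<subseteq> closure D"
    by (rule countable_dense_subset_span) auto
  have "f \<in> closure (span (\<Union>n. G n))" for f
    unfolding closure_approachable
  proof (intro allI impI)
    fix e :: real assume e: "e > 0"
    have "bounded_linear (blinfun_apply f)" by (rule blinfun.bounded_linear_right)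
    then have "\<exists>n. \<forall>x\<in>cball 0 1. (\<forall>g\<in>F n. \<bar>g x\<bar> < \<epsilon> n) \<longrightarrow> \<bar>f x\<bar> < e / 2"
      using e by (intro base) auto
    then obtain n where n: "\<And>x. x \<in> cball 0 1 \<Longrightarrow> (\<And>g. g \<in> F n \<Longrightarrow> \<bar>g x\<bar> < \<epsilon> n) \<Longrightarrow> \<bar>f x\<bar> < e / 2"
      by blast
    define W where "W = {x. \<forall>g\<in>F n. g x = 0}"
    have linF: "linear g" if "g \<in> F n" for g using F(2)[OF that] by (rule bounded_linear.linear)
    have W: "subspace W"
    proof (rule subspaceI)
      show "0 \<in> W" using linear_0[OF linF] by (simp add: W_def)
      fix x y c assume x: "x \<in> W"
      show "x + y \<in> W" if y: "y \<in> W"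
      proof -
        have "g (x + y) = 0" if "g \<in> F n" for g
        proof -
          have "g x = 0" "g y = 0" using x y that unfolding W_def by blast+
          then show ?thesis using linear_add[OF linF[OF that], of x y] by simp
        qed
        then show ?thesis by (simp add: W_def)
      qed
      have "g (c *\<^sub>R x) = 0" if "g \<in> F n" for g
        using linear_scale[OF linF[OF that], of c x] x that by (simp add: W_def)
      then show "c *\<^sub>R x \<in> W" by (simp add: W_def)
    qed
    have le: "f w \<le> e / 2 * norm w" if w: "w \<in> W" for w
    proof (cases "w = 0")
      case False
      have "\<bar>f (w /\<^sub>R norm w)\<bar> < e / 2"
      proof (rule n)
        show "w /\<^sub>R norm w \<in> cball 0 1" using False by simp
        fix g assume "g \<in> F n"
        then have "g (w /\<^sub>R norm w) = 0" using subspace_scale[OF W w] unfolding W_def by blast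
        then show "\<bar>g (w /\<^sub>R norm w)\<bar> < \<epsilon> n" using \<epsilon> by simp
      qed
      then show ?thesis
        using False by (simp add: blinfun.bilinear_simps abs_mult field_simps)
    qed simp
    obtain h where h: "bounded_linear h" "\<And>x. \<bar>h x\<bar> \<le> e / 2 * norm x" "\<And>w. w \<in> W \<Longrightarrow> h w = f w"
      by (rule functional_extension[OF W bounded_linear.linear[OF blinfun.bounded_linear_right[of f]], of "e / 2"])
        (use e le in auto)
    have h_apply: "blinfun_apply (Blinfun h) = h" using h(1) by (rule bounded_linear_Blinfun_apply)
    have "f - Blinfun h \<in> span (G n)"
    proof (rule blinfun_in_span_if_vanishes_on_kernels)
      show "finite (G n)" using F(1) by (simp add: G_def)
      fix x assume x: "\<forall>g\<in>G n. blinfun_apply g x = 0"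
      have "g x = 0" if "g \<in> F n" for g
      proof -
        have "blinfun_apply (Blinfun g) x = 0" using x that by (simp add: G_def)
        then show ?thesis by (simp add: bounded_linear_Blinfun_apply[OF F(2)[OF that]])
      qed
      then have "x \<in> W" by (simp add: W_def)
      then show "blinfun_apply (f - Blinfun h) x = 0"
        using h(3) by (simp add: blinfun.bilinear_simps h_apply)
    qed
    then have "f - Blinfun h \<in> span (\<Union>n. G n)"
      using span_mono[of "G n" "\<Union>n. G n"] by blast
    moreover have "dist (f - Blinfun h) f < e"
    proof -
      have "norm (Blinfun h) \<le> e / 2"
        by (rule norm_blinfun_bound) (use e h(2) in \<open>auto simp: h_apply\<close>)
      then show ?thesis using e by (simp add: dist_norm)
    qed
    ultimately show "\<exists>y\<in>span (\<Union>n. G n). dist y f < e" by blast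
  qed
  then have "closure D = UNIV"
    using closure_minimal[OF D(2) closed_closure] by blast
  then show ?thesis
    unfolding separable_space_def using D(1) by (intro exI[of _ D]) simp
qed

text \<open>
  The perturbations \<open>e / (n + 1)\<close> keep the terms away from \<open>0\<close>, so that a weakly null sequence of
  perturbed terms cannot stay in finitely many rows.
\<close>

lemma weakly_null_across_rows:
  fixes y :: "nat \<Rightarrow> nat \<Rightarrow> 'a::real_normed_vector"
  assumes FU: "\<And>A :: 'a set. bounded A \<Longrightarrow> 0 \<in> weak_topology closure_of A \<Longrightarrow>
      \<exists>x :: nat \<Rightarrow> 'a. range x \<subseteq> A \<and> limitin weak_topology x 0 sequentially"
    and y: "\<And>n k. norm (y n k) \<le> 1" "\<And>n. limitin weak_topology (y n) 0 sequentially"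
  obtains \<nu> \<kappa> where "filterlim \<nu> at_top sequentially"
    "limitin weak_topology (\<lambda>i. y (\<nu> i) (\<kappa> i)) 0 sequentially"
proof (cases "\<exists>e :: 'a. e \<noteq> 0")
  \<comment> \<open>The zero space has no unit vector to shift by, but its rows are constantly
    \<open>0\<close>.\<close>
  case False
  then have "y n k = 0" for n k by blast
  then have "limitin weak_topology (\<lambda>i. y i 0) 0 sequentially"
    by (simp add: limitin_weak_topology)
  then show thesis using that[of "\<lambda>i. i" "\<lambda>_. 0"] filterlim_ident by blast
next
  case True
  then obtain e0 :: 'a where "e0 \<noteq> 0" by blast
  define e where "e = sgn e0"
  have e: "norm e = 1" using \<open>e0 \<noteq> 0\<close> by (simp add: e_def norm_sgn)
  have lim_y: "(\<lambda>k. \<phi> (y n k)) \<longlonglongrightarrow> 0" if "bounded_linear \<phi>" for n and \<phi> :: "'a \<Rightarrow> real"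
    using y(2)[of n] that by (auto simp: limitin_weak_topology linear_0 bounded_linear.linear)
  obtain \<phi>0 where \<phi>0: "bounded_linear \<phi>0" "\<phi>0 e = norm e"
    by (rule norming_functional[of e])
  have lin0: "linear \<phi>0" using \<phi>0(1) by (rule bounded_linear.linear)
  define x where "x n = e /\<^sub>R real (Suc n)" for n
  \<comment> \<open>The value \<open>\<phi>0 (x n) = 1 / (n + 1)\<close> is twice the allowed
    perturbation, so \<open>\<phi>0\<close> stays above \<open>1 / (2 * (n + 1))\<close> on the
    elements from row \<open>n\<close>. This prevents a weakly null sequence in \<open>A\<close>
    from returning to one row infinitely often.\<close>
  define A where "A = {x n + y n k | n k. \<bar>\<phi>0 (y n k)\<bar> < 1 / (2 * real (Suc n))}"
  have "bounded A"
  proof -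
    have "norm (x n + y n k) \<le> 2" for n k
    proof -
      have "norm (x n) \<le> 1" using e by (simp add: x_def divide_simps)
      then show ?thesis using norm_triangle_ineq[of "x n" "y n k"] y(1)[of n k] by linarith
    qed
    then show ?thesis unfolding bounded_iff A_def by blast
  qed
  \<comment> \<open>\<open>0\<close> is an iterated limit: \<open>x n\<close> tends to
    \<open>0\<close> in norm, and each row tends to \<open>0\<close> weakly.\<close>
  moreover have "0 \<in> weak_topology closure_of A"
    unfolding zero_in_weak_closure
  proof (intro allI impI, elim conjE)
    fix F :: "('a \<Rightarrow> real) set" and \<epsilon> :: real
    assume F: "finite F" "\<forall>\<phi>\<in>F. bounded_linear \<phi>" "\<epsilon> > 0"
    obtain c where c: "c > 0" "\<And>\<phi> x. \<phi> \<in> F \<Longrightarrow> \<bar>\<phi> x\<bar> \<le> c * norm x"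
      by (rule finite_functionals_common_bound[OF F(1)]) (use F(2) in auto)
    obtain n where n: "inverse (real (Suc n)) < \<epsilon> / 2 / c"
      using reals_Archimedean[of "\<epsilon> / 2 / c"] F(3) c(1) by auto
    have x_small: "\<bar>\<phi> (x n)\<bar> < \<epsilon> / 2" if "\<phi> \<in> F" for \<phi>
    proof -
      have "\<bar>\<phi> (x n)\<bar> \<le> c * inverse (real (Suc n))"
        using c(2)[OF that, of "x n"] e by (simp add: x_def)
      also have "\<dots> < c * (\<epsilon> / 2 / c)" using n c(1) by (intro mult_strict_left_mono)
      also have "\<dots> = \<epsilon> / 2" using c(1) by simp
      finally show ?thesis .
    qed
    have "\<forall>\<^sub>F k in sequentially. \<forall>\<phi>\<in>F. dist (\<phi> (y n k)) 0 < \<epsilon> / 2"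
      using F lim_y by (intro eventually_ball_finite ballI tendstoD) auto
    moreover have "\<forall>\<^sub>F k in sequentially. dist (\<phi>0 (y n k)) 0 < 1 / (2 * real (Suc n))"
      using lim_y[OF \<phi>0(1), of n] by (rule tendstoD) simp
    ultimately have "\<forall>\<^sub>F k in sequentially. (\<forall>\<phi>\<in>F. dist (\<phi> (y n k)) 0 < \<epsilon> / 2) \<and>
        dist (\<phi>0 (y n k)) 0 < 1 / (2 * real (Suc n))"
      by (rule eventually_conj)
    then obtain k where k: "\<And>\<phi>. \<phi> \<in> F \<Longrightarrow> \<bar>\<phi> (y n k)\<bar> < \<epsilon> / 2" "\<bar>\<phi>0 (y n k)\<bar> < 1 / (2 * real (Suc n))"
      unfolding eventually_sequentially by (auto simp: dist_real_def)
    have "\<bar>\<phi> (x n + y n k)\<bar> < \<epsilon>" if "\<phi> \<in> F" for \<phi>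
    proof -
      have "\<phi> (x n + y n k) = \<phi> (x n) + \<phi> (y n k)"
        using F(2) that by (intro linear_add bounded_linear.linear) auto
      then show ?thesis using x_small[OF that] k(1)[OF that] by linarith
    qed
    moreover have "x n + y n k \<in> A" unfolding A_def using k(2) by blast
    ultimately show "\<exists>a\<in>A. \<forall>\<phi>\<in>F. \<bar>\<phi> a\<bar> < \<epsilon>" by blast
  qed
  ultimately obtain z :: "nat \<Rightarrow> 'a" where z: "range z \<subseteq> A" "limitin weak_topology z 0 sequentially"
    using FU by blast
  have "\<exists>n k. z i = x n + y n k \<and> \<bar>\<phi>0 (y n k)\<bar> < 1 / (2 * real (Suc n))" for i
    using z(1) unfolding A_def by blast
  then obtain \<nu> \<kappa> where z_eq: "\<And>i. z i = x (\<nu> i) + y (\<nu> i) (\<kappa> i)"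
    and small: "\<And>i. \<bar>\<phi>0 (y (\<nu> i) (\<kappa> i))\<bar> < 1 / (2 * real (Suc (\<nu> i)))"
    by metis
  have lim_z: "(\<lambda>i. \<phi> (z i)) \<longlonglongrightarrow> 0" if "bounded_linear \<phi>" for \<phi> :: "'a \<Rightarrow> real"
    using z(2) that by (auto simp: limitin_weak_topology linear_0 bounded_linear.linear)
  have lower: "1 / (2 * real (Suc (\<nu> i))) < \<phi>0 (z i)" for i
  proof -
    define t where "t = 1 / (2 * real (Suc (\<nu> i)))"
    have "inverse (real (Suc (\<nu> i))) = 2 * t" by (simp add: t_def divide_simps)
    then have "\<phi>0 (z i) = 2 * t + \<phi>0 (y (\<nu> i) (\<kappa> i))"
      using \<phi>0(2) e by (simp add: z_eq linear_add[OF lin0] x_def linear_scale[OF lin0])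
    moreover have "\<bar>\<phi>0 (y (\<nu> i) (\<kappa> i))\<bar> < t" using small[of i] by (simp add: t_def)
    ultimately have "t < \<phi>0 (z i)" by linarith
    then show ?thesis by (simp add: t_def)
  qed
  have \<nu>: "filterlim \<nu> at_top sequentially"
    unfolding filterlim_at_top
  proof
    fix n
    have "\<forall>\<^sub>F i in sequentially. \<phi>0 (z i) < 1 / (2 * real (Suc n))"
      using lim_z[OF \<phi>0(1)] by (rule order_tendstoD(2)) simp
    then show "\<forall>\<^sub>F i in sequentially. n \<le> \<nu> i"
    proof eventually_elim
      case (elim i)
      then have "1 / (2 * real (Suc (\<nu> i))) < 1 / (2 * real (Suc n))" using lower[of i] by linarith
      then show ?case by (simp add: divide_simps)
    qed
  qed
  \<comment> \<open>The shifts \<open>x (\<nu> i)\<close> tend to \<open>0\<close> because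
    \<open>\<nu>\<close> tends to infinity, so removing them keeps the sequence weakly null.\<close>
  moreover have "limitin weak_topology (\<lambda>i. y (\<nu> i) (\<kappa> i)) 0 sequentially"
    unfolding limitin_weak_topology
  proof (intro allI impI)
    fix \<phi> :: "'a \<Rightarrow> real" assume \<phi>: "bounded_linear \<phi>"
    have lin: "linear \<phi>" using \<phi> by (rule bounded_linear.linear)
    have "(\<lambda>i. inverse (real (Suc (\<nu> i)))) \<longlonglongrightarrow> 0"
      by (rule filterlim_compose[OF LIMSEQ_inverse_real_of_nat \<nu>])
    then have "(\<lambda>i. \<phi> (z i) - inverse (real (Suc (\<nu> i))) * \<phi> e) \<longlonglongrightarrow> 0 - 0 * \<phi> e"
      by (intro tendsto_diff lim_z[OF \<phi>] tendsto_mult tendsto_const)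
    moreover have "\<phi> (z i) - inverse (real (Suc (\<nu> i))) * \<phi> e = \<phi> (y (\<nu> i) (\<kappa> i))" for i
      by (simp add: z_eq linear_add[OF lin] x_def linear_scale[OF lin])
    ultimately show "(\<lambda>i. \<phi> (y (\<nu> i) (\<kappa> i))) \<longlonglongrightarrow> \<phi> 0"
      by (simp add: linear_0[OF lin])
  qed
  ultimately show thesis by (rule that)
qed

text \<open>
  The limits in \<open>M\<close> of the images \<open>s \<circ> y\<close> of weakly null sequences \<open>y\<close> form a precompact set \<open>P\<close>,
  and the preimages under \<open>s\<close> of the metric neighbourhoods of \<open>P\<close> form a countable base at \<open>0\<close>.
\<close>

theorem separable_dual_if_cs_star_metrizable_unit_ball:
  assumes FU: "\<And>A :: 'a::real_normed_vector set. bounded A \<Longrightarrow> 0 \<in> weak_topology closure_of A \<Longrightarrow>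
      \<exists>x :: nat \<Rightarrow> 'a. range x \<subseteq> A \<and> limitin weak_topology x 0 sequentially"
    and cs_star: "cs_star_metrizable (subtopology weak_topology (cball (0 :: 'a) 1))"
  shows "separable_space (euclidean :: ('a \<Rightarrow>\<^sub>L real) topology)"
proof -
  let ?B = "cball (0 :: 'a) 1"
  obtain M :: "(nat \<Rightarrow> 'a) topology" and f s where M: "metrizable_space M"
    and fB: "continuous_map M (subtopology weak_topology ?B) f"
    and sec: "section_of M (subtopology weak_topology ?B) f s"
    and cs: "cs_star_continuous_map (subtopology weak_topology ?B) M s"
    using cs_star unfolding cs_star_metrizable_def by auto
  obtain S d where Sd: "Metric_space S d" "M = Metric_space.mtopology S d"
    using M unfolding metrizable_space_def by blast
  interpret Metric_space S d by (rule Sd(1))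
  have f: "continuous_map mtopology weak_topology f"
    using fB unfolding Sd(2) continuous_map_in_subtopology by blast
  have s: "s x \<in> S" "f (s x) = x" if "x \<in> ?B" for x
    using sec that by (auto simp: section_of_def Sd(2))
  define null where "null y \<longleftrightarrow> (\<forall>k. y k \<in> ?B) \<and> limitin weak_topology y 0 sequentially"
    for y :: "nat \<Rightarrow> 'a"
  have null_subseq: "null (y \<circ> r)" if "null y" "strict_mono r" for y r
    using that limitin_subsequence[of r weak_topology y 0] by (auto simp: null_def)
  define P where "P = {a. \<exists>y. null y \<and> limitin mtopology (s \<circ> y) a sequentially}"
  have cluster: "\<exists>a r. a \<in> P \<and> strict_mono r \<and> limitin mtopology (s \<circ> y \<circ> r) a sequentially"
    if y: "null y" for y
  proof -
    have "limitin (subtopology weak_topology ?B) y 0 sequentially"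
      using y unfolding limitin_subtopology null_def by auto
    then have "convergent_seq_in (subtopology weak_topology ?B) y"
      using y by (auto simp: convergent_seq_in_def null_def)
    then obtain a where a: "accumulation_point_in M (s \<circ> y) a"
      using cs by (auto simp: cs_star_continuous_map_def)
    have "range (s \<circ> y) \<subseteq> topspace M" using s(1) y by (auto simp: null_def Sd(2))
    then obtain r where r: "strict_mono r" "limitin M (s \<circ> y \<circ> r) a sequentially"
      using accumulation_point_in_metrizable_subseq[OF M a] by blast
    then have "limitin mtopology (s \<circ> (y \<circ> r)) a sequentially" by (simp add: Sd(2) comp_assoc)
    then have "a \<in> P" unfolding P_def using null_subseq[OF y r(1)] by blast
    then show ?thesis using r by (auto simp: Sd(2))
  qed
  have PS: "P \<subseteq> S" unfolding P_def using limitin_mspace by blast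
  have "precompact_in M P"
  proof -
    have "\<exists>b. accumulation_point_in M a b" if a: "range a \<subseteq> P" for a
    proof -
      \<comment> \<open>Dropping initial terms makes every lift of row \<open>n\<close> close to
        \<open>a n\<close>. All \<open>k\<close> are needed, since the position later selected
        within a row is not controlled.\<close>
      have "\<exists>y. null y \<and> (\<forall>k. d (s (y k)) (a n) < 1 / Suc n)" for n
      proof -
        have "a n \<in> P" using a by blast
        then obtain y where y: "null y" "limitin mtopology (s \<circ> y) (a n) sequentially"
          by (auto simp: P_def)
        then obtain N where N: "\<And>k. k \<ge> N \<Longrightarrow> d (s (y k)) (a n) < 1 / Suc n"
          unfolding limit_metric_sequentially by (metis comp_apply of_nat_0_less_iff zero_less_Suc zero_less_divide_1_iff)
        have "null (y \<circ> (\<lambda>k. k + N))" by (rule null_subseq[OF y(1)]) (simp add: strict_mono_def)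
        then show ?thesis using N by (intro exI[of _ "y \<circ> (\<lambda>k. k + N)"]) auto
      qed
      then obtain y where y: "\<And>n. null (y n)" "\<And>n k. d (s (y n k)) (a n) < 1 / Suc n" by metis
      have yB: "y n k \<in> ?B" for n k using y(1) by (simp add: null_def)
      \<comment> \<open>The lifts of a weakly null selection across the rows have a cluster point
        \<open>b\<close>. Since \<open>\<nu>\<close> tends to infinity, their distance to
        \<open>a (\<nu> i)\<close> tends to \<open>0\<close>, and \<open>b\<close> becomes an
        accumulation point of \<open>a\<close>.\<close>
      obtain \<nu> \<kappa> where \<nu>: "filterlim \<nu> at_top sequentially"
        "limitin weak_topology (\<lambda>i. y (\<nu> i) (\<kappa> i)) 0 sequentially"
        by (rule weakly_null_across_rows[of y, OF FU]) (use y(1) yB in \<open>auto simp: null_def\<close>)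
      then have "null (\<lambda>i. y (\<nu> i) (\<kappa> i))" using yB by (simp add: null_def)
      then obtain b r where r: "b \<in> P" "strict_mono r"
        "limitin mtopology (s \<circ> (\<lambda>i. y (\<nu> i) (\<kappa> i)) \<circ> r) b sequentially"
        using cluster by blast
      have \<nu>r: "filterlim (\<lambda>i. \<nu> (r i)) at_top sequentially"
        using filterlim_compose[OF \<nu>(1) filterlim_subseq[OF r(2)]] .
      have "accumulation_point_in mtopology a b"
        unfolding accumulation_point_in_def
      proof (intro conjI allI impI)
        show "b \<in> topspace mtopology" using r(1) PS by auto
        fix U assume U: "openin mtopology U \<and> b \<in> U"
        then obtain e where e: "e > 0" "mball b e \<subseteq> U" unfolding openin_mtopology by blast
        \<comment> \<open>The indices \<open>\<nu> (r i)\<close> may repeat; what counts is that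
          they exceed every \<open>m\<close>.\<close>
        show "infinite {n. a n \<in> U}"
          unfolding infinite_nat_iff_unbounded
        proof
          fix m
          have "\<forall>\<^sub>F i in sequentially. s (y (\<nu> (r i)) (\<kappa> (r i))) \<in> S \<and> d (s (y (\<nu> (r i)) (\<kappa> (r i)))) b < e / 2"
            using r(3) e(1) unfolding limitin_metric by (auto dest: spec[of _ "e / 2"])
          moreover have "\<forall>\<^sub>F i in sequentially. 1 / Suc (\<nu> (r i)) < e / 2"
            using order_tendstoD(2)[OF filterlim_compose[OF LIMSEQ_inverse_real_of_nat \<nu>r], of "e / 2"] e(1)
            by (simp add: inverse_eq_divide)
          moreover have "\<forall>\<^sub>F i in sequentially. Suc m \<le> \<nu> (r i)"
            using \<nu>r unfolding filterlim_at_top by blast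
          ultimately have "\<forall>\<^sub>F i in sequentially. \<nu> (r i) > m \<and> a (\<nu> (r i)) \<in> U"
          proof eventually_elim
            case (elim i)
            have aS: "a (\<nu> (r i)) \<in> S" using a PS by blast
            have bS: "b \<in> S" using r(1) PS by blast
            have "d b (a (\<nu> (r i))) \<le> d b (s (y (\<nu> (r i)) (\<kappa> (r i)))) + d (s (y (\<nu> (r i)) (\<kappa> (r i)))) (a (\<nu> (r i)))"
              using triangle elim(1) aS bS by blast
            moreover have "d (s (y (\<nu> (r i)) (\<kappa> (r i)))) (a (\<nu> (r i))) < 1 / Suc (\<nu> (r i))" by (rule y(2))
            ultimately have "d b (a (\<nu> (r i))) < e"
              using elim commute[of b "s (y (\<nu> (r i)) (\<kappa> (r i)))"] by linarith
            then have "a (\<nu> (r i)) \<in> mball b e" using aS bS by simp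
            then show ?case using elim(3) e(2) by auto
          qed
          then obtain i where "\<nu> (r i) > m" "a (\<nu> (r i)) \<in> U"
            using eventually_happens'[OF sequentially_bot] by blast
          then show "\<exists>n>m. n \<in> {n. a n \<in> U}" by blast
        qed
      qed
      then show ?thesis unfolding Sd(2) by blast
    qed
    moreover have "P \<subseteq> topspace M" using PS by (simp add: Sd(2))
    ultimately show ?thesis using precompact_in_metrizable_sequentially[OF M] by blast
  qed
  define C where "C = mtopology closure_of P"
  have C: "compactin mtopology C"
    using \<open>precompact_in M P\<close> by (simp add: precompact_in_def C_def Sd(2))
  have PC: "P \<subseteq> C" unfolding C_def using PS by (simp add: closure_of_subset)
  have CS: "C \<subseteq> S" using compactin_subset_topspace[OF C] by simp
  \<comment> \<open>As \<open>f\<close> inverts \<open>s\<close> on the ball, \<open>f a\<close> is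
    the weak limit of a null sequence. The fibre over \<open>0\<close> is closed, so this extends
    from \<open>P\<close> to \<open>C\<close>.\<close>
  have f_zero: "f c = 0" if "c \<in> C" for c
  proof -
    have "f a = 0" if a: "a \<in> P" for a
    proof -
      have "\<exists>y. null y \<and> limitin mtopology (s \<circ> y) a sequentially"
        using a unfolding P_def by (rule CollectD)
      then obtain y where y: "null y" "limitin mtopology (s \<circ> y) a sequentially" by (elim exE conjE)
      have "limitin weak_topology (f \<circ> (s \<circ> y)) (f a) sequentially"
        using f y(2) by (rule continuous_map_limit)
      moreover have "f \<circ> (s \<circ> y) = y"
        using y(1) s(2) by (simp add: null_def fun_eq_iff del: mem_cball_0)
      ultimately have lim: "limitin weak_topology y (f a) sequentially" by simp
      have "limitin weak_topology y 0 sequentially" using y(1) by (simp add: null_def)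
      then show ?thesis
        by (rule limitin_Hausdorff_unique[OF lim _ _ Hausdorff_space_weak_topology]) simp
    qed
    moreover have "closedin mtopology {x \<in> topspace mtopology. f x \<in> {0}}"
      by (rule closedin_continuous_map_preimage[OF f closedin_Hausdorff_singleton[OF Hausdorff_space_weak_topology]]) simp
    ultimately have "C \<subseteq> {x \<in> topspace mtopology. f x \<in> {0}}"
      unfolding C_def using PS by (intro closure_of_minimal) auto
    then show ?thesis using that by blast
  qed
  define W where "W n = {m \<in> S. \<exists>c\<in>C. d c m < 1 / Suc n}" for n :: nat
  \<comment> \<open>Otherwise some null sequence would have all its lifts outside
    \<open>W n\<close>, although a subsequence of the lifts converges to a point of
    \<open>P\<close>.\<close>
  have not_closure: "0 \<notin> weak_topology closure_of {x \<in> ?B. s x \<notin> W n}" for n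
  proof
    assume *: "0 \<in> weak_topology closure_of {x \<in> ?B. s x \<notin> W n}"
    have "bounded {x \<in> ?B. s x \<notin> W n}" by (rule bounded_subset[OF bounded_cball[of 0 1]]) auto
    then obtain y where y: "range y \<subseteq> {x \<in> ?B. s x \<notin> W n}" "limitin weak_topology y 0 sequentially"
      using FU * by blast
    then have "null y" by (auto simp: null_def)
    then obtain a r where a: "a \<in> P" "limitin mtopology (s \<circ> y \<circ> r) a sequentially"
      using cluster by blast
    then have "\<forall>\<^sub>F i in sequentially. (s \<circ> y \<circ> r) i \<in> S \<and> d ((s \<circ> y \<circ> r) i) a < 1 / Suc n"
      unfolding limitin_metric by (auto dest: spec[of _ "1 / Suc n"])
    then obtain i where "s (y (r i)) \<in> S" "d (s (y (r i))) a < 1 / Suc n"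
      using eventually_happens'[OF sequentially_bot] by force
    then have "s (y (r i)) \<in> W n"
      unfolding W_def using a(1) PC by (auto simp: commute)
    then show False using y(1) by blast
  qed
  have "\<exists>F \<epsilon>. finite F \<and> (\<forall>\<phi>\<in>F. bounded_linear (\<phi> :: 'a \<Rightarrow> real)) \<and> \<epsilon> > 0 \<and>
      (\<forall>x\<in>?B. (\<forall>\<phi>\<in>F. \<bar>\<phi> x\<bar> < \<epsilon>) \<longrightarrow> s x \<in> W n)" for n
  proof (rule ccontr)
    assume neg: "\<not> ?thesis"
    have "\<exists>x\<in>{x \<in> ?B. s x \<notin> W n}. \<forall>\<phi>\<in>F. \<bar>\<phi> x\<bar> < \<epsilon>"
      if "finite F \<and> (\<forall>\<phi>\<in>F. bounded_linear (\<phi> :: 'a \<Rightarrow> real)) \<and> \<epsilon> > 0" for F \<epsilon>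
    proof -
      have "\<not> (\<forall>x\<in>?B. (\<forall>\<phi>\<in>F. \<bar>\<phi> x\<bar> < \<epsilon>) \<longrightarrow> s x \<in> W n)"
        using neg that by (simp only: not_ex) metis
      then show ?thesis by blast
    qed
    then have "0 \<in> weak_topology closure_of {x \<in> ?B. s x \<notin> W n}"
      unfolding zero_in_weak_closure by (intro allI impI)
    then show False using not_closure by contradiction
  qed
  then obtain F :: "nat \<Rightarrow> ('a \<Rightarrow> real) set" and \<epsilon> :: "nat \<Rightarrow> real" where F:
    "\<And>n. finite (F n)" "\<And>n \<phi>. \<phi> \<in> F n \<Longrightarrow> bounded_linear \<phi>" "\<And>n. \<epsilon> n > 0"
    "\<And>n x. x \<in> ?B \<Longrightarrow> (\<And>\<phi>. \<phi> \<in> F n \<Longrightarrow> \<bar>\<phi> x\<bar> < \<epsilon> n) \<Longrightarrow> s x \<in> W n"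
    by metis
  show ?thesis
  proof (rule separable_dual_if_countable_base[OF F(1,2,3)])
    fix \<phi> :: "'a \<Rightarrow> real" and e :: real
    assume \<phi>: "bounded_linear \<phi>" and e: "e > 0"
    \<comment> \<open>Here the compactness of \<open>C\<close> is used: \<open>V\<close> is an open
      set containing \<open>C\<close>, and a Lebesgue number for it leaves room for one of the
      countably many radii \<open>1 / (n + 1)\<close>.\<close>
    define V where "V = {m \<in> topspace mtopology. (\<phi> \<circ> f) m \<in> ball 0 e}"
    have "openin mtopology V"
      unfolding V_def using continuous_map_compose[OF f continuous_map_weak_functional[OF \<phi>]]
      by (rule openin_continuous_map_preimage) simp
    moreover have "C \<subseteq> V"
      using CS f_zero e by (auto simp: V_def linear_0[OF bounded_linear.linear[OF \<phi>]])
    ultimately obtain \<rho> where \<rho>: "\<rho> > 0" "\<And>c. c \<in> C \<Longrightarrow> mball c \<rho> \<subseteq> V"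
      using lebesgue_number[OF C, of "{V}"] by auto
    obtain n where n: "1 / real (Suc n) < \<rho>"
      using reals_Archimedean[OF \<rho>(1)] by (auto simp: inverse_eq_divide)
    have "\<bar>\<phi> x\<bar> < e" if x: "x \<in> ?B" "\<forall>g\<in>F n. \<bar>g x\<bar> < \<epsilon> n" for x
    proof -
      have "s x \<in> W n" using F(4) x by blast
      then obtain c where "c \<in> C" "d c (s x) < 1 / Suc n" "s x \<in> S" by (auto simp: W_def)
      then have "s x \<in> mball c \<rho>" using CS n by auto
      then have "s x \<in> V" using \<rho>(2) \<open>c \<in> C\<close> by blast
      then show ?thesis using s(2)[OF x(1)] by (simp add: V_def)
    qed
    then show "\<exists>n. \<forall>x\<in>?B. (\<forall>g\<in>F n. \<bar>g x\<bar> < \<epsilon> n) \<longrightarrow> \<bar>\<phi> x\<bar> < e" by blast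
  qed
qed

section \<open>Equivalence of the conditions\<close>

theorem theorem12p3:
  fixes X :: "'a::real_normed_vector topology" and B :: "'a topology"
    and j :: "'a \<Rightarrow> 'c::banach" and C :: "'c set"
  assumes X: "X = weak_topology"
    and B: "B = subtopology weak_topology (cball 0 1)"
  shows
    "((k_star_metrizable X \<longleftrightarrow> cs_star_metrizable X) \<and>
      (cs_star_metrizable X \<longleftrightarrow> k_star_metrizable B) \<and>
      (k_star_metrizable B \<longleftrightarrow> cs_star_metrizable B)) \<and>
     (is_completion j C \<and> \<not> contains_copy_of_l1 C \<longrightarrow>
      (k_star_metrizable X \<longleftrightarrow> cs_metrizable B) \<and>
      (cs_metrizable B \<longleftrightarrow> k_metrizable B) \<and>
      (k_metrizable B \<longleftrightarrow> metrizable_space B) \<and>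
      (metrizable_space B \<longleftrightarrow> separable_space (euclidean :: ('a \<Rightarrow>\<^sub>L real) topology)))"
proof -
  have "closedin (weak_topology :: 'a topology) UNIV"
    using closedin_topspace[of "weak_topology :: 'a topology"] by simp
  then have X_iff: "k_star_metrizable X \<longleftrightarrow> cs_star_metrizable X"
    using k_star_iff_cs_star_metrizable_weak_closed[of "UNIV :: 'a set"] by (simp add: X)
  have B_iff: "k_star_metrizable B \<longleftrightarrow> cs_star_metrizable B"
    unfolding B by (rule k_star_iff_cs_star_metrizable_weak_closed[OF closedin_weak_cball])
  have XB_iff: "cs_star_metrizable X \<longleftrightarrow> cs_star_metrizable B"
    unfolding X B using cs_star_metrizable_closed_subspace[OF _ closedin_weak_cball]
      cs_star_metrizable_weak_if_unit_ball by blast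
  \<comment> \<open>The absence of \<open>l1\<close> enters in this implication, which closes the
    cycle: a separable dual makes the ball metrizable, and both k-metrizability and cs-metrizability
    lead back to cs*-metrizability.\<close>
  have "cs_star_metrizable B \<longrightarrow> separable_space (euclidean :: ('a \<Rightarrow>\<^sub>L real) topology)"
    if j: "is_completion j C" "\<not> contains_copy_of_l1 C"
  proof
    assume cs: "cs_star_metrizable B"
    show "separable_space (euclidean :: ('a \<Rightarrow>\<^sub>L real) topology)"
    proof (rule separable_dual_if_cs_star_metrizable_unit_ball)
      fix A :: "'a set" assume "bounded A" "0 \<in> weak_topology closure_of A"
      then show "\<exists>x :: nat \<Rightarrow> 'a. range x \<subseteq> A \<and> limitin weak_topology x 0 sequentially"
        using weakly_null_sequence_in_weak_closure[OF j] by metis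
    qed (use cs B in simp)
  qed
  moreover have "metrizable_space B" if "separable_space (euclidean :: ('a \<Rightarrow>\<^sub>L real) topology)"
    unfolding B using that by (rule metrizable_weak_unit_ball_if_separable_dual)
  moreover have "metrizable_space B \<longrightarrow> k_metrizable B \<and> cs_metrizable B"
    using metrizable_imp_k_metrizable metrizable_imp_cs_metrizable by blast
  moreover have "k_metrizable B \<longrightarrow> cs_star_metrizable B" "cs_metrizable B \<longrightarrow> cs_star_metrizable B"
    using k_metrizable_imp_k_star_metrizable B_iff cs_metrizable_imp_cs_star_metrizable by blast+
  ultimately show ?thesis using X_iff B_iff XB_iff by blast
qed

end
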